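(* Let $|\psi_1\rangle,|\psi_2\rangle$ be orthonormal continuous matrix product states (cMPS) in the bosonic Fock space over $L^2(I)$, $|\psi_i\rangle=|\psi[B_i,Q_i,L_i]\rangle$ with bond dimension $D_i$, and let $V\in U(2)$ be a unitary $2\times2$ matrix. Then $$U=\mathbb 1+\sum_{i,j=1}^2\big(V_{ij}-\delta_{ij}\big)|\psi_i\rangle\langle\psi_j|$$ is a unitary continuous matrix product operator (cMPU) with bond dimension $D=1+\sum_{i,j=1}^2D_iD_j$.
   Context: Setting. $I=[x_-,x_+]=[-\ell/2,\ell/2]$ is an interval, $\mathfrak F=\bigoplus_{N\ge 0} L^2(I)^{\odot N}$ is the bosonic Fock space, $\psi(x)$ is the bosonic field operator with $[\psi(x),\psi^\dagger(y)]=\delta(x-y)$, and $|\Omega\rangle$ is the Fock vacuum. For a matrix-valued function $Q$, $V_x^y=\mathcal P\exp\int_x^y Q(z)\,dz$, ordered so that $\partial_yV_x^y=V_x^yQ(y)$, $V_x^yV_y^z=V_x^z$; $V_i^{i+1}=V_{x_i}^{x_{i+1}}$, $V_-^1=V_{x_-}^{x_1}$, $V_n^+=V_{x_n}^{x_+}$. Matrix-valued functions are assumed regular enough that all expressions make sense. cMPS. For $B\in M_D(\mathbb C)$ and $Q,L:I\to M_D(\mathbb C)$, the cMPS with bond dimension $D$ is $$|\psi[B,Q,L]\rangle=\sum_{j\ge0}\int_{x_1<\dots<x_j}\! d^jx\ \mathrm{Tr}\big(BV_-^1L(x_1)V_1^2\cdots L(x_j)V_j^+\big)\psi^\dagger(x_1)\cdots\psi^\dagger(x_j)|\Omega\rangle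 .$$ cMPO. For $B\in M_D(\mathbb C)$ and $Q,L,R,T:I\to M_D(\mathbb C)$, the cMPO with bond dimension $D$ is $$O[B,Q,L,R,T]=\mathrm{Tr}_D\Big(B\,\mathcal P e^{\int_I dx\,(Q(x)\otimes \mathrm{Id}+L(x)\otimes l_x+R(x)\otimes r_x+T(x)\otimes \mathrm{Ad}_x)}\Big)\big(|\Omega\rangle\langle\Omega|\big),$$ with supermaps $l_x[X]=\psi^\dagger(x)X$, $r_x[X]=X\psi(x)$, $\mathrm{Ad}_x[X]=\psi^\dagger(x)X\psi(x)$, $\mathrm{Id}[X]=X$; i.e. the Dyson expansion $$O=\sum_{n\ge0}\ \sum_{\alpha\in\{L,R,A\}^n}\int_{x_1<\dots<x_n}\! d^nx\ \mathrm{Tr}\big(B\,V_-^1K^{\alpha_1}(x_1)V_1^2\cdots K^{\alpha_n}(x_n)V_n^+\big)\; s^{\alpha_1}_{x_1}\cdots s^{\alpha_n}_{x_n}\big[|\Omega\rangle\langle\Omega|\big],$$ with $K^L=L$, $K^R=R$, $K^A=T$, $s^L_x=l_x$, $s^R_x=r_x$, $s^A_x=\mathrm{Ad}_x$. Operators are understood through their matrix elements between particle-number sectors. A cMPU is a unitary cMPO. "With bond dimension $D$" means that the operator admits a representation with $D\times D$ matrices (not asserted minimal). *)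

theory Defs
  imports
    "HOL-Analysis.Analysis"
    "HOL-Combinatorics.Permutations"
    "Jordan_Normal_Form.Schur_Decomposition"
begin

section \<open>Bosonic Fock space over \<open>L\<^sup>2(I)\<close>\<close>

definition seg :: "real \<Rightarrow> real set" where
  "seg l = {- l / 2 .. l / 2}"

definition seg_pow :: "real \<Rightarrow> nat \<Rightarrow> (nat \<Rightarrow> real) measure" where
  "seg_pow l n = (\<Pi>\<^sub>M i\<in>{..<n}. restrict_space lborel (seg l))"

text \<open>
  A Fock vector is the sequence of its \<open>n\<close>-particle wave functions. Elements of \<open>L\<^sup>2\<close> are
  represented by functions, to be identified when they agree almost everywhere (\<open>fock_eq\<close>).
\<close>

type_synonym fock = "nat \<Rightarrow> (nat \<Rightarrow> real) \<Rightarrow> complex"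

definition fock_space :: "real \<Rightarrow> fock set" where
  "fock_space l = {\<Phi>.
     (\<forall>n. \<Phi> n \<in> borel_measurable (seg_pow l n) \<and>
          (\<forall>p. p permutes {..<n} \<longrightarrow> (AE x in seg_pow l n. \<Phi> n (x \<circ> p) = \<Phi> n x)) \<and>
          integrable (seg_pow l n) (\<lambda>x. (cmod (\<Phi> n x))\<^sup>2)) \<and>
     summable (\<lambda>n. LINT x|seg_pow l n. (cmod (\<Phi> n x))\<^sup>2)}"

definition fock_eq :: "real \<Rightarrow> fock \<Rightarrow> fock \<Rightarrow> bool" where
  "fock_eq l \<Phi> \<Psi> \<longleftrightarrow> (\<forall>n. AE x in seg_pow l n. \<Phi> n x = \<Psi> n x)"

definition fock_inner :: "real \<Rightarrow> fock \<Rightarrow> fock \<Rightarrow> complex" where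
  "fock_inner l \<Phi> \<Psi> = (\<Sum>n. LINT x|seg_pow l n. cnj (\<Phi> n x) * \<Psi> n x)"

definition sector :: "nat \<Rightarrow> fock \<Rightarrow> fock" where
  "sector N \<Phi> = (\<lambda>n x. if n = N then \<Phi> n x else 0)"

definition ket_bra :: "real \<Rightarrow> fock \<Rightarrow> fock \<Rightarrow> fock \<Rightarrow> fock" where
  "ket_bra l \<phi> \<eta> \<Psi> = (\<lambda>n x. fock_inner l \<eta> \<Psi> * \<phi> n x)"

definition fock_unitary :: "real \<Rightarrow> (fock \<Rightarrow> fock) \<Rightarrow> bool" where
  "fock_unitary l U \<longleftrightarrow>
     (\<forall>\<Phi>\<in>fock_space l. U \<Phi> \<in> fock_space l) \<and>
     (\<forall>\<Phi>\<in>fock_space l. \<forall>\<Psi>\<in>fock_space l. fock_eq l \<Phi> \<Psi> \<longrightarrow> fock_eq l (U \<Phi>) (U \<Psi>)) \<and>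
     (\<forall>\<Phi>\<in>fock_space l. \<forall>\<Psi>\<in>fock_space l. \<forall>c.
        fock_eq l (U (\<lambda>n x. c * \<Phi> n x + \<Psi> n x)) (\<lambda>n x. c * U \<Phi> n x + U \<Psi> n x)) \<and>
     (\<forall>\<Phi>\<in>fock_space l. \<forall>\<Psi>\<in>fock_space l. fock_inner l (U \<Phi>) (U \<Psi>) = fock_inner l \<Phi> \<Psi>) \<and>
     (\<forall>\<Phi>\<in>fock_space l. \<exists>\<Psi>\<in>fock_space l. fock_eq l (U \<Psi>) \<Phi>)"

text \<open>
  \<open>vac_amp \<Phi> [y\<^sub>1, \<dots>, y\<^sub>n]\<close> is \<open>\<langle>\<Omega>|\<psi>(y\<^sub>1)\<cdots>\<psi>(y\<^sub>n)|\<Phi>\<rangle>\<close>; the factor \<open>\<surd>n!\<close> is forced by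
  \<open>[\<psi>(x), \<psi>\<^sup>\<dagger>(y)] = \<delta>(x - y)\<close> and the unweighted norm of \<open>L\<^sup>2(I\<^sup>n)\<close> used in \<open>fock_inner\<close>.
\<close>

definition vac_amp :: "fock \<Rightarrow> real list \<Rightarrow> complex" where
  "vac_amp \<Phi> ys =
     complex_of_real (sqrt (fact (length ys))) * \<Phi> (length ys) (\<lambda>i\<in>{..<length ys}. ys ! i)"


section \<open>Matrix-valued functions and path-ordered exponentials\<close>

definition mat_trace :: "complex mat \<Rightarrow> complex" where
  "mat_trace A = (\<Sum>i<dim_row A. A $$ (i, i))"

text \<open>
  Regularity: \<open>Q \<in> L\<^sup>1\<close>, \<open>L, R \<in> L\<^sup>2\<close> and \<open>T \<in> L\<^sup>\<infinity>\<close> entrywise. These make the path-ordered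
  exponential, the state and all matrix elements between \<open>L\<^sup>2\<close> wave functions absolutely convergent.
\<close>

definition mat_fun :: "real \<Rightarrow> nat \<Rightarrow> ((real \<Rightarrow> complex) \<Rightarrow> bool) \<Rightarrow> (real \<Rightarrow> complex mat) \<Rightarrow> bool" where
  "mat_fun l D P F \<longleftrightarrow> (\<forall>x\<in>seg l. F x \<in> carrier_mat D D) \<and>
     (\<forall>i<D. \<forall>j<D. P (\<lambda>x. F x $$ (i, j)))"

definition L1 :: "real \<Rightarrow> (real \<Rightarrow> complex) \<Rightarrow> bool" where
  "L1 l f \<longleftrightarrow> set_integrable lborel (seg l) f"

definition L2 :: "real \<Rightarrow> (real \<Rightarrow> complex) \<Rightarrow> bool" where
  "L2 l f \<longleftrightarrow> set_borel_measurable lborel (seg l) f \<and>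
     set_integrable lborel (seg l) (\<lambda>x. (cmod (f x))\<^sup>2)"

definition Linf :: "real \<Rightarrow> (real \<Rightarrow> complex) \<Rightarrow> bool" where
  "Linf l f \<longleftrightarrow> set_borel_measurable lborel (seg l) f \<and>
     (\<exists>C. AE x in lborel. x \<in> seg l \<longrightarrow> cmod (f x) \<le> C)"

text \<open>
  \<open>path_exp D Q x y\<close>, for \<open>x \<le> y\<close>, is \<open>V\<^sub>x\<^sup>y\<close>. Its \<open>n\<close>-th term is the integral of
  \<open>Q(z\<^sub>1)\<cdots>Q(z\<^sub>n)\<close> over \<open>x < z\<^sub>1 < \<dots> < z\<^sub>n < y\<close>.
\<close>

fun path_exp_term :: "nat \<Rightarrow> (real \<Rightarrow> complex mat) \<Rightarrow> nat \<Rightarrow> real \<Rightarrow> real \<Rightarrow> complex mat" where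
  "path_exp_term D Q 0 x y = 1\<^sub>m D"
| "path_exp_term D Q (Suc n) x y =
     Matrix.mat D D (\<lambda>(i, j). LINT z:{x..y}|lborel. (path_exp_term D Q n x z * Q z) $$ (i, j))"

definition path_exp :: "nat \<Rightarrow> (real \<Rightarrow> complex mat) \<Rightarrow> real \<Rightarrow> real \<Rightarrow> complex mat" where
  "path_exp D Q x y = Matrix.mat D D (\<lambda>(i, j). \<Sum>n. path_exp_term D Q n x y $$ (i, j))"

text \<open>
  \<open>mat_string D Q a b [(x\<^sub>1, K\<^sub>1), \<dots>, (x\<^sub>n, K\<^sub>n)]\<close> is
  \<open>V\<^sub>a\<^sup>1 K\<^sub>1 V\<^sub>1\<^sup>2 K\<^sub>2 \<cdots> K\<^sub>n V\<^sub>n\<^sup>b\<close>.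
\<close>

fun mat_string :: "nat \<Rightarrow> (real \<Rightarrow> complex mat) \<Rightarrow> real \<Rightarrow> real \<Rightarrow> (real \<times> complex mat) list \<Rightarrow> complex mat" where
  "mat_string D Q a b [] = path_exp D Q a b"
| "mat_string D Q a b ((x, K) # ks) = path_exp D Q a x * K * mat_string D Q x b ks"


section \<open>Continuous matrix product states\<close>

text \<open>
  The vector \<open>\<integral>\<^bsub>x\<^sub>1<\<dots><x\<^sub>n\<^esub> f(x) \<psi>\<^sup>\<dagger>(x\<^sub>1)\<cdots>\<psi>\<^sup>\<dagger>(x\<^sub>n)|\<Omega>\<rangle>\<close> has the symmetric
  wave function that takes the value \<open>f(x\<^sub>1,\<dots>,x\<^sub>n) / \<surd>n!\<close> at every rearrangement
  of \<open>x\<^sub>1 < \<dots> < x\<^sub>n\<close>.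
\<close>

definition cmps :: "real \<Rightarrow> nat \<Rightarrow> complex mat \<Rightarrow> (real \<Rightarrow> complex mat) \<Rightarrow> (real \<Rightarrow> complex mat) \<Rightarrow> fock" where
  "cmps l D B Q L = (\<lambda>n x.
     mat_trace (B * mat_string D Q (- l / 2) (l / 2)
       (map (\<lambda>y. (y, L y)) (sort (map x [0..<n]))))
     / complex_of_real (sqrt (fact n)))"

definition cmps_data :: "real \<Rightarrow> nat \<Rightarrow> complex mat \<Rightarrow> (real \<Rightarrow> complex mat) \<Rightarrow> (real \<Rightarrow> complex mat) \<Rightarrow> bool" where
  "cmps_data l D B Q L \<longleftrightarrow>
     B \<in> carrier_mat D D \<and> mat_fun l D (L1 l) Q \<and> mat_fun l D (L2 l) L"


section \<open>Continuous matrix product operators\<close>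

datatype leg = Left_leg | Right_leg | Ad_leg

fun leg_mat :: "'a \<Rightarrow> 'a \<Rightarrow> 'a \<Rightarrow> leg \<Rightarrow> 'a" where
  "leg_mat L R T Left_leg = L"
| "leg_mat L R T Right_leg = R"
| "leg_mat L R T Ad_leg = T"

text \<open>
  Applying the supermaps of \<open>\<alpha>\<close> at \<open>x\<^sub>1 < \<dots> < x\<^sub>n\<close> to \<open>|\<Omega>\<rangle>\<langle>\<Omega>|\<close> puts a \<open>\<psi>\<^sup>\<dagger>(x\<^sub>i)\<close> on the left for the
  indices \<open>i\<close> of type \<open>L\<close> or \<open>Ad\<close>, and a \<open>\<psi>(x\<^sub>i)\<close> on the right for those of type \<open>R\<close> or \<open>Ad\<close>.
\<close>

definition ket_points :: "leg list \<Rightarrow> (nat \<Rightarrow> real) \<Rightarrow> real list" where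
  "ket_points \<alpha> x = map x (filter (\<lambda>i. \<alpha> ! i \<noteq> Right_leg) [0..<length \<alpha>])"

definition bra_points :: "leg list \<Rightarrow> (nat \<Rightarrow> real) \<Rightarrow> real list" where
  "bra_points \<alpha> x = map x (filter (\<lambda>i. \<alpha> ! i \<noteq> Left_leg) [0..<length \<alpha>])"

definition ordered_points :: "nat \<Rightarrow> (nat \<Rightarrow> real) set" where
  "ordered_points n = {x. \<forall>i j. i < j \<longrightarrow> j < n \<longrightarrow> x i < x j}"

text \<open>
  The matrix element \<open>\<langle>\<Phi>|O|\<Psi>\<rangle>\<close> of the Dyson expansion of \<open>O[B,Q,L,R,T]\<close>. For \<open>\<Phi>\<close> with \<open>M\<close> and \<open>\<Psi>\<close>
  with \<open>N\<close> particles only terms with \<open>n \<le> M + N\<close> are nonzero.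
\<close>

definition cmpo_elem ::
  "real \<Rightarrow> nat \<Rightarrow> complex mat \<Rightarrow> (real \<Rightarrow> complex mat) \<Rightarrow> (real \<Rightarrow> complex mat) \<Rightarrow>
   (real \<Rightarrow> complex mat) \<Rightarrow> (real \<Rightarrow> complex mat) \<Rightarrow> fock \<Rightarrow> fock \<Rightarrow> complex" where
  "cmpo_elem l D B Q L R T \<Phi> \<Psi> =
     (\<Sum>n. \<Sum>\<alpha> | length \<alpha> = n.
        LINT x:ordered_points n|seg_pow l n.
          mat_trace (B * mat_string D Q (- l / 2) (l / 2)
            (map (\<lambda>i. (x i, leg_mat L R T (\<alpha> ! i) (x i))) [0..<n]))
          * cnj (vac_amp \<Phi> (ket_points \<alpha> x)) * vac_amp \<Psi> (bra_points \<alpha> x))"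

definition cmpo_data ::
  "real \<Rightarrow> nat \<Rightarrow> complex mat \<Rightarrow> (real \<Rightarrow> complex mat) \<Rightarrow> (real \<Rightarrow> complex mat) \<Rightarrow>
   (real \<Rightarrow> complex mat) \<Rightarrow> (real \<Rightarrow> complex mat) \<Rightarrow> bool" where
  "cmpo_data l D B Q L R T \<longleftrightarrow>
     B \<in> carrier_mat D D \<and> mat_fun l D (L1 l) Q \<and> mat_fun l D (L2 l) L \<and>
     mat_fun l D (L2 l) R \<and> mat_fun l D (Linf l) T"

definition is_cmpo :: "real \<Rightarrow> nat \<Rightarrow> (fock \<Rightarrow> fock) \<Rightarrow> bool" where
  "is_cmpo l D U \<longleftrightarrow> (\<exists>B Q L R T. cmpo_data l D B Q L R T \<and>
     (\<forall>\<Phi>\<in>fock_space l. \<forall>\<Psi>\<in>fock_space l. \<forall>M N.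
        fock_inner l (sector M \<Phi>) (U (sector N \<Psi>)) =
        cmpo_elem l D B Q L R T (sector M \<Phi>) (sector N \<Psi>)))"

definition is_cmpu :: "real \<Rightarrow> nat \<Rightarrow> (fock \<Rightarrow> fock) \<Rightarrow> bool" where
  "is_cmpu l D U \<longleftrightarrow> fock_unitary l U \<and> is_cmpo l D U"

end

theory Submission
  imports Defs
begin

text \<open>
  The identity is a cMPO of bond dimension \<open>1\<close> with \<open>B = T = 1\<close> and \<open>Q = L = R = 0\<close>. The operator
  \<open>c |\<psi>\<^sub>1\<rangle>\<langle>\<psi>\<^sub>2|\<close> is one of bond dimension \<open>D\<^sub>1 D\<^sub>2\<close> with
  \<open>B = c B\<^sub>1 \<otimes> cnj B\<^sub>2\<close>, \<open>Q = Q\<^sub>1 \<otimes> 1 + 1 \<otimes> cnj Q\<^sub>2\<close>, \<open>L = L\<^sub>1 \<otimes> 1\<close>, \<open>R = 1 \<otimes> cnj L\<^sub>2\<close>, \<open>T = 0\<close>: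
  the path-ordered exponential of such a \<open>Q\<close> factorizes, so each string of matrices is the tensor product
  of a string at the ket points and one at the bra points, and the sum over interleavings of ordered ket
  points with ordered bra points turns the integral over a simplex into a product of two simplex integrals.
  Direct sums of the matrices add the operators. Unitarity is that of \<open>V\<close> acting on the span of the
  orthonormal pair.
\<close>

section \<open>Path-ordered exponentials\<close>

text \<open>The generators are only integrable, so the ordered exponentials have no classical
  differential equation to argue with. Composition at an intermediate point and factorization over
  tensor products are instead proved for the Dyson terms, order by order, with Fubini on a triangle
  serving as integration by parts; absolutely convergent Cauchy products then sum the orders.
  Composition is needed because an insertion in one tensor factor cuts the propagators of both, and
  the factor without an insertion has to be glued together again. The factors
  \<open>sqrt (fact n)\<close> of the wave functions and of \<open>vac_amp\<close> multiply to
  \<open>fact n\<close>, the number of permuted copies of the simplex in the cube; this turns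
  ordered integrals back into the inner products of \<open>fock_inner\<close>. Coinciding points
  form a null set, so the decomposition of the cube holds almost everywhere only. Matrix elements
  are taken between fixed particle numbers, so every Dyson sum over words is finite and operators
  may be added word by word.\<close>

lemma set_integral_Icc_continuous:
  fixes f :: "real \<Rightarrow> 'a::euclidean_space"
  assumes "set_integrable lborel {a..b} f"
  shows "continuous_on {a..b} (\<lambda>x. LINT t:{a..x}|lborel. f t)"
proof -
  have "(LINT t:{a..x}|lborel. f t) = integral {a..x} f" if "x \<in> {a..b}" for x
    using that by (intro set_borel_integral_eq_integral set_integrable_subset[OF assms]) auto
  moreover have "continuous_on {a..b} (\<lambda>x. integral {a..x} f)"
    using assms by (intro indefinite_integral_continuous_1 set_borel_integral_eq_integral)
  ultimately show ?thesis by (metis (no_types, lifting) continuous_on_cong)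
qed

text \<open>The Dyson recursion multiplies a lower term, continuous in its endpoint, by an entry of
  the generator that is merely integrable. A continuous factor is bounded on the compact interval,
  so the product stays integrable.\<close>

lemma set_integrable_mult_continuous:
  fixes f g :: "real \<Rightarrow> 'a::{real_normed_field,euclidean_space}"
  assumes f: "set_integrable lborel {a..b} f" and g: "continuous_on {a..b} g"
  shows "set_integrable lborel {a..b} (\<lambda>t. g t * f t)"
proof -
  have "compact (g ` {a..b})"
    by (rule compact_continuous_image[OF g]) simp
  then obtain C where C: "\<And>t. t \<in> {a..b} \<Longrightarrow> norm (g t) \<le> C"
    using compact_imp_bounded bounded_iff by (metis imageI)
  have gm: "set_borel_measurable lborel {a..b} g"
    unfolding set_borel_measurable_def
    using borel_measurable_continuous_on_indicator[OF _ g] by simp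
  have "set_integrable lborel {a..b} (\<lambda>t. C * norm (f t))"
    using f by (intro set_integrable_mult_right set_integrable_norm)
  then show ?thesis
  proof (rule set_integrable_bound)
    \<comment> \<open>Measurability is known only for the two functions cut off to the interval;
      since the indicator is idempotent, their product is the cut-off product.\<close>
    have "(\<lambda>x. (indicator {a..b} x *\<^sub>R g x) * (indicator {a..b} x *\<^sub>R f x)) \<in> borel_measurable lborel"
      using gm f unfolding set_borel_measurable_def set_integrable_def by measurable
    then show "set_borel_measurable lborel {a..b} (\<lambda>t. g t * f t)"
      unfolding set_borel_measurable_def
      by (rule measurable_cong[THEN iffD1, rotated]) (auto simp: indicator_def)
    have "norm (g t * f t) \<le> norm (C * norm (f t))" if "t \<in> {a..b}" for t
      using C[OF that] norm_ge_zero[of "g t"]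
      by (simp add: norm_mult abs_mult mult_right_mono)
    then show "AE t in lborel. t \<in> {a..b} \<longrightarrow> norm (g t * f t) \<le> norm (C * norm (f t))"
      by simp
  qed
qed

text \<open>Fubini: the square \<open>[x, y]\<^sup>2\<close> splits into the triangles above and below the diagonal.\<close>

lemma set_integral_product_rule:
  fixes a b :: "real \<Rightarrow> 'a::{real_normed_field,euclidean_space}"
  assumes a: "set_integrable lborel {x..y} a" and b: "set_integrable lborel {x..y} b"
  shows "(LINT t:{x..y}|lborel. a t) * (LINT t:{x..y}|lborel. b t) =
    (LINT s:{x..y}|lborel. (LINT t:{x..s}|lborel. b t) * a s) +
    (LINT t:{x..y}|lborel. (LINT s:{x..t}|lborel. a s) * b t)"
proof -
  define a' where "a' s = indicator {x..y} s *\<^sub>R a s" for s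
  define b' where "b' s = indicator {x..y} s *\<^sub>R b s" for s
  have a': "integrable lborel a'" and b': "integrable lborel b'"
    using a b unfolding a'_def b'_def set_integrable_def by auto
  note [measurable] = borel_measurable_integrable[OF a'] borel_measurable_integrable[OF b']
  have ab: "integrable (lborel \<Otimes>\<^sub>M lborel) (\<lambda>(s, t). a' s * b' t)"
    by (rule lborel_pair.Fubini_integrable)
       (use a' b' in \<open>auto simp: norm_mult integrable_norm\<close>)
  \<comment> \<open>The diagonal is assigned to the triangle \<open>t \<le> s\<close> alone, so the
    two indicators add up to one everywhere.\<close>
  have ab1: "integrable (lborel \<Otimes>\<^sub>M lborel) (\<lambda>(s, t). of_bool (t \<le> s) * (a' s * b' t))"
    by (rule Bochner_Integration.integrable_bound[OF ab]) (auto simp: norm_mult)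
  have int1: "integrable lborel (\<lambda>t. LINT s|lborel. of_bool (t \<le> s) * (a' s * b' t))"
    using lborel_pair.integrable_snd[OF ab1] by simp
  have ab2: "integrable (lborel \<Otimes>\<^sub>M lborel) (\<lambda>(s, t). of_bool (s < t) * (a' s * b' t))"
    by (rule Bochner_Integration.integrable_bound[OF ab]) (auto simp: norm_mult)
  have int2: "integrable lborel (\<lambda>t. LINT s|lborel. of_bool (s < t) * (a' s * b' t))"
    using lborel_pair.integrable_snd[OF ab2] by simp
  have 1: "(LINT s:{x..y}|lborel. (LINT t:{x..s}|lborel. b t) * a s)
      = (LINT t|lborel. LINT s|lborel. of_bool (t \<le> s) * (a' s * b' t))"
  proof -
    have "(LINT t:{x..s}|lborel. b t) * a' s = (LINT t|lborel. of_bool (t \<le> s) * (a' s * b' t))" for s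
    proof -
      have "(LINT t:{x..s}|lborel. b t) * a' s = (LINT t|lborel. (indicator {x..s} t *\<^sub>R b t) * a' s)"
        unfolding set_lebesgue_integral_def by (rule integral_mult_left_zero[symmetric])
      also have "\<dots> = (LINT t|lborel. of_bool (t \<le> s) * (a' s * b' t))"
        by (rule Bochner_Integration.integral_cong) (auto simp: a'_def b'_def indicator_def)
      finally show ?thesis .
    qed
    moreover have "(LINT s:{x..y}|lborel. (LINT t:{x..s}|lborel. b t) * a s)
      = (LINT s|lborel. (LINT t:{x..s}|lborel. b t) * a' s)"
      unfolding set_lebesgue_integral_def by (simp add: a'_def)
    ultimately have "(LINT s:{x..y}|lborel. (LINT t:{x..s}|lborel. b t) * a s)
      = (LINT s|lborel. LINT t|lborel. of_bool (t \<le> s) * (a' s * b' t))"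
      by simp
    also have "\<dots> = (LINT t|lborel. LINT s|lborel. of_bool (t \<le> s) * (a' s * b' t))"
      using lborel_pair.Fubini_integral[OF ab1] by simp
    finally show ?thesis .
  qed
  have 2: "(LINT t:{x..y}|lborel. (LINT s:{x..t}|lborel. a s) * b t)
      = (LINT t|lborel. LINT s|lborel. of_bool (s < t) * (a' s * b' t))"
  proof -
    have "(LINT s:{x..t}|lborel. a s) * b' t = (LINT s|lborel. of_bool (s < t) * (a' s * b' t))" for t
    proof -
      have "(LINT s:{x..t}|lborel. a s) * b' t = (LINT s|lborel. (indicator {x..t} s *\<^sub>R a s) * b' t)"
        unfolding set_lebesgue_integral_def by (rule integral_mult_left_zero[symmetric])
      also have "\<dots> = (LINT s|lborel. of_bool (s \<le> t) * (a' s * b' t))"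
        by (rule Bochner_Integration.integral_cong) (auto simp: a'_def b'_def indicator_def)
      \<comment> \<open>The closed interval \<open>{x..t}\<close> contains the diagonal point
        \<open>s = t\<close>, which belongs to the other triangle; it is a single point and hence
        null.\<close>
      also have "\<dots> = (LINT s|lborel. of_bool (s < t) * (a' s * b' t))"
      proof (rule integral_cong_AE)
        show "AE s in lborel. of_bool (s \<le> t) * (a' s * b' t) = of_bool (s < t) * (a' s * b' t)"
          using AE_lborel_singleton[of t] by eventually_elim auto
      qed auto
      finally show ?thesis .
    qed
    moreover have "(LINT t:{x..y}|lborel. (LINT s:{x..t}|lborel. a s) * b t)
      = (LINT t|lborel. (LINT s:{x..t}|lborel. a s) * b' t)"
      unfolding set_lebesgue_integral_def by (simp add: b'_def)
    ultimately show ?thesis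
      by simp
  qed
  have "(LINT t:{x..y}|lborel. a t) * (LINT t:{x..y}|lborel. b t)
      = (LINT t|lborel. LINT s|lborel. a' s * b' t)"
    unfolding set_lebesgue_integral_def a'_def[symmetric] b'_def[symmetric] by simp
  also have "\<dots> = (LINT t|lborel. (LINT s|lborel. of_bool (t \<le> s) * (a' s * b' t)) +
      (LINT s|lborel. of_bool (s < t) * (a' s * b' t)))"
  proof (rule Bochner_Integration.integral_cong[OF refl])
    fix t
    have i: "integrable lborel (\<lambda>s. a' s * b' t)" using a' by simp
    have "integrable lborel (\<lambda>s. of_bool (t \<le> s) * (a' s * b' t))"
         "integrable lborel (\<lambda>s. of_bool (s < t) * (a' s * b' t))"
      by (rule Bochner_Integration.integrable_bound[OF i]; auto simp: norm_mult)+
    then have "(LINT s|lborel. of_bool (t \<le> s) * (a' s * b' t)) +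
      (LINT s|lborel. of_bool (s < t) * (a' s * b' t)) =
      (LINT s|lborel. of_bool (t \<le> s) * (a' s * b' t) + of_bool (s < t) * (a' s * b' t))"
      by simp
    also have "\<dots> = (LINT s|lborel. a' s * b' t)"
      by (rule Bochner_Integration.integral_cong) auto
    finally show "(LINT s|lborel. a' s * b' t) = (LINT s|lborel. of_bool (t \<le> s) * (a' s * b' t)) +
      (LINT s|lborel. of_bool (s < t) * (a' s * b' t))" by simp
  qed
  also have "\<dots> = (LINT s:{x..y}|lborel. (LINT t:{x..s}|lborel. b t) * a s) +
    (LINT t:{x..y}|lborel. (LINT s:{x..t}|lborel. a s) * b t)"
    unfolding 1 2 by (rule Bochner_Integration.integral_add[OF int1 int2])
  finally show ?thesis .
qed

lemma set_integrable_sum: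
  fixes f :: "'i \<Rightarrow> 'a \<Rightarrow> 'b::{banach,second_countable_topology}"
  assumes "\<And>i. i \<in> I \<Longrightarrow> set_integrable M A (f i)"
  shows "set_integrable M A (\<lambda>x. \<Sum>i\<in>I. f i x)"
  using assms unfolding set_integrable_def by (simp add: scaleR_sum_right)

lemma set_integral_sum:
  fixes f :: "'i \<Rightarrow> 'a \<Rightarrow> 'b::{banach,second_countable_topology}"
  assumes "\<And>i. i \<in> I \<Longrightarrow> set_integrable M A (f i)"
  shows "(LINT x:A|M. \<Sum>i\<in>I. f i x) = (\<Sum>i\<in>I. LINT x:A|M. f i x)"
  using assms unfolding set_integrable_def set_lebesgue_integral_def
  by (simp add: scaleR_sum_right)

lemma set_integral_Icc_combine:
  fixes f :: "real \<Rightarrow> 'a::euclidean_space"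
  assumes f: "set_integrable lborel {x..z} f" and "x \<le> y" "y \<le> z"
  shows "(LINT t:{x..z}|lborel. f t) = (LINT t:{x..y}|lborel. f t) + (LINT t:{y..z}|lborel. f t)"
proof -
  have 1: "set_integrable lborel {x..y} f"
    by (rule set_integrable_subset[OF f]) (simp_all add: \<open>y \<le> z\<close>)
  have 2: "set_integrable lborel {y..z} f"
    by (rule set_integrable_subset[OF f]) (simp_all add: \<open>x \<le> y\<close>)
  have "(LINT t:{x..z}|lborel. f t) = integral {x..z} f"
    by (rule set_borel_integral_eq_integral(2)[OF f])
  also have "\<dots> = integral {x..y} f + integral {y..z} f"
    by (rule Henstock_Kurzweil_Integration.integral_combine[symmetric,
      OF assms(2,3) set_borel_integral_eq_integral(1)[OF f]])
  also have "integral {x..y} f = (LINT t:{x..y}|lborel. f t)"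
    by (rule set_borel_integral_eq_integral(2)[OF 1, symmetric])
  also have "integral {y..z} f = (LINT t:{y..z}|lborel. f t)"
    by (rule set_borel_integral_eq_integral(2)[OF 2, symmetric])
  finally show ?thesis .
qed

text \<open>An integrated Leibniz rule at total order \<open>Suc n\<close>: \<open>F' k\<close> and
  \<open>G' k\<close> play the derivatives of \<open>F (Suc k)\<close> and \<open>G (Suc k)\<close>,
  while the zeroth terms are constant. Differentiability is replaced by the triangle decomposition
  of each product of two primitives.\<close>

lemma set_integral_convolution:
  fixes F F' G G' :: "nat \<Rightarrow> real \<Rightarrow> 'a::{real_normed_field,euclidean_space}"
  assumes F0: "\<And>t. t \<in> {x..y} \<Longrightarrow> F 0 t = c" and G0: "\<And>t. t \<in> {x..y} \<Longrightarrow> G 0 t = e"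
    and F': "\<And>k. set_integrable lborel {x..y} (F' k)" and G': "\<And>k. set_integrable lborel {x..y} (G' k)"
    and F: "\<And>k t. t \<in> {x..y} \<Longrightarrow> F (Suc k) t = (LINT s:{x..t}|lborel. F' k s)"
    and G: "\<And>k t. t \<in> {x..y} \<Longrightarrow> G (Suc k) t = (LINT s:{x..t}|lborel. G' k s)"
    and "x \<le> y"
  shows "(LINT t:{x..y}|lborel. \<Sum>k\<le>n. F' k t * G (n - k) t + F k t * G' (n - k) t) =
    (\<Sum>k\<le>Suc n. F k y * G (Suc n - k) y)"
proof -
  have y: "y \<in> {x..y}" using \<open>x \<le> y\<close> by simp
  have Fc: "continuous_on {x..y} (F k)" for k
  proof (cases k)
    case 0 then show ?thesis using F0 by (auto intro: continuous_on_eq[OF continuous_on_const])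
  next
    case (Suc m) then show ?thesis
      using F by (auto intro: continuous_on_eq[OF set_integral_Icc_continuous[OF F'[of m]]])
  qed
  have Gc: "continuous_on {x..y} (G k)" for k
  proof (cases k)
    case 0 then show ?thesis using G0 by (auto intro: continuous_on_eq[OF continuous_on_const])
  next
    case (Suc m) then show ?thesis
      using G by (auto intro: continuous_on_eq[OF set_integral_Icc_continuous[OF G'[of m]]])
  qed
  define I1 where "I1 k m = (LINT t:{x..y}|lborel. F' k t * G m t)" for k m
  define I2 where "I2 k m = (LINT t:{x..y}|lborel. F k t * G' m t)" for k m
  have i1: "set_integrable lborel {x..y} (\<lambda>t. F' k t * G m t)" for k m
    using set_integrable_mult_continuous[OF F' Gc, of m k] by (simp add: mult.commute)
  have i2: "set_integrable lborel {x..y} (\<lambda>t. F k t * G' m t)" for k m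
    using set_integrable_mult_continuous[OF G' Fc] .
  have ss: "F (Suc k) y * G (Suc m) y = I1 k (Suc m) + I2 (Suc k) m" for k m
  proof -
    have "I1 k (Suc m) = (LINT s:{x..y}|lborel. (LINT t:{x..s}|lborel. G' m t) * F' k s)"
      unfolding I1_def by (rule set_lebesgue_integral_cong) (auto simp: G)
    moreover have "I2 (Suc k) m = (LINT t:{x..y}|lborel. (LINT s:{x..t}|lborel. F' k s) * G' m t)"
      unfolding I2_def by (rule set_lebesgue_integral_cong) (auto simp: F)
    ultimately show ?thesis
      using set_integral_product_rule[OF F' G', of k m] F[OF y] G[OF y] by simp
  qed
  have s0: "F (Suc k) y * G 0 y = I1 k 0" for k
  proof -
    have "I1 k 0 = (LINT t:{x..y}|lborel. F' k t * e)"
      unfolding I1_def by (rule set_lebesgue_integral_cong) (auto simp: G0)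
    then show ?thesis using G0[OF y] F[OF y] by simp
  qed
  have os: "F 0 y * G (Suc m) y = I2 0 m" for m
  proof -
    have "I2 0 m = (LINT t:{x..y}|lborel. c * G' m t)"
      unfolding I2_def by (rule set_lebesgue_integral_cong) (auto simp: F0)
    then show ?thesis using F0[OF y] G[OF y] by simp
  qed
  \<comment> \<open>The two end terms contain a constant factor and produce one integral each,
    whereas every inner term produces two; hence they are split off.\<close>
  have "(\<Sum>k\<le>Suc n. F k y * G (Suc n - k) y) =
      F 0 y * G (Suc n) y + (\<Sum>k<n. F (Suc k) y * G (Suc (n - Suc k)) y) + F (Suc n) y * G 0 y"
  proof -
    have "(\<Sum>k\<le>Suc n. h k) = h 0 + (\<Sum>k<n. h (Suc k)) + h (Suc n)" for h :: "nat \<Rightarrow> 'a"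
      unfolding sum.atMost_Suc unfolding lessThan_Suc_atMost[symmetric] sum.lessThan_Suc_shift by simp
    then have "(\<Sum>k\<le>Suc n. F k y * G (Suc n - k) y) =
        F 0 y * G (Suc n - 0) y + (\<Sum>k<n. F (Suc k) y * G (Suc n - Suc k) y) + F (Suc n) y * G (Suc n - Suc n) y" .
    moreover have "Suc n - Suc k = Suc (n - Suc k)" if "k < n" for k
      using that by simp
    then have "(\<Sum>k<n. F (Suc k) y * G (Suc n - Suc k) y) = (\<Sum>k<n. F (Suc k) y * G (Suc (n - Suc k)) y)"
      by (intro sum.cong refl) (simp only: lessThan_iff)
    ultimately show ?thesis
      by (simp only: diff_zero diff_self_eq_0)
  qed
  also have "\<dots> = I2 0 n + (\<Sum>k<n. I1 k (n - k) + I2 (Suc k) (n - Suc k)) + I1 n 0"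
  proof -
    have "F (Suc k) y * G (Suc (n - Suc k)) y = I1 k (n - k) + I2 (Suc k) (n - Suc k)" if "k < n" for k
      using ss[of k "n - Suc k"] that by (simp add: Suc_diff_Suc)
    then have "(\<Sum>k<n. F (Suc k) y * G (Suc (n - Suc k)) y) = (\<Sum>k<n. I1 k (n - k) + I2 (Suc k) (n - Suc k))"
      by (intro sum.cong refl) (simp only: lessThan_iff)
    then show ?thesis by (simp only: s0 os)
  qed
  \<comment> \<open>The \<open>I1\<close> integrals take their last term from \<open>G 0\<close> and
    the \<open>I2\<close> integrals their first term from \<open>F 0\<close>, so both sums become
    complete.\<close>
  also have "\<dots> = (\<Sum>k\<le>n. I1 k (n - k)) + (\<Sum>k\<le>n. I2 k (n - k))"
  proof -
    have "(\<Sum>k\<le>n. I1 k (n - k)) = (\<Sum>k<n. I1 k (n - k)) + I1 n 0"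
      by (simp add: lessThan_Suc_atMost[symmetric])
    moreover have "(\<Sum>k\<le>n. I2 k (n - k)) = I2 0 n + (\<Sum>k<n. I2 (Suc k) (n - Suc k))"
      unfolding lessThan_Suc_atMost[symmetric] sum.lessThan_Suc_shift by simp
    ultimately show ?thesis by (simp add: sum.distrib algebra_simps)
  qed
  also have "\<dots> = (LINT t:{x..y}|lborel. \<Sum>k\<le>n. F' k t * G (n - k) t + F k t * G' (n - k) t)"
  proof -
    have "(LINT t:{x..y}|lborel. \<Sum>k\<le>n. F' k t * G (n - k) t + F k t * G' (n - k) t) =
        (\<Sum>k\<le>n. LINT t:{x..y}|lborel. F' k t * G (n - k) t + F k t * G' (n - k) t)"
      by (intro set_integral_sum set_integral_add i1 i2)
    also have "\<dots> = (\<Sum>k\<le>n. I1 k (n - k) + I2 k (n - k))"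
      unfolding I1_def I2_def by (intro sum.cong refl set_integral_add i1 i2)
    finally show ?thesis by (simp only: sum.distrib)
  qed
  finally show ?thesis by simp
qed

section \<open>Dyson terms: recursion, bounds, convergence and composition\<close>

lemma seg_Icc_subset: "x \<in> seg l \<Longrightarrow> y \<in> seg l \<Longrightarrow> {x..y} \<subseteq> seg l"
  by (auto simp: seg_def)

lemma path_exp_term_carrier [simp]: "path_exp_term D Q n x y \<in> carrier_mat D D"
  by (cases n) auto

lemma path_exp_carrier [simp]: "path_exp D Q x y \<in> carrier_mat D D"
  by (simp add: path_exp_def)

lemma path_exp_index:
  "i < D \<Longrightarrow> j < D \<Longrightarrow> path_exp D Q x y $$ (i, j) = (\<Sum>n. path_exp_term D Q n x y $$ (i, j))"
  by (simp add: path_exp_def)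

lemma mult_mat_index_sum:
  assumes "A \<in> carrier_mat n m" "B \<in> carrier_mat m p" "i < n" "j < p"
  shows "(A * B) $$ (i, j) = (\<Sum>k<m. A $$ (i, k) * B $$ (k, j))"
  using assms by (simp add: scalar_prod_def lessThan_atLeast0)

text \<open>Entries rather than matrices carry the analysis: the matrix product becomes a finite sum
  of scalar products, to which the scalar integral rules apply.\<close>

lemma path_exp_term_Suc_index:
  assumes "\<And>z. z \<in> {x..y} \<Longrightarrow> Q z \<in> carrier_mat D D" "i < D" "j < D"
  shows "path_exp_term D Q (Suc n) x y $$ (i, j) =
    (LINT z:{x..y}|lborel. \<Sum>k<D. path_exp_term D Q n x z $$ (i, k) * Q z $$ (k, j))"
proof -
  have "path_exp_term D Q (Suc n) x y $$ (i, j) = (LINT z:{x..y}|lborel. (path_exp_term D Q n x z * Q z) $$ (i, j))"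
    using assms by simp
  also have "\<dots> = (LINT z:{x..y}|lborel. \<Sum>k<D. path_exp_term D Q n x z $$ (i, k) * Q z $$ (k, j))"
    using assms by (intro set_lebesgue_integral_cong)
      (auto intro!: mult_mat_index_sum[OF path_exp_term_carrier])
  finally show ?thesis .
qed

declare path_exp_term.simps(2) [simp del]

text \<open>Complex conjugation and \<open>kron_sum\<close> preserve this setting, so the composite
  generator of a rank-one operator inherits every result proved here.\<close>

locale L1_generator =
  fixes l :: real and D :: nat and Q :: "real \<Rightarrow> complex mat"
  assumes L1: "mat_fun l D (L1 l) Q"
begin

lemma carrier: "x \<in> seg l \<Longrightarrow> Q x \<in> carrier_mat D D"
  using L1 by (simp add: mat_fun_def)

lemma integrable_entry:
  "x \<in> seg l \<Longrightarrow> y \<in> seg l \<Longrightarrow> i < D \<Longrightarrow> j < D \<Longrightarrow> set_integrable lborel {x..y} (\<lambda>z. Q z $$ (i, j))"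
  using L1 unfolding mat_fun_def L1_def by (metis set_integrable_subset seg_Icc_subset atLeastAtMost_borel sets_lborel)

lemma term_Suc_index:
  assumes "x \<in> seg l" "y \<in> seg l" "i < D" "j < D"
  shows "path_exp_term D Q (Suc n) x y $$ (i, j) =
    (LINT z:{x..y}|lborel. \<Sum>k<D. path_exp_term D Q n x z $$ (i, k) * Q z $$ (k, j))"
  using assms seg_Icc_subset[OF assms(1,2)] by (intro path_exp_term_Suc_index carrier) auto

text \<open>Continuity climbs one order at a time: continuous times integrable is integrable, and
  its primitive is again continuous.\<close>

lemma term_continuous:
  assumes "x \<in> seg l" "y \<in> seg l" "i < D" "j < D"
  shows "continuous_on {x..y} (\<lambda>z. path_exp_term D Q n x z $$ (i, j))"
  using assms(3,4)
proof (induction n arbitrary: j)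
  case (Suc n)
  have "set_integrable lborel {x..y} (\<lambda>z. \<Sum>k<D. path_exp_term D Q n x z $$ (i, k) * Q z $$ (k, j))"
    using assms Suc by (intro set_integrable_sum set_integrable_mult_continuous integrable_entry) auto
  from set_integral_Icc_continuous[OF this] show ?case
  proof (rule continuous_on_eq)
    fix z assume "z \<in> {x..y}"
    then show "(LINT t:{x..z}|lborel. \<Sum>k<D. path_exp_term D Q n x t $$ (i, k) * Q t $$ (k, j)) =
        path_exp_term D Q (Suc n) x z $$ (i, j)"
      using assms(1,2) Suc.prems seg_Icc_subset[OF assms(1,2)] by (subst term_Suc_index) auto
  qed
qed simp

lemma term_integrable:
  assumes "x \<in> seg l" "y \<in> seg l" "i < D" "j < D"
  shows "set_integrable lborel {x..y} (\<lambda>z. \<Sum>k<D. path_exp_term D Q n x z $$ (i, k) * Q z $$ (k, j))"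
  using assms
  by (intro set_integrable_sum set_integrable_mult_continuous integrable_entry term_continuous) auto

text \<open>The integral of \<open>rate\<close> takes the place of \<open>\<parallel>Q\<parallel>\<close> in the bound \<open>\<parallel>Q\<parallel>\<^sup>n / n!\<close> on the Dyson terms.\<close>

definition rate :: "real \<Rightarrow> real" where
  "rate z = (\<Sum>i<D. \<Sum>j<D. cmod (Q z $$ (i, j)))"

lemma rate_nonneg: "0 \<le> rate z"
  by (simp add: rate_def sum_nonneg)

lemma rate_integrable: "x \<in> seg l \<Longrightarrow> y \<in> seg l \<Longrightarrow> set_integrable lborel {x..y} rate"
  unfolding rate_def by (intro set_integrable_sum set_integrable_norm integrable_entry) auto

lemma column_le_rate: "j < D \<Longrightarrow> (\<Sum>k<D. cmod (Q z $$ (k, j))) \<le> rate z"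
  unfolding rate_def
proof (rule sum_mono)
  fix k assume "j < D"
  then show "cmod (Q z $$ (k, j)) \<le> (\<Sum>j<D. cmod (Q z $$ (k, j)))"
    by (intro member_le_sum) auto
qed

text \<open>This is the substitution \<open>u = G z\<close> for a primitive \<open>G\<close> of a
  merely integrable \<open>rate\<close>. Instead of a chain rule, the product rule is applied to
  \<open>G\<close> and the integral known from the previous exponent.\<close>

lemma power_rate_integral:
  assumes "x \<in> seg l" "y \<in> seg l" "x \<le> y"
  shows "(LINT z:{x..y}|lborel. (LINT t:{x..z}|lborel. rate t) ^ n * rate z) =
    (LINT t:{x..y}|lborel. rate t) ^ Suc n / Suc n"
  using assms(2,3)
proof (induction n arbitrary: y)
  case (Suc n)
  define G where "G z = (LINT t:{x..z}|lborel. rate t)" for z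
  have r: "set_integrable lborel {x..y} rate"
    using assms(1) Suc.prems by (intro rate_integrable)
  have Gc: "continuous_on {x..y} G"
    unfolding G_def by (rule set_integral_Icc_continuous[OF r])
  have i: "set_integrable lborel {x..y} (\<lambda>z. G z ^ k * rate z)" for k
    by (intro set_integrable_mult_continuous[OF r] continuous_on_power Gc)
  have IH: "(LINT t:{x..z}|lborel. G t ^ n * rate t) = G z ^ Suc n / Suc n" if "z \<in> {x..y}" for z
    using Suc.IH[of z] that seg_Icc_subset[OF assms(1) Suc.prems(1)] by (auto simp: G_def)
  have "G y * (G y ^ Suc n / Suc n) =
      (LINT s:{x..y}|lborel. (LINT t:{x..s}|lborel. G t ^ n * rate t) * rate s) +
      (LINT t:{x..y}|lborel. G t * (G t ^ n * rate t))"
    using set_integral_product_rule[OF r i[of n]] IH[of y] Suc.prems by (simp add: G_def)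
  also have "(LINT s:{x..y}|lborel. (LINT t:{x..s}|lborel. G t ^ n * rate t) * rate s) =
      (LINT s:{x..y}|lborel. (1 / Suc n) * (G s ^ Suc n * rate s))"
    by (rule set_lebesgue_integral_cong) (auto simp: IH)
  also have "\<dots> = 1 / Suc n * (LINT s:{x..y}|lborel. G s ^ Suc n * rate s)"
    by (rule set_integral_mult_right)
  also have "(LINT t:{x..y}|lborel. G t * (G t ^ n * rate t)) = (LINT s:{x..y}|lborel. G s ^ Suc n * rate s)"
    by (simp add: mult.assoc)
  finally have *: "G y * (G y ^ Suc n / Suc n) =
      1 / Suc n * (LINT s:{x..y}|lborel. G s ^ Suc n * rate s) +
        (LINT s:{x..y}|lborel. G s ^ Suc n * rate s)" .
  \<comment> \<open>The unknown integral \<open>a\<close> occurs in both triangles, with weights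
    \<open>1 / m\<close> and \<open>1\<close> for \<open>m = Suc n\<close>; solving this linear
    equation raises the denominator from \<open>m\<close> to \<open>m + 1\<close>.\<close>
  have "a = g * h / (m + 1)" if "g * (h / m) = 1 / m * a + a" "m > 0" for a g h m :: real
    using that by (simp add: field_simps)
  from this[OF *] show ?case
    unfolding G_def[symmetric] by simp
qed simp

text \<open>The bound is the same for all entries in a row, so the next order needs only a column
  sum of moduli of \<open>Q z\<close>, which \<open>rate z\<close> dominates. The factorial then
  builds up through the integrals of powers of the primitive of \<open>rate\<close>.\<close>

lemma term_bound:
  assumes "x \<in> seg l" "y \<in> seg l" "x \<le> y" "i < D" "j < D"
  shows "cmod (path_exp_term D Q n x y $$ (i, j)) \<le> (LINT t:{x..y}|lborel. rate t) ^ n / fact n"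
  using assms(2,3,5)
proof (induction n arbitrary: y j)
  case (Suc n)
  define G where "G z = (LINT t:{x..z}|lborel. rate t)" for z
  note xy = assms(1) Suc.prems(1)
  have r: "set_integrable lborel {x..y} rate" using xy by (rule rate_integrable)
  have ib: "set_integrable lborel {x..y} (\<lambda>z. G z ^ n * rate z)"
    unfolding G_def
    by (intro set_integrable_mult_continuous[OF r] continuous_on_power set_integral_Icc_continuous r)
  have "cmod (path_exp_term D Q (Suc n) x y $$ (i, j)) \<le>
      (LINT z:{x..y}|lborel. cmod (\<Sum>k<D. path_exp_term D Q n x z $$ (i, k) * Q z $$ (k, j)))"
    using xy Suc.prems assms(4)
    by (simp add: term_Suc_index set_integral_norm_bound term_integrable)
  also have "\<dots> \<le> (LINT z:{x..y}|lborel. 1 / fact n * (G z ^ n * rate z))"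
  proof (rule set_integral_mono)
    show "set_integrable lborel {x..y} (\<lambda>z. cmod (\<Sum>k<D. path_exp_term D Q n x z $$ (i, k) * Q z $$ (k, j)))"
      using xy Suc.prems assms(4) by (intro set_integrable_norm term_integrable)
    fix z assume z: "z \<in> {x..y}"
    then have zs: "z \<in> seg l" using seg_Icc_subset[OF xy] by blast
    have G0: "0 \<le> G z"
      unfolding G_def set_lebesgue_integral_def by (intro integral_nonneg_AE) (simp add: rate_nonneg)
    have "cmod (\<Sum>k<D. path_exp_term D Q n x z $$ (i, k) * Q z $$ (k, j)) \<le>
        (\<Sum>k<D. G z ^ n / fact n * cmod (Q z $$ (k, j)))"
      using Suc.IH[of z] z zs unfolding G_def
      by (intro sum_norm_le) (auto simp: norm_mult simp del: times_divide_eq_left intro!: mult_right_mono)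
    also have "\<dots> \<le> G z ^ n / fact n * rate z"
      unfolding sum_distrib_left[symmetric] using G0 Suc.prems
      by (intro mult_left_mono column_le_rate) auto
    finally show "cmod (\<Sum>k<D. path_exp_term D Q n x z $$ (i, k) * Q z $$ (k, j)) \<le>
        1 / fact n * (G z ^ n * rate z)" by simp
  qed (use ib in simp)
  also have "\<dots> = 1 / fact n * (G y ^ Suc n / Suc n)"
    using power_rate_integral[OF xy Suc.prems(2), of n] unfolding G_def[symmetric]
    by (subst set_integral_mult_right) simp
  also have "\<dots> = G y ^ Suc n / fact (Suc n)"
    by simp
  finally show ?case unfolding G_def .
qed (use assms(4) in simp)

lemma term_summable:
  assumes "x \<in> seg l" "y \<in> seg l" "x \<le> y" "i < D" "j < D"
  shows "summable (\<lambda>n. norm (path_exp_term D Q n x y $$ (i, j)))"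
proof (rule summable_comparison_test')
  show "summable (\<lambda>n. inverse (fact n) * (LINT t:{x..y}|lborel. rate t) ^ n)"
    by (rule summable_exp)
  show "norm (norm (path_exp_term D Q n x y $$ (i, j))) \<le>
      inverse (fact n) * (LINT t:{x..y}|lborel. rate t) ^ n" for n
    using term_bound[OF assms, of n] by (simp add: divide_inverse mult.commute)
qed

text \<open>The \<open>n\<close> ordered insertions in \<open>[x, z]\<close> are sorted by how many,
  \<open>k\<close>, lie before \<open>y\<close>. The induction removes the last insertion and asks
  on which side of \<open>y\<close> it lies.\<close>

lemma term_split:
  assumes "x \<in> seg l" "y \<in> seg l" "z \<in> seg l" "x \<le> y" "y \<le> z" "i < D" "j < D"
  shows "path_exp_term D Q n x z $$ (i, j) =
    (\<Sum>m<D. \<Sum>k\<le>n. path_exp_term D Q k x y $$ (i, m) * path_exp_term D Q (n - k) y z $$ (m, j))"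
  using assms(3,5,7)
proof (induction n arbitrary: z j)
  case 0
  then show ?case
    using assms(6) by (simp add: if_distrib[of "\<lambda>x. x * _"] cong: if_cong)
next
  case (Suc n)
  let ?T = "path_exp_term D Q"
  have "?T (Suc n) x z $$ (i, j) = (LINT t:{x..z}|lborel. \<Sum>p<D. ?T n x t $$ (i, p) * Q t $$ (p, j))"
    using assms Suc.prems by (intro term_Suc_index)
  also have "\<dots> = (LINT t:{x..y}|lborel. \<Sum>p<D. ?T n x t $$ (i, p) * Q t $$ (p, j)) +
      (LINT t:{y..z}|lborel. \<Sum>p<D. ?T n x t $$ (i, p) * Q t $$ (p, j))"
    using assms Suc.prems by (intro set_integral_Icc_combine term_integrable)
  also have "(LINT t:{x..y}|lborel. \<Sum>p<D. ?T n x t $$ (i, p) * Q t $$ (p, j)) = ?T (Suc n) x y $$ (i, j)"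
    using assms Suc.prems by (intro term_Suc_index[symmetric])
  \<comment> \<open>With the last insertion to the right of \<open>y\<close>, the induction
    hypothesis splits the other \<open>n\<close>; the factor from \<open>x\<close> to
    \<open>y\<close> does not depend on \<open>t\<close>.\<close>
  also have "(LINT t:{y..z}|lborel. \<Sum>p<D. ?T n x t $$ (i, p) * Q t $$ (p, j)) =
     (LINT t:{y..z}|lborel. \<Sum>m<D. \<Sum>k\<le>n. ?T k x y $$ (i, m) * (\<Sum>p<D. ?T (n - k) y t $$ (m, p) * Q t $$ (p, j)))"
  proof (rule set_lebesgue_integral_cong, simp, intro allI impI)
    fix t assume t: "t \<in> {y..z}"
    then have "t \<in> seg l" using seg_Icc_subset[OF assms(2) Suc.prems(1)] by blast
    with t have "(\<Sum>p<D. ?T n x t $$ (i, p) * Q t $$ (p, j)) =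
        (\<Sum>p<D. \<Sum>m<D. \<Sum>k\<le>n. ?T k x y $$ (i, m) * (?T (n - k) y t $$ (m, p) * Q t $$ (p, j)))"
      using Suc.IH[of t] by (simp add: sum_distrib_right mult.assoc)
    also have "\<dots> = (\<Sum>m<D. \<Sum>p<D. \<Sum>k\<le>n. ?T k x y $$ (i, m) * (?T (n - k) y t $$ (m, p) * Q t $$ (p, j)))"
      by (rule sum.swap)
    also have "\<dots> = (\<Sum>m<D. \<Sum>k\<le>n. \<Sum>p<D. ?T k x y $$ (i, m) * (?T (n - k) y t $$ (m, p) * Q t $$ (p, j)))"
      by (intro sum.cong sum.swap) auto
    finally show "(\<Sum>p<D. ?T n x t $$ (i, p) * Q t $$ (p, j)) =
        (\<Sum>m<D. \<Sum>k\<le>n. ?T k x y $$ (i, m) * (\<Sum>p<D. ?T (n - k) y t $$ (m, p) * Q t $$ (p, j)))"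
      by (simp add: sum_distrib_left)
  qed
  also have "\<dots> = (\<Sum>m<D. \<Sum>k\<le>n. ?T k x y $$ (i, m) * ?T (Suc (n - k)) y z $$ (m, j))"
  proof -
    have "set_integrable lborel {y..z} (\<lambda>t. c * (\<Sum>p<D. ?T k y t $$ (m, p) * Q t $$ (p, j)))" if "m < D" for m k c
      using assms Suc.prems that by (intro set_integrable_mult_right term_integrable)
    then have "(LINT t:{y..z}|lborel. \<Sum>m<D. \<Sum>k\<le>n. ?T k x y $$ (i, m) * (\<Sum>p<D. ?T (n - k) y t $$ (m, p) * Q t $$ (p, j))) =
       (\<Sum>m<D. \<Sum>k\<le>n. LINT t:{y..z}|lborel. ?T k x y $$ (i, m) * (\<Sum>p<D. ?T (n - k) y t $$ (m, p) * Q t $$ (p, j)))"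
      by (subst set_integral_sum, force intro!: set_integrable_sum)
         (intro sum.cong refl set_integral_sum, simp)
    also have "\<dots> = (\<Sum>m<D. \<Sum>k\<le>n. ?T k x y $$ (i, m) * ?T (Suc (n - k)) y z $$ (m, j))"
      using assms Suc.prems by (intro sum.cong refl) (simp add: term_Suc_index)
    finally show ?thesis .
  qed
  also have "?T (Suc n) x y $$ (i, j) + \<dots> =
      (\<Sum>m<D. \<Sum>k\<le>Suc n. ?T k x y $$ (i, m) * ?T (Suc n - k) y z $$ (m, j))"
  proof -
    have "(\<Sum>k\<le>n. ?T k x y $$ (i, m) * ?T (Suc n - k) y z $$ (m, j)) =
        (\<Sum>k\<le>n. ?T k x y $$ (i, m) * ?T (Suc (n - k)) y z $$ (m, j))" for m
      by (rule sum.cong) (auto simp: Suc_diff_le)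
    \<comment> \<open>The case of all insertions to the left of \<open>y\<close> is the summand
      \<open>k = Suc n\<close>, whose right factor is the zeroth term, the identity matrix.\<close>
    moreover have "(\<Sum>m<D. ?T (Suc n) x y $$ (i, m) * 1\<^sub>m D $$ (m, j)) = ?T (Suc n) x y $$ (i, j)"
      using Suc.prems by (simp add: if_distrib[of "\<lambda>x. _ * x"] cong: if_cong)
    ultimately show ?thesis by (simp add: sum.distrib)
  qed
  finally show ?case .
qed

text \<open>Summing \<open>term_split\<close> over all orders is a Cauchy product, and the series of
  both factors converge absolutely.\<close>

lemma path_exp_split:
  assumes "x \<in> seg l" "y \<in> seg l" "z \<in> seg l" "x \<le> y" "y \<le> z"
  shows "path_exp D Q x z = path_exp D Q x y * path_exp D Q y z"
proof (rule eq_matI)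
  fix i j assume "i < dim_row (path_exp D Q x y * path_exp D Q y z)" "j < dim_col (path_exp D Q x y * path_exp D Q y z)"
  then have ij: "i < D" "j < D" by (auto simp: path_exp_def)
  let ?T = "path_exp_term D Q"
  have C: "(\<lambda>n. \<Sum>k\<le>n. ?T k x y $$ (i, m) * ?T (n - k) y z $$ (m, j)) sums
      (path_exp D Q x y $$ (i, m) * path_exp D Q y z $$ (m, j))" if "m < D" for m
    using Cauchy_product_sums[OF term_summable term_summable, of x y i m y z m j] assms ij that
    by (simp add: path_exp_index)
  have "(\<lambda>n. ?T n x z $$ (i, j)) sums (\<Sum>m<D. path_exp D Q x y $$ (i, m) * path_exp D Q y z $$ (m, j))"
    using assms ij by (subst term_split[of x y z]) (auto intro!: sums_sum C)
  then show "path_exp D Q x z $$ (i, j) = (path_exp D Q x y * path_exp D Q y z) $$ (i, j)"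
    using ij by (simp add: path_exp_index sums_iff mult_mat_index_sum[OF path_exp_carrier path_exp_carrier])
qed (auto simp: path_exp_def)

end

section \<open>Stability of the regularity classes\<close>

lemma L1_cong: "(\<And>x. x \<in> seg l \<Longrightarrow> f x = g x) \<Longrightarrow> L1 l f = L1 l g"
  unfolding L1_def by (rule set_integrable_cong) auto

lemma L2_cong: "(\<And>x. x \<in> seg l \<Longrightarrow> f x = g x) \<Longrightarrow> L2 l f = L2 l g"
  unfolding L2_def set_borel_measurable_def
  by (intro conj_cong set_integrable_cong measurable_cong) (auto simp: indicator_def)

lemma Linf_cong: "(\<And>x. x \<in> seg l \<Longrightarrow> f x = g x) \<Longrightarrow> Linf l f = Linf l g"
  unfolding Linf_def set_borel_measurable_def
  by (intro conj_cong ex_cong measurable_cong) (auto simp: indicator_def intro!: AE_cong ex_cong)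

lemma L1_add: "L1 l f \<Longrightarrow> L1 l g \<Longrightarrow> L1 l (\<lambda>x. f x + g x)"
  unfolding L1_def by (rule set_integral_add)

lemma L1_mult: "L1 l f \<Longrightarrow> L1 l (\<lambda>x. c * f x)"
  unfolding L1_def by (intro set_integrable_mult_right) simp

lemma L2_mult: assumes "L2 l f" shows "L2 l (\<lambda>x. c * f x)"
proof -
  have "(\<lambda>x. c * (indicat_real (seg l) x *\<^sub>R f x)) \<in> borel_measurable lborel"
    using assms unfolding L2_def set_borel_measurable_def
    by (intro borel_measurable_times borel_measurable_const) simp
  then show ?thesis
    using assms unfolding L2_def set_borel_measurable_def
    by (auto simp: norm_mult power_mult_distrib intro!: set_integrable_mult_right)
qed

lemma L1_cnj: "L1 l f \<Longrightarrow> L1 l (\<lambda>x. cnj (f x))"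
  unfolding L1_def set_integrable_def by (drule integrable_cnj) simp

lemma L2_cnj: assumes "L2 l f" shows "L2 l (\<lambda>x. cnj (f x))"
proof -
  have "(\<lambda>x. cnj (indicat_real (seg l) x *\<^sub>R f x)) \<in> borel_measurable lborel"
    using assms unfolding L2_def set_borel_measurable_def
    by (intro measurable_compose[OF _ borel_measurable_continuous_onI[of cnj]] continuous_intros) simp
  then show ?thesis
    using assms unfolding L2_def set_borel_measurable_def by simp
qed

lemma L1_0: "L1 l (\<lambda>x. 0)" and L2_0: "L2 l (\<lambda>x. 0)" and Linf_const: "Linf l (\<lambda>x. c)"
  unfolding L1_def L2_def Linf_def set_borel_measurable_def set_integrable_def
  by (auto simp: seg_def intro!: exI[of _ "cmod c"])

lemma dim_path_exp_term [simp]: "dim_row (path_exp_term D Q n x y) = D" "dim_col (path_exp_term D Q n x y) = D"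
  by (rule carrier_matD[OF path_exp_term_carrier])+

lemma dim_path_exp [simp]: "dim_row (path_exp D Q x y) = D" "dim_col (path_exp D Q x y) = D"
  by (simp_all add: path_exp_def)

lemma mat_fun_carrier: "mat_fun l D P F \<Longrightarrow> x \<in> seg l \<Longrightarrow> F x \<in> carrier_mat D D"
  by (simp add: mat_fun_def)

lemma mat_fun_L1_generator: "mat_fun l D (L1 l) Q \<Longrightarrow> L1_generator l D Q"
  by unfold_locales

subsection \<open>Matrix strings\<close>

lemma mat_string_carrier:
  "(\<And>x K. (x, K) \<in> set ks \<Longrightarrow> K \<in> carrier_mat D D) \<Longrightarrow> mat_string D Q a b ks \<in> carrier_mat D D"
proof (induction ks arbitrary: a)
  case (Cons k ks)
  obtain x K where "k = (x, K)" by (cases k)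
  with Cons show ?case by (auto intro!: mult_carrier_mat[of _ D D])
qed simp

text \<open>Rank-one operators have \<open>T = 0\<close>; this removes every word that contains an
  \<open>Ad_leg\<close>.\<close>

lemma mat_string_zero:
  assumes "\<And>x K. (x, K) \<in> set ks \<Longrightarrow> K \<in> carrier_mat D D" "(y, 0\<^sub>m D D) \<in> set ks"
  shows "mat_string D Q a b ks = 0\<^sub>m D D"
  using assms
proof (induction ks arbitrary: a)
  case (Cons k ks)
  obtain x K where k: "k = (x, K)" by (cases k)
  have S: "mat_string D Q x b ks \<in> carrier_mat D D" using Cons.prems by (intro mat_string_carrier) auto
  show ?case
  proof (cases "k = (y, 0\<^sub>m D D)")
    case True
    then show ?thesis using S k by (simp add: right_mult_zero_mat[OF path_exp_carrier] left_mult_zero_mat)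
  next
    case False
    then have "mat_string D Q x b ks = 0\<^sub>m D D" using Cons by auto
    moreover have "path_exp D Q a x * K \<in> carrier_mat D D"
      using Cons.prems k by (auto intro!: mult_carrier_mat[of _ D D])
    ultimately show ?thesis using k right_mult_zero_mat[of "path_exp D Q a x * K" D D D] by simp
  qed
qed simp

text \<open>The propagator in front of the first insertion may be cut at any earlier point. Read
  from right to left, this repairs a cut that was caused by an insertion in the other tensor
  factor.\<close>

lemma (in L1_generator) mat_string_split:
  assumes "a \<in> seg l" "x \<in> seg l" "b \<in> seg l" "a \<le> x" "x \<le> b"
    and "\<And>y K. (y, K) \<in> set ks \<Longrightarrow> y \<in> seg l \<and> x \<le> y \<and> K \<in> carrier_mat D D"
  shows "mat_string D Q a b ks = path_exp D Q a x * mat_string D Q x b ks"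
proof (cases ks)
  case Nil
  then show ?thesis using path_exp_split[OF assms(1-5)] by simp
next
  case (Cons k ks')
  obtain y K where k: "k = (y, K)" by (cases k)
  have y: "y \<in> seg l" "x \<le> y" and K: "K \<in> carrier_mat D D" using assms(6)[of y K] Cons k by auto
  have S: "mat_string D Q y b ks' \<in> carrier_mat D D"
    by (rule mat_string_carrier) (use assms(6) Cons in auto)
  note V = path_exp_carrier[of D Q]
  have "path_exp D Q a y = path_exp D Q a x * path_exp D Q x y"
    using assms y by (intro path_exp_split)
  then show ?thesis
    using Cons k assoc_mult_mat[OF V V K] assoc_mult_mat[OF V mult_carrier_mat[OF V K] S] by simp
qed

subsection \<open>Complex conjugation\<close>

text \<open>Entrywise conjugation, unlike the adjoint, preserves the order of factors. That is what
  a conjugated bra amplitude requires, since its points still increase from left to right.\<close>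

lemma map_mat_mult_cnj:
  assumes "A \<in> carrier_mat n m" "B \<in> carrier_mat m p"
  shows "map_mat cnj (A * B) = map_mat cnj A * map_mat cnj B"
proof (rule eq_matI)
  fix i j assume "i < dim_row (map_mat cnj A * map_mat cnj B)" "j < dim_col (map_mat cnj A * map_mat cnj B)"
  then show "map_mat cnj (A * B) $$ (i, j) = (map_mat cnj A * map_mat cnj B) $$ (i, j)"
    using assms by (auto simp: scalar_prod_def)
qed auto

lemma mat_trace_map_cnj: "A \<in> carrier_mat n n \<Longrightarrow> mat_trace (map_mat cnj A) = cnj (mat_trace A)"
  by (auto simp: mat_trace_def)

context L1_generator
begin

lemma cnj_generator: "L1_generator l D (\<lambda>x. map_mat cnj (Q x))"
  unfolding L1_generator_def mat_fun_def
proof (intro conjI ballI allI impI)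
  fix i j assume "i < D" "j < D"
  then have "L1 l (\<lambda>x. cnj (Q x $$ (i, j)))" using L1 by (intro L1_cnj) (auto simp: mat_fun_def)
  also have "L1 l (\<lambda>x. cnj (Q x $$ (i, j))) = L1 l (\<lambda>x. map_mat cnj (Q x) $$ (i, j))"
    using \<open>i < D\<close> \<open>j < D\<close> carrier by (intro L1_cong) (metis carrier_matD index_map_mat(1))
  finally show "L1 l (\<lambda>x. map_mat cnj (Q x) $$ (i, j))" .
qed (use carrier in auto)

lemma path_exp_term_cnj:
  assumes "x \<in> seg l" "y \<in> seg l"
  shows "path_exp_term D (\<lambda>x. map_mat cnj (Q x)) n x y = map_mat cnj (path_exp_term D Q n x y)"
  using assms(2)
proof (induction n arbitrary: y)
  case 0
  show ?case by (rule eq_matI) auto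
next
  case (Suc n)
  interpret c: L1_generator l D "\<lambda>x. map_mat cnj (Q x)" by (rule cnj_generator)
  show ?case
  proof (rule eq_matI)
    fix i j assume "i < dim_row (map_mat cnj (path_exp_term D Q (Suc n) x y))"
      "j < dim_col (map_mat cnj (path_exp_term D Q (Suc n) x y))"
    then have ij: "i < D" "j < D" using path_exp_term_carrier[of D Q "Suc n" x y] by auto
    have "path_exp_term D (\<lambda>x. map_mat cnj (Q x)) (Suc n) x y $$ (i, j) =
        (LINT z:{x..y}|lborel. cnj (\<Sum>k<D. path_exp_term D Q n x z $$ (i, k) * Q z $$ (k, j)))"
      unfolding c.term_Suc_index[OF assms(1) Suc.prems ij]
    proof (rule set_lebesgue_integral_cong, simp, intro allI impI)
      fix z assume "z \<in> {x..y}"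
      then have z: "z \<in> seg l" using seg_Icc_subset[OF assms(1) Suc.prems] by blast
      show "(\<Sum>k<D. path_exp_term D (\<lambda>x. map_mat cnj (Q x)) n x z $$ (i, k) * map_mat cnj (Q z) $$ (k, j)) =
          cnj (\<Sum>k<D. path_exp_term D Q n x z $$ (i, k) * Q z $$ (k, j))"
        using ij carrier[OF z] path_exp_term_carrier[of D Q n x z] by (simp add: Suc.IH[OF z])
    qed
    also have "\<dots> = cnj (path_exp_term D Q (Suc n) x y $$ (i, j))"
      unfolding term_Suc_index[OF assms(1) Suc.prems ij] set_lebesgue_integral_def
      unfolding Bochner_Integration.integral_cnj[symmetric] by simp
    finally show "path_exp_term D (\<lambda>x. map_mat cnj (Q x)) (Suc n) x y $$ (i, j) =
        map_mat cnj (path_exp_term D Q (Suc n) x y) $$ (i, j)"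
      using ij path_exp_term_carrier[of D Q "Suc n" x y] by simp
  qed auto
qed

lemma path_exp_cnj:
  assumes "x \<in> seg l" "y \<in> seg l" "x \<le> y"
  shows "path_exp D (\<lambda>x. map_mat cnj (Q x)) x y = map_mat cnj (path_exp D Q x y)"
proof (rule eq_matI)
  fix i j assume "i < dim_row (map_mat cnj (path_exp D Q x y))" "j < dim_col (map_mat cnj (path_exp D Q x y))"
  then have ij: "i < D" "j < D" using path_exp_carrier[of D Q x y] by auto
  have "summable (\<lambda>n. path_exp_term D Q n x y $$ (i, j))"
    using term_summable[OF assms ij] by (rule summable_norm_cancel)
  then have "(\<lambda>n. cnj (path_exp_term D Q n x y $$ (i, j))) sums cnj (path_exp D Q x y $$ (i, j))"
    using ij by (simp add: path_exp_index sums_cnj summable_sums)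
  then show "path_exp D (\<lambda>x. map_mat cnj (Q x)) x y $$ (i, j) = map_mat cnj (path_exp D Q x y) $$ (i, j)"
    using ij assms path_exp_carrier[of D Q x y] path_exp_term_carrier[of D Q _ x y]
    by (simp add: path_exp_index path_exp_term_cnj sums_iff)
qed (auto simp: path_exp_def)

text \<open>Sortedness lets each propagator run from a smaller to a larger endpoint, where
  convergence of the Dyson series is available and conjugation passes through the sum.\<close>

lemma mat_string_cnj:
  assumes "a \<in> seg l" "b \<in> seg l" "a \<le> b" "sorted (map fst ks)"
    and "\<And>y K. (y, K) \<in> set ks \<Longrightarrow> y \<in> seg l \<and> a \<le> y \<and> y \<le> b \<and> K \<in> carrier_mat D D"
  shows "mat_string D (\<lambda>x. map_mat cnj (Q x)) a b (map (\<lambda>(y, K). (y, map_mat cnj K)) ks) =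
    map_mat cnj (mat_string D Q a b ks)"
  using assms
proof (induction ks arbitrary: a)
  case Nil
  then show ?case by (simp add: path_exp_cnj)
next
  case (Cons k ks)
  obtain x K where k: "k = (x, K)" by (cases k)
  have x: "x \<in> seg l" "a \<le> x" "x \<le> b" and K: "K \<in> carrier_mat D D" using Cons.prems(5)[of x K] k by auto
  have S: "mat_string D Q x b ks \<in> carrier_mat D D" using Cons.prems(5) by (intro mat_string_carrier) auto
  have "mat_string D (\<lambda>x. map_mat cnj (Q x)) x b (map (\<lambda>(y, K). (y, map_mat cnj K)) ks) =
      map_mat cnj (mat_string D Q x b ks)"
    using Cons.prems k x by (intro Cons.IH) auto
  then show ?case
    using k path_exp_cnj[OF Cons.prems(1) x(1,2)] map_mat_mult_cnj[OF path_exp_carrier K]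
      map_mat_mult_cnj[OF mult_carrier_mat[OF path_exp_carrier K] S] by simp
qed

end

subsection \<open>Kronecker products\<close>

definition kron :: "complex mat \<Rightarrow> complex mat \<Rightarrow> complex mat" where
  "kron A B = Matrix.mat (dim_row A * dim_row B) (dim_col A * dim_col B)
     (\<lambda>(i, j). A $$ (i div dim_row B, j div dim_col B) * B $$ (i mod dim_row B, j mod dim_col B))"

lemma kron_carrier:
  "A \<in> carrier_mat n m \<Longrightarrow> B \<in> carrier_mat p q \<Longrightarrow> kron A B \<in> carrier_mat (n * p) (m * q)"
  by (auto simp: kron_def)

lemma kron_index:
  assumes "A \<in> carrier_mat n m" "B \<in> carrier_mat p q" "i < n * p" "j < m * q"
  shows "kron A B $$ (i, j) = A $$ (i div p, j div q) * B $$ (i mod p, j mod q)"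
  using assms by (auto simp: kron_def)

lemma div_mod_less_mult:
  fixes i :: nat
  assumes "i < a * b"
  shows "i div b < a" "i mod b < b"
proof -
  show "i div b < a" using assms by (rule less_mult_imp_div_less)
  have "b > 0" using assms by (cases b) auto
  then show "i mod b < b" by simp
qed

text \<open>Composite indices of a Kronecker product are pairs written in base \<open>b\<close>; the
  inverse of the encoding is \<open>p * b + q\<close>.\<close>

lemma sum_div_mod:
  fixes h :: "nat \<Rightarrow> nat \<Rightarrow> 'a::comm_monoid_add"
  shows "(\<Sum>m<a * b. h (m div b) (m mod b)) = (\<Sum>p<a. \<Sum>q<b. h p q)"
  unfolding sum.cartesian_product
proof (rule sum.reindex_bij_witness[of _ "\<lambda>(p, q). p * b + q" "\<lambda>m. (m div b, m mod b)"])
  fix x assume "x \<in> {..<a} \<times> {..<b}"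
  then obtain p q where x: "x = (p, q)" "p < a" "q < b" by auto
  then have "p * b + q < (p + 1) * b" by simp
  also have "\<dots> \<le> a * b" using x by (intro mult_right_mono) auto
  finally show "(case x of (p, q) \<Rightarrow> p * b + q) \<in> {..<a * b}" using x by simp
qed (use div_mod_less_mult in auto)

lemma kron_mult:
  assumes "A \<in> carrier_mat n n" "C \<in> carrier_mat n n" "B \<in> carrier_mat m m" "D \<in> carrier_mat m m"
  shows "kron A B * kron C D = kron (A * C) (B * D)"
proof (rule eq_matI)
  fix i j assume "i < dim_row (kron (A * C) (B * D))" "j < dim_col (kron (A * C) (B * D))"
  then have i: "i < n * m" and j: "j < n * m" using assms by (auto simp: kron_def)
  note ij = div_mod_less_mult[OF i] div_mod_less_mult[OF j]
  have "(kron A B * kron C D) $$ (i, j) = (\<Sum>k<n * m. kron A B $$ (i, k) * kron C D $$ (k, j))"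
    by (rule mult_mat_index_sum[OF kron_carrier[OF assms(1,3)] kron_carrier[OF assms(2,4)] i j])
  also have "\<dots> = (\<Sum>k<n * m. A $$ (i div m, k div m) * B $$ (i mod m, k mod m) *
      (C $$ (k div m, j div m) * D $$ (k mod m, j mod m)))"
    using assms i j by (intro sum.cong refl) (auto simp: kron_index)
  also have "\<dots> = (\<Sum>p<n. \<Sum>q<m. A $$ (i div m, p) * B $$ (i mod m, q) * (C $$ (p, j div m) * D $$ (q, j mod m)))"
    by (rule sum_div_mod)
  also have "\<dots> = (A * C) $$ (i div m, j div m) * (B * D) $$ (i mod m, j mod m)"
    using mult_mat_index_sum[OF assms(1,2) ij(1,3)] mult_mat_index_sum[OF assms(3,4) ij(2,4)]
    by (simp add: sum_product mult_ac)
  also have "\<dots> = kron (A * C) (B * D) $$ (i, j)"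
    using assms i j by (intro kron_index[symmetric]) auto
  finally show "(kron A B * kron C D) $$ (i, j) = kron (A * C) (B * D) $$ (i, j)" .
qed (use assms in \<open>auto simp: kron_def\<close>)

lemma mat_trace_kron:
  assumes "A \<in> carrier_mat n n" "B \<in> carrier_mat m m"
  shows "mat_trace (kron A B) = mat_trace A * mat_trace B"
proof -
  have "mat_trace (kron A B) = (\<Sum>i<n * m. A $$ (i div m, i div m) * B $$ (i mod m, i mod m))"
    using assms unfolding mat_trace_def
    by (intro sum.cong) (auto simp: kron_def)
  also have "\<dots> = (\<Sum>p<n. \<Sum>q<m. A $$ (p, p) * B $$ (q, q))"
    by (rule sum_div_mod)
  also have "\<dots> = mat_trace A * mat_trace B"
    using assms by (simp add: mat_trace_def sum_product)
  finally show ?thesis .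
qed

text \<open>The Kronecker sum. Its two summands commute even when taken at different positions,
  which is why its ordered exponential is a Kronecker product.\<close>

definition kron_sum :: "nat \<Rightarrow> nat \<Rightarrow> complex mat \<Rightarrow> complex mat \<Rightarrow> complex mat" where
  "kron_sum n m A B = kron A (1\<^sub>m m) + kron (1\<^sub>m n) B"

lemma kron_sum_carrier:
  "A \<in> carrier_mat n n \<Longrightarrow> B \<in> carrier_mat m m \<Longrightarrow> kron_sum n m A B \<in> carrier_mat (n * m) (n * m)"
  unfolding kron_sum_def by (intro add_carrier_mat kron_carrier) auto

lemma kron_sum_index:
  assumes "A \<in> carrier_mat n n" "B \<in> carrier_mat m m" "i < n * m" "j < n * m"
  shows "kron_sum n m A B $$ (i, j) =
    of_bool (i mod m = j mod m) * A $$ (i div m, j div m) + of_bool (i div m = j div m) * B $$ (i mod m, j mod m)"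
proof -
  note ij = div_mod_less_mult[OF assms(3)] div_mod_less_mult[OF assms(4)]
  have "kron_sum n m A B $$ (i, j) = kron A (1\<^sub>m m) $$ (i, j) + kron (1\<^sub>m n) B $$ (i, j)"
    unfolding kron_sum_def using assms kron_carrier[OF one_carrier_mat assms(2), of n] by simp
  then show ?thesis
    using assms ij by (simp add: kron_index[where n=n and m=n and p=m and q=m])
qed

locale L1_generator_pair =
  fst: L1_generator l d1 Q1 + snd: L1_generator l d2 Q2
  for l :: real and d1 d2 :: nat and Q1 Q2 :: "real \<Rightarrow> complex mat"
begin

sublocale kron: L1_generator l "d1 * d2" "\<lambda>x. kron_sum d1 d2 (Q1 x) (Q2 x)"
proof
  show "mat_fun l (d1 * d2) (L1 l) (\<lambda>x. kron_sum d1 d2 (Q1 x) (Q2 x))"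
    unfolding mat_fun_def
  proof (intro conjI ballI allI impI)
    fix i j assume ij: "i < d1 * d2" "j < d1 * d2"
    note b = div_mod_less_mult[OF ij(1)] div_mod_less_mult[OF ij(2)]
    have "L1 l (\<lambda>x. of_bool (i mod d2 = j mod d2) * Q1 x $$ (i div d2, j div d2) +
        of_bool (i div d2 = j div d2) * Q2 x $$ (i mod d2, j mod d2))"
      using fst.L1 snd.L1 b by (intro L1_add L1_mult) (auto simp: mat_fun_def)
    then show "L1 l (\<lambda>x. kron_sum d1 d2 (Q1 x) (Q2 x) $$ (i, j))"
      using ij fst.carrier snd.carrier by (subst L1_cong) (auto simp: kron_sum_index)
  qed (use fst.carrier snd.carrier kron_sum_carrier in auto)
qed

abbreviation "T1 \<equiv> path_exp_term d1 Q1"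
abbreviation "T2 \<equiv> path_exp_term d2 Q2"
abbreviation "QQ x \<equiv> kron_sum d1 d2 (Q1 x) (Q2 x)"

text \<open>Each of the \<open>n\<close> insertions acts on one of the two factors; summed over all
  interleavings, \<open>k\<close> insertions in one and \<open>n - k\<close> in the other give a
  product of Dyson terms. In the induction only the factor hit by the last insertion is
  distinguished, and this is the Leibniz rule.\<close>

lemma path_exp_term_kron:
  assumes "x \<in> seg l" "y \<in> seg l" "x \<le> y" "i < d1 * d2" "j < d1 * d2"
  shows "path_exp_term (d1 * d2) QQ n x y $$ (i, j) =
    (\<Sum>k\<le>n. T1 k x y $$ (i div d2, j div d2) * T2 (n - k) x y $$ (i mod d2, j mod d2))"
  using assms(2,3,5)
proof (induction n arbitrary: y j)
  case 0
  note b = div_mod_less_mult[OF assms(4)] div_mod_less_mult[OF 0(3)]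
  have "i = j \<longleftrightarrow> i div d2 = j div d2 \<and> i mod d2 = j mod d2"
    by (metis div_mult_mod_eq)
  then show ?case using 0 assms(4) b by auto
next
  case (Suc n)
  note b = div_mod_less_mult[OF assms(4)] div_mod_less_mult[OF Suc.prems(3)]
  let ?f = "\<lambda>k t. \<Sum>p<d1. T1 k x t $$ (i div d2, p) * Q1 t $$ (p, j div d2)"
  let ?g = "\<lambda>k t. \<Sum>q<d2. T2 k x t $$ (i mod d2, q) * Q2 t $$ (q, j mod d2)"
  have "path_exp_term (d1 * d2) QQ (Suc n) x y $$ (i, j) =
      (LINT t:{x..y}|lborel. \<Sum>k\<le>n. ?f k t * T2 (n - k) x t $$ (i mod d2, j mod d2) +
        T1 k x t $$ (i div d2, j div d2) * ?g (n - k) t)"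
    unfolding kron.term_Suc_index[OF assms(1) Suc.prems(1) assms(4) Suc.prems(3)]
  proof (rule set_lebesgue_integral_cong, simp, intro allI impI)
    fix t assume t: "t \<in> {x..y}"
    then have ts: "t \<in> seg l" using seg_Icc_subset[OF assms(1) Suc.prems(1)] by blast
    let ?h = "\<lambda>p q. \<Sum>k\<le>n. T1 k x t $$ (i div d2, p) * T2 (n - k) x t $$ (i mod d2, q)"
    have "(\<Sum>m<d1 * d2. path_exp_term (d1 * d2) QQ n x t $$ (i, m) * QQ t $$ (m, j)) =
        (\<Sum>m<d1 * d2. ?h (m div d2) (m mod d2) *
          (of_bool (m mod d2 = j mod d2) * Q1 t $$ (m div d2, j div d2) +
           of_bool (m div d2 = j div d2) * Q2 t $$ (m mod d2, j mod d2)))"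
      using Suc.IH[OF ts] t Suc.prems fst.carrier[OF ts] snd.carrier[OF ts]
      by (intro sum.cong refl) (simp add: kron_sum_index)
    also have "\<dots> = (\<Sum>p<d1. \<Sum>q<d2. ?h p q *
          (of_bool (q = j mod d2) * Q1 t $$ (p, j div d2) + of_bool (p = j div d2) * Q2 t $$ (q, j mod d2)))"
      by (rule sum_div_mod)
    also have "\<dots> = (\<Sum>p<d1. \<Sum>q<d2. of_bool (q = j mod d2) * (?h p q * Q1 t $$ (p, j div d2))) +
        (\<Sum>q<d2. \<Sum>p<d1. of_bool (p = j div d2) * (?h p q * Q2 t $$ (q, j mod d2)))"
      unfolding sum.swap[of _ "{..<d1}" "{..<d2}"]
      by (simp only: sum.distrib[symmetric] distrib_left mult.left_commute)
    \<comment> \<open>Each Kronecker delta removes one summation, leaving \<open>Q1\<close> acting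
      on the first index or \<open>Q2\<close> on the second.\<close>
    also have "\<dots> = (\<Sum>p<d1. ?h p (j mod d2) * Q1 t $$ (p, j div d2)) +
        (\<Sum>q<d2. ?h (j div d2) q * Q2 t $$ (q, j mod d2))"
      using b by (simp add: of_bool_def if_distrib[of "\<lambda>x. x * _"] cong: if_cong)
    also have "(\<Sum>p<d1. ?h p (j mod d2) * Q1 t $$ (p, j div d2)) =
        (\<Sum>k\<le>n. ?f k t * T2 (n - k) x t $$ (i mod d2, j mod d2))"
      unfolding sum_distrib_right sum.swap[of _ "{..n}"] by (simp add: mult_ac)
    also have "(\<Sum>q<d2. ?h (j div d2) q * Q2 t $$ (q, j mod d2)) =
        (\<Sum>k\<le>n. T1 k x t $$ (i div d2, j div d2) * ?g (n - k) t)"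
      unfolding sum_distrib_right sum_distrib_left sum.swap[of _ "{..n}"] by (simp add: mult_ac)
    finally show "(\<Sum>m<d1 * d2. path_exp_term (d1 * d2) QQ n x t $$ (i, m) * QQ t $$ (m, j)) =
        (\<Sum>k\<le>n. ?f k t * T2 (n - k) x t $$ (i mod d2, j mod d2) +
          T1 k x t $$ (i div d2, j div d2) * ?g (n - k) t)"
      by (simp add: sum.distrib)
  qed
  \<comment> \<open>The terms of order \<open>Suc k\<close> are primitives of \<open>?f k\<close>
    and \<open>?g k\<close>, so the integrand has the form required by the integrated Leibniz
    rule.\<close>
  also have "\<dots> = (\<Sum>k\<le>Suc n. T1 k x y $$ (i div d2, j div d2) * T2 (Suc n - k) x y $$ (i mod d2, j mod d2))"
  proof (rule set_integral_convolution)
    have sub: "t \<in> seg l" if "t \<in> {x..y}" for t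
      using that seg_Icc_subset[OF assms(1) Suc.prems(1)] by blast
    show "set_integrable lborel {x..y} (?f k)" "set_integrable lborel {x..y} (?g k)" for k
      using assms(1) Suc.prems(1) b by (intro fst.term_integrable snd.term_integrable; simp)+
    show "T1 (Suc k) x t $$ (i div d2, j div d2) = (LINT s:{x..t}|lborel. ?f k s)"
      "T2 (Suc k) x t $$ (i mod d2, j mod d2) = (LINT s:{x..t}|lborel. ?g k s)" if "t \<in> {x..y}" for k t
      using assms(1) sub[OF that] b by (intro fst.term_Suc_index snd.term_Suc_index; simp)+
  qed (use Suc.prems in auto)
  finally show ?case .
qed

lemma path_exp_kron:
  assumes "x \<in> seg l" "y \<in> seg l" "x \<le> y"
  shows "path_exp (d1 * d2) QQ x y = kron (path_exp d1 Q1 x y) (path_exp d2 Q2 x y)"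
proof (rule eq_matI)
  fix i j assume "i < dim_row (kron (path_exp d1 Q1 x y) (path_exp d2 Q2 x y))"
    "j < dim_col (kron (path_exp d1 Q1 x y) (path_exp d2 Q2 x y))"
  then have ij: "i < d1 * d2" "j < d1 * d2" by (auto simp: kron_def)
  note b = div_mod_less_mult[OF ij(1)] div_mod_less_mult[OF ij(2)]
  have "path_exp (d1 * d2) QQ x y $$ (i, j) =
      (\<Sum>n. \<Sum>k\<le>n. T1 k x y $$ (i div d2, j div d2) * T2 (n - k) x y $$ (i mod d2, j mod d2))"
    using assms ij by (simp add: path_exp_index path_exp_term_kron)
  also have "\<dots> = path_exp d1 Q1 x y $$ (i div d2, j div d2) * path_exp d2 Q2 x y $$ (i mod d2, j mod d2)"
    using Cauchy_product[OF fst.term_summable snd.term_summable, OF assms b(1,3) assms b(2,4)] b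
    by (simp add: path_exp_index)
  also have "\<dots> = kron (path_exp d1 Q1 x y) (path_exp d2 Q2 x y) $$ (i, j)"
    using ij by (intro kron_index[symmetric]) auto
  finally show "path_exp (d1 * d2) QQ x y $$ (i, j) = kron (path_exp d1 Q1 x y) (path_exp d2 Q2 x y) $$ (i, j)" .
qed (auto simp: kron_def)

text \<open>A left or right leg inserts a matrix in one factor and the identity in the other, so the
  mixed-product rule separates the strings. An \<open>Ad_leg\<close> would insert an arbitrary
  \<open>T y\<close>, which need not factorize.\<close>

lemma mat_string_kron:
  assumes "a \<in> seg l" "b \<in> seg l" "a \<le> b" "sorted (map fst zs)"
    and "\<And>y g. (y, g) \<in> set zs \<Longrightarrow> y \<in> seg l \<and> a \<le> y \<and> y \<le> b \<and> g \<noteq> Ad_leg"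
    and L: "\<And>y. y \<in> seg l \<Longrightarrow> L y \<in> carrier_mat d1 d1" and R: "\<And>y. y \<in> seg l \<Longrightarrow> R y \<in> carrier_mat d2 d2"
  shows "mat_string (d1 * d2) QQ a b
      (map (\<lambda>(y, g). (y, leg_mat (kron (L y) (1\<^sub>m d2)) (kron (1\<^sub>m d1) (R y)) (T y) g)) zs) =
    kron (mat_string d1 Q1 a b (map (\<lambda>z. (fst z, L (fst z))) (filter (\<lambda>z. snd z \<noteq> Right_leg) zs)))
      (mat_string d2 Q2 a b (map (\<lambda>z. (fst z, R (fst z))) (filter (\<lambda>z. snd z \<noteq> Left_leg) zs)))"
  using assms(1-5)
proof (induction zs arbitrary: a)
  case Nil
  then show ?case by (simp add: path_exp_kron)
next
  case (Cons z zs)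
  obtain x g where z: "z = (x, g)" by (cases z)
  have x: "x \<in> seg l" "a \<le> x" "x \<le> b" "g \<noteq> Ad_leg" using Cons.prems(5)[of x g] z by auto
  let ?l = "map (\<lambda>z. (fst z, L (fst z))) (filter (\<lambda>z. snd z \<noteq> Right_leg) zs)"
  let ?r = "map (\<lambda>z. (fst z, R (fst z))) (filter (\<lambda>z. snd z \<noteq> Left_leg) zs)"
  have IH: "mat_string (d1 * d2) QQ x b
      (map (\<lambda>(y, g). (y, leg_mat (kron (L y) (1\<^sub>m d2)) (kron (1\<^sub>m d1) (R y)) (T y) g)) zs) =
      kron (mat_string d1 Q1 x b ?l) (mat_string d2 Q2 x b ?r)"
    using Cons.prems x z by (intro Cons.IH) auto
  have tail: "(y, h) \<in> set zs \<Longrightarrow> y \<in> seg l \<and> x \<le> y" for y h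
    using Cons.prems(4,5) z by fastforce
  have Lx: "L x \<in> carrier_mat d1 d1" and Rx: "R x \<in> carrier_mat d2 d2" using L R x by auto
  note P = path_exp_carrier[of d1 Q1 a x] path_exp_carrier[of d2 Q2 a x]
  have S: "mat_string d1 Q1 x b ?l \<in> carrier_mat d1 d1" "mat_string d2 Q2 x b ?r \<in> carrier_mat d2 d2"
    using tail L R by (intro mat_string_carrier; force)+
  \<comment> \<open>At a right leg the ket string is cut at \<open>x\<close> without an insertion,
    at a left leg the bra string; \<open>s1\<close> and \<open>s2\<close> undo these cuts.\<close>
  have s1: "mat_string d1 Q1 a b ?l = path_exp d1 Q1 a x * mat_string d1 Q1 x b ?l"
    using Cons.prems x tail L by (intro fst.mat_string_split) force+
  have s2: "mat_string d2 Q2 a b ?r = path_exp d2 Q2 a x * mat_string d2 Q2 x b ?r"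
    using Cons.prems x tail R by (intro snd.mat_string_split) force+
  have V: "path_exp (d1 * d2) QQ a x = kron (path_exp d1 Q1 a x) (path_exp d2 Q2 a x)"
    using Cons.prems x by (intro path_exp_kron)
  show ?case
  proof (cases g)
    case Left_leg
    have "kron (path_exp d1 Q1 a x) (path_exp d2 Q2 a x) * kron (L x) (1\<^sub>m d2) *
        kron (mat_string d1 Q1 x b ?l) (mat_string d2 Q2 x b ?r) =
        kron (path_exp d1 Q1 a x * L x * mat_string d1 Q1 x b ?l) (path_exp d2 Q2 a x * mat_string d2 Q2 x b ?r)"
      using kron_mult[OF P(1) Lx P(2) one_carrier_mat]
        kron_mult[OF mult_carrier_mat[OF P(1) Lx] S(1) P(2) S(2)] right_mult_one_mat[OF P(2)] by simp
    then show ?thesis using z Left_leg IH V s2 by simp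
  next
    case Right_leg
    have "kron (path_exp d1 Q1 a x) (path_exp d2 Q2 a x) * kron (1\<^sub>m d1) (R x) *
        kron (mat_string d1 Q1 x b ?l) (mat_string d2 Q2 x b ?r) =
        kron (path_exp d1 Q1 a x * mat_string d1 Q1 x b ?l) (path_exp d2 Q2 a x * R x * mat_string d2 Q2 x b ?r)"
      using kron_mult[OF P(1) one_carrier_mat P(2) Rx]
        kron_mult[OF P(1) S(1) mult_carrier_mat[OF P(2) Rx] S(2)] right_mult_one_mat[OF P(1)] by simp
    then show ?thesis using z Right_leg IH V s1 by simp
  next
    case Ad_leg
    then show ?thesis using x by simp
  qed
qed

end

subsection \<open>Direct sums\<close>

definition dirsum :: "complex mat \<Rightarrow> complex mat \<Rightarrow> complex mat" where
  "dirsum A B = four_block_mat A (0\<^sub>m (dim_row A) (dim_col B)) (0\<^sub>m (dim_row B) (dim_col A)) B"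

lemma dirsum_carrier:
  "A \<in> carrier_mat n n \<Longrightarrow> B \<in> carrier_mat m m \<Longrightarrow> dirsum A B \<in> carrier_mat (n + m) (n + m)"
  unfolding dirsum_def by (intro four_block_carrier_mat)

lemma dirsum_index:
  assumes "A \<in> carrier_mat n n" "B \<in> carrier_mat m m" "i < n + m" "j < n + m"
  shows "dirsum A B $$ (i, j) =
    (if i < n then if j < n then A $$ (i, j) else 0 else if j < n then 0 else B $$ (i - n, j - n))"
  using assms by (auto simp: dirsum_def)

lemma dim_dirsum [simp]:
  "dim_row (dirsum A B) = dim_row A + dim_row B" "dim_col (dirsum A B) = dim_col A + dim_col B"
  by (simp_all add: dirsum_def)

lemma dirsum_mult:
  assumes "A \<in> carrier_mat n n" "C \<in> carrier_mat n n" "B \<in> carrier_mat m m" "D \<in> carrier_mat m m"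
  shows "dirsum A B * dirsum C D = dirsum (A * C) (B * D)"
proof -
  have "dirsum A B * dirsum C D = four_block_mat (A * C + 0\<^sub>m n m * 0\<^sub>m m n) (A * 0\<^sub>m n m + 0\<^sub>m n m * D)
      (0\<^sub>m m n * C + B * 0\<^sub>m m n) (0\<^sub>m m n * 0\<^sub>m n m + B * D)"
    using assms unfolding dirsum_def by (subst mult_four_block_mat) auto
  then show ?thesis
    using assms left_add_zero_mat[OF mult_carrier_mat[OF assms(3,4)]]
      right_add_zero_mat[OF mult_carrier_mat[OF assms(1,2)]]
    by (simp add: dirsum_def)
qed

lemma mat_trace_dirsum:
  assumes "A \<in> carrier_mat n n" "B \<in> carrier_mat m m"
  shows "mat_trace (dirsum A B) = mat_trace A + mat_trace B"
proof -
  have "mat_trace (dirsum A B) = (\<Sum>i<n + m. dirsum A B $$ (i, i))"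
    using assms by (simp add: mat_trace_def dirsum_def)
  also have "\<dots> = (\<Sum>i<n + m. if i < n then A $$ (i, i) else B $$ (i - n, i - n))"
    using assms by (intro sum.cong) (auto simp: dirsum_index)
  also have "\<dots> = (\<Sum>i<n. A $$ (i, i)) + (\<Sum>i<m. B $$ (i, i))"
  proof -
    have "{..<n + m} = {..<n} \<union> {n..<n + m}" by auto
    moreover have "(\<Sum>i\<in>{n..<n + m}. if i < n then A $$ (i, i) else B $$ (i - n, i - n)) = (\<Sum>i<m. B $$ (i, i))"
      by (rule sum.reindex_bij_witness[of _ "\<lambda>i. i + n" "\<lambda>i. i - n"]) auto
    ultimately show ?thesis by (simp add: sum.union_disjoint[of "{..<n}" "{n..<n + m}"] ivl_disj_int)
  qed
  finally show ?thesis using assms by (simp add: mat_trace_def)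
qed

text \<open>Stated for a general \<open>P\<close> to serve the three regularity classes at once. The
  formula for the entries holds only on \<open>seg l\<close>, where the shapes of the blocks are
  known; this is why \<open>cong\<close> is assumed.\<close>

lemma mat_fun_dirsum:
  assumes F: "mat_fun l n P F" and G: "mat_fun l m P G" and zero: "P (\<lambda>x. 0)"
    and cong: "\<And>f g. (\<And>x. x \<in> seg l \<Longrightarrow> f x = g x) \<Longrightarrow> P f = P g"
  shows "mat_fun l (n + m) P (\<lambda>x. dirsum (F x) (G x))"
  unfolding mat_fun_def
proof (intro conjI ballI allI impI)
  fix i j assume ij: "i < n + m" "j < n + m"
  have "P (\<lambda>x. if i < n then if j < n then F x $$ (i, j) else 0 else if j < n then 0 else G x $$ (i - n, j - n))"
    using F G zero ij by (cases "i < n"; cases "j < n") (auto simp: mat_fun_def)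
  also have "P (\<lambda>x. if i < n then if j < n then F x $$ (i, j) else 0 else if j < n then 0 else G x $$ (i - n, j - n)) =
      P (\<lambda>x. dirsum (F x) (G x) $$ (i, j))"
    using ij by (intro cong dirsum_index[OF mat_fun_carrier[OF F] mat_fun_carrier[OF G], symmetric])
  finally show "P (\<lambda>x. dirsum (F x) (G x) $$ (i, j))" .
qed (use F G in \<open>auto simp: mat_fun_def dirsum_carrier\<close>)

text \<open>Block-diagonal matrices never mix their blocks, so every entry is literally the scalar
  integral of one block or the integral of zero. Only the shapes of the matrices matter.\<close>

lemma path_exp_term_dirsum:
  assumes "\<And>z. z \<in> {x..y} \<Longrightarrow> Q1 z \<in> carrier_mat n n" "\<And>z. z \<in> {x..y} \<Longrightarrow> Q2 z \<in> carrier_mat m m"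
  shows "path_exp_term (n + m) (\<lambda>z. dirsum (Q1 z) (Q2 z)) k x y = dirsum (path_exp_term n Q1 k x y) (path_exp_term m Q2 k x y)"
  using assms
proof (induction k arbitrary: y)
  case 0
  show ?case by (rule eq_matI) (auto simp: dirsum_index[where n=n and m=m] dirsum_def)
next
  case (Suc k)
  show ?case
  proof (rule eq_matI)
    fix i j assume "i < dim_row (dirsum (path_exp_term n Q1 (Suc k) x y) (path_exp_term m Q2 (Suc k) x y))"
      "j < dim_col (dirsum (path_exp_term n Q1 (Suc k) x y) (path_exp_term m Q2 (Suc k) x y))"
    then have ij: "i < n + m" "j < n + m" by (auto simp: dirsum_def)
    let ?P1 = "\<lambda>z. path_exp_term n Q1 k x z * Q1 z" and ?P2 = "\<lambda>z. path_exp_term m Q2 k x z * Q2 z"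
    have "path_exp_term (n + m) (\<lambda>z. dirsum (Q1 z) (Q2 z)) (Suc k) x y $$ (i, j) =
      (LINT z:{x..y}|lborel. (path_exp_term (n + m) (\<lambda>z. dirsum (Q1 z) (Q2 z)) k x z * dirsum (Q1 z) (Q2 z)) $$ (i, j))"
      using ij by (simp add: path_exp_term.simps(2))
    also have "\<dots> = (LINT z:{x..y}|lborel. if i < n then if j < n then ?P1 z $$ (i, j) else 0
        else if j < n then 0 else ?P2 z $$ (i - n, j - n))"
    proof (rule set_lebesgue_integral_cong, simp, intro allI impI)
      fix z assume z: "z \<in> {x..y}"
      then have IH: "path_exp_term (n + m) (\<lambda>z. dirsum (Q1 z) (Q2 z)) k x z =
          dirsum (path_exp_term n Q1 k x z) (path_exp_term m Q2 k x z)"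
        using Suc.prems by (intro Suc.IH) auto
      show "(path_exp_term (n + m) (\<lambda>z. dirsum (Q1 z) (Q2 z)) k x z * dirsum (Q1 z) (Q2 z)) $$ (i, j) =
          (if i < n then if j < n then ?P1 z $$ (i, j) else 0 else if j < n then 0 else ?P2 z $$ (i - n, j - n))"
        unfolding IH dirsum_mult[OF path_exp_term_carrier Suc.prems(1)[OF z] path_exp_term_carrier Suc.prems(2)[OF z]]
        using Suc.prems z ij
        by (intro dirsum_index) (auto intro!: mult_carrier_mat[OF path_exp_term_carrier])
    qed
    also have "\<dots> = dirsum (path_exp_term n Q1 (Suc k) x y) (path_exp_term m Q2 (Suc k) x y) $$ (i, j)"
      using ij by (subst dirsum_index[where n=n and m=m])
        (auto simp: path_exp_term.simps(2) set_lebesgue_integral_def)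
    finally show "path_exp_term (n + m) (\<lambda>z. dirsum (Q1 z) (Q2 z)) (Suc k) x y $$ (i, j) =
      dirsum (path_exp_term n Q1 (Suc k) x y) (path_exp_term m Q2 (Suc k) x y) $$ (i, j)" .
  qed (auto simp: dirsum_def)
qed

lemma path_exp_dirsum:
  assumes "\<And>z. z \<in> {x..y} \<Longrightarrow> Q1 z \<in> carrier_mat n n" "\<And>z. z \<in> {x..y} \<Longrightarrow> Q2 z \<in> carrier_mat m m"
  shows "path_exp (n + m) (\<lambda>z. dirsum (Q1 z) (Q2 z)) x y = dirsum (path_exp n Q1 x y) (path_exp m Q2 x y)"
proof -
  have "path_exp_term (n + m) (\<lambda>z. dirsum (Q1 z) (Q2 z)) k x y =
      dirsum (path_exp_term n Q1 k x y) (path_exp_term m Q2 k x y)" for k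
    using assms by (rule path_exp_term_dirsum)
  then show ?thesis
    by (intro eq_matI) (auto simp: path_exp_index dirsum_index[where n=n and m=m])
qed

lemma mat_string_dirsum:
  assumes "a \<in> seg l" "b \<in> seg l"
    and Q: "\<And>z. z \<in> seg l \<Longrightarrow> Q1 z \<in> carrier_mat n n" "\<And>z. z \<in> seg l \<Longrightarrow> Q2 z \<in> carrier_mat m m"
    and "\<And>y g. (y, g) \<in> set zs \<Longrightarrow> y \<in> seg l \<and> K1 y g \<in> carrier_mat n n \<and> K2 y g \<in> carrier_mat m m"
  shows "mat_string (n + m) (\<lambda>z. dirsum (Q1 z) (Q2 z)) a b (map (\<lambda>(y, g). (y, dirsum (K1 y g) (K2 y g))) zs) =
    dirsum (mat_string n Q1 a b (map (\<lambda>(y, g). (y, K1 y g)) zs)) (mat_string m Q2 a b (map (\<lambda>(y, g). (y, K2 y g)) zs))"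
  using assms(1,5)
proof (induction zs arbitrary: a)
  case Nil
  then show ?case
    using seg_Icc_subset[OF Nil(1) assms(2)] Q by (simp, intro path_exp_dirsum) auto
next
  case (Cons z zs)
  obtain x g where z: "z = (x, g)" by (cases z)
  have x: "x \<in> seg l" and K: "K1 x g \<in> carrier_mat n n" "K2 x g \<in> carrier_mat m m"
    using Cons.prems(2)[of x g] z by auto
  have S: "mat_string n Q1 x b (map (\<lambda>(y, g). (y, K1 y g)) zs) \<in> carrier_mat n n"
      "mat_string m Q2 x b (map (\<lambda>(y, g). (y, K2 y g)) zs) \<in> carrier_mat m m"
    using Cons.prems by (intro mat_string_carrier; force)+
  have V: "path_exp (n + m) (\<lambda>z. dirsum (Q1 z) (Q2 z)) a x = dirsum (path_exp n Q1 a x) (path_exp m Q2 a x)"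
    using seg_Icc_subset[OF Cons.prems(1) x] Q by (intro path_exp_dirsum) auto
  have IH: "mat_string (n + m) (\<lambda>z. dirsum (Q1 z) (Q2 z)) x b (map (\<lambda>(y, g). (y, dirsum (K1 y g) (K2 y g))) zs) =
    dirsum (mat_string n Q1 x b (map (\<lambda>(y, g). (y, K1 y g)) zs)) (mat_string m Q2 x b (map (\<lambda>(y, g). (y, K2 y g)) zs))"
    using Cons.prems x by (intro Cons.IH) auto
  note P = path_exp_carrier[of n Q1 a x] path_exp_carrier[of m Q2 a x]
  show ?case
    using z V IH dirsum_mult[OF P(1) K(1) P(2) K(2)]
      dirsum_mult[OF mult_carrier_mat[OF P(1) K(1)] S(1) mult_carrier_mat[OF P(2) K(2)] S(2)] by simp
qed

section \<open>Ordered configurations\<close>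

context
  fixes l :: real
begin

interpretation seg_lborel: finite_measure "restrict_space lborel (seg l)"
  by (rule finite_measureI) (auto simp: emeasure_restrict_space space_restrict_space seg_def emeasure_lborel_Icc_eq)

interpretation seg_product: product_sigma_finite "\<lambda>i::nat. restrict_space lborel (seg l)"
  by unfold_locales

lemma sigma_finite_seg_pow: "sigma_finite_measure (seg_pow l n)"
  unfolding seg_pow_def by (rule seg_product.sigma_finite) simp

lemma space_seg_pow: "space (seg_pow l n) = (\<Pi>\<^sub>E i\<in>{..<n}. seg l)"
  by (simp add: seg_pow_def space_PiM space_restrict_space)

lemma measurable_seg_pow_component [measurable]:
  "i < n \<Longrightarrow> (\<lambda>x. x i) \<in> borel_measurable (seg_pow l n)"
proof -
  assume "i < n"
  then have "(\<lambda>x. x i) \<in> measurable (seg_pow l n) (restrict_space lborel (seg l))"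
    unfolding seg_pow_def by (intro measurable_component_singleton) simp
  then show ?thesis
    by (auto simp: measurable_restrict_space2_iff)
qed

lemma ordered_points_measurable [measurable]: "Measurable.pred (seg_pow l n) (\<lambda>x. x \<in> ordered_points n)"
proof -
  have "ordered_points n = {x. \<forall>j<n. \<forall>i<j. x i < x j}"
    unfolding ordered_points_def by auto
  moreover have "Measurable.pred (seg_pow l n) (\<lambda>x. \<forall>j\<in>{..<n}. \<forall>i\<in>{..<j}. x i < x j)"
    by measurable
  ultimately show ?thesis by (simp add: Ball_def)
qed

text \<open>A permutation of \<open>{..<n}\<close> fixes all other indices, so
  \<open>x \<circ> p\<close> keeps the value \<open>undefined\<close> there and remains a point of
  the product space.\<close>

lemma measurable_permute_seg_pow:
  assumes "p permutes {..<n}"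
  shows "(\<lambda>x. x \<circ> p) \<in> measurable (seg_pow l n) (seg_pow l n)"
proof -
  have pn: "p i < n \<longleftrightarrow> i < n" for i
    using permutes_in_image[OF assms, of i] by simp
  have pn': "p i = i" if "\<not> i < n" for i
    using assms that by (simp add: permutes_def)
  show ?thesis
    unfolding seg_pow_def comp_def
    by (rule measurable_PiM_single') (auto simp: pn pn' space_PiM PiE_def extensional_def)
qed

text \<open>Boxes determine the product measure, and a permutation of coordinates merely permutes
  the sides of a box, leaving the product of their measures unchanged.\<close>

lemma seg_pow_distr_permute:
  assumes "p permutes {..<n}"
  shows "distr (seg_pow l n) (seg_pow l n) (\<lambda>x. x \<circ> p) = seg_pow l n"
proof -
  let ?M = "restrict_space lborel (seg l)"
  have pn: "p i < n \<longleftrightarrow> i < n" for i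
    using permutes_in_image[OF assms, of i] by simp
  have pn': "p i = i" if "\<not> i < n" for i
    using assms that by (simp add: permutes_def)
  note m = measurable_permute_seg_pow[OF assms]
  have "distr (seg_pow l n) (seg_pow l n) (\<lambda>x. x \<circ> p) = PiM {..<n} (\<lambda>i. ?M)"
  proof (rule seg_product.PiM_eqI)
    show "finite {..<n}" by simp
    show "sets (distr (seg_pow l n) (seg_pow l n) (\<lambda>x. x \<circ> p)) = sets (PiM {..<n} (\<lambda>i. ?M))"
      by (simp add: seg_pow_def)
    fix A :: "nat \<Rightarrow> real set" assume A: "\<And>i. i \<in> {..<n} \<Longrightarrow> A i \<in> sets ?M"
    \<comment> \<open>The condition at index \<open>j\<close> constrains the coordinate
      \<open>p j\<close> of \<open>x\<close>; hence coordinate \<open>i\<close> receives the side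
      with index \<open>inv p i\<close>.\<close>
    have "(\<lambda>x. x \<circ> p) -` (Pi\<^sub>E {..<n} A) \<inter> space (seg_pow l n) = Pi\<^sub>E {..<n} (\<lambda>i. A (Hilbert_Choice.inv p i))"
    proof (intro equalityI subsetI)
      fix x assume x: "x \<in> (\<lambda>x. x \<circ> p) -` (Pi\<^sub>E {..<n} A) \<inter> space (seg_pow l n)"
      have "x i \<in> A (Hilbert_Choice.inv p i)" if "i < n" for i
      proof -
        have "Hilbert_Choice.inv p i < n" using permutes_in_image[OF permutes_inv[OF assms], of i] that by simp
        moreover have "x \<circ> p \<in> Pi\<^sub>E {..<n} A" using x by simp
        ultimately have "(x \<circ> p) (Hilbert_Choice.inv p i) \<in> A (Hilbert_Choice.inv p i)"
          using PiE_mem[of "x \<circ> p" "{..<n}" A "Hilbert_Choice.inv p i"] by blast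
        then show ?thesis using permutes_inverses[OF assms] by simp
      qed
      then show "x \<in> Pi\<^sub>E {..<n} (\<lambda>i. A (Hilbert_Choice.inv p i))" using x by (auto simp: space_seg_pow PiE_def)
    next
      fix x assume x: "x \<in> Pi\<^sub>E {..<n} (\<lambda>i. A (Hilbert_Choice.inv p i))"
      have "x (p i) \<in> A i" if "i < n" for i
        using PiE_mem[OF x, of "p i"] that by (simp add: pn permutes_inverses[OF assms])
      moreover have "x i \<in> seg l" if "i < n" for i
      proof -
        have "Hilbert_Choice.inv p i < n" using permutes_in_image[OF permutes_inv[OF assms], of i] that by simp
        then have "A (Hilbert_Choice.inv p i) \<subseteq> seg l" using sets.sets_into_space[OF A[of "Hilbert_Choice.inv p i"]] by (simp add: space_restrict_space)
        then show ?thesis using x that by auto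
      qed
      ultimately show "x \<in> (\<lambda>x. x \<circ> p) -` (Pi\<^sub>E {..<n} A) \<inter> space (seg_pow l n)"
        using x pn' by (auto simp: space_seg_pow PiE_def extensional_def)
    qed
    moreover have "Pi\<^sub>E {..<n} A \<in> sets (seg_pow l n)"
      unfolding seg_pow_def using A by (intro sets_PiM_I_finite) auto
    ultimately have "emeasure (distr (seg_pow l n) (seg_pow l n) (\<lambda>x. x \<circ> p)) (Pi\<^sub>E {..<n} A) =
        emeasure (seg_pow l n) (Pi\<^sub>E {..<n} (\<lambda>i. A (Hilbert_Choice.inv p i)))"
      using m by (simp add: emeasure_distr)
    also have "\<dots> = (\<Prod>i<n. emeasure ?M (A (Hilbert_Choice.inv p i)))"
      unfolding seg_pow_def
    proof (rule seg_product.emeasure_PiM)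
      fix i assume "i \<in> {..<n}"
      then show "A (Hilbert_Choice.inv p i) \<in> sets ?M"
        by (intro A) (simp only: permutes_in_image[OF permutes_inv[OF assms]])
    qed simp
    also have "\<dots> = (\<Prod>i<n. emeasure ?M (A i))"
      using prod.permute[OF permutes_inv[OF assms], of "\<lambda>i. emeasure ?M (A i)"] by (simp add: comp_def)
    finally show "emeasure (distr (seg_pow l n) (seg_pow l n) (\<lambda>x. x \<circ> p)) (Pi\<^sub>E {..<n} A) =
      (\<Prod>i<n. emeasure ?M (A i))" .
  qed
  then show ?thesis unfolding seg_pow_def .
qed

text \<open>Coordinates below \<open>m\<close> are later the ket points and the others the bra
  points. The restriction supplies the value \<open>undefined\<close> that points of
  \<open>seg_pow\<close> have outside the index set.\<close>

definition join_points :: "nat \<Rightarrow> nat \<Rightarrow> (nat \<Rightarrow> real) \<times> (nat \<Rightarrow> real) \<Rightarrow> nat \<Rightarrow> real" where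
  "join_points m n = (\<lambda>(x, y). \<lambda>i\<in>{..<m + n}. if i < m then x i else y (i - m))"

lemma measurable_join_points:
  "join_points m n \<in> measurable (seg_pow l m \<Otimes>\<^sub>M seg_pow l n) (seg_pow l (m + n))"
  unfolding seg_pow_def
proof (rule measurable_PiM_single')
  fix i assume "i \<in> {..<m + n}"
  then show "(\<lambda>w. join_points m n w i) \<in> measurable (PiM {..<m} (\<lambda>i. restrict_space lborel (seg l)) \<Otimes>\<^sub>M
      PiM {..<n} (\<lambda>i. restrict_space lborel (seg l))) (restrict_space lborel (seg l))"
    by (cases "i < m") (auto simp: join_points_def case_prod_beta)
next
  show "join_points m n \<in> space (PiM {..<m} (\<lambda>i. restrict_space lborel (seg l)) \<Otimes>\<^sub>M
      PiM {..<n} (\<lambda>i. restrict_space lborel (seg l))) \<rightarrow> ({..<m + n} \<rightarrow>\<^sub>E space (restrict_space lborel (seg l)))"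
  proof
    fix w assume "w \<in> space (PiM {..<m} (\<lambda>i. restrict_space lborel (seg l)) \<Otimes>\<^sub>M
      PiM {..<n} (\<lambda>i. restrict_space lborel (seg l)))"
    then obtain x y where w: "w = (x, y)" "\<And>i. i < m \<Longrightarrow> x i \<in> seg l" "\<And>i. i < n \<Longrightarrow> y i \<in> seg l"
      by (auto simp: space_pair_measure space_PiM space_restrict_space)
    show "join_points m n w \<in> {..<m + n} \<rightarrow>\<^sub>E space (restrict_space lborel (seg l))"
      using w by (auto simp: join_points_def space_restrict_space)
  qed
qed

lemma seg_pow_distr_join:
  "distr (seg_pow l m \<Otimes>\<^sub>M seg_pow l n) (seg_pow l (m + n)) (join_points m n) = seg_pow l (m + n)"
proof -
  let ?M = "restrict_space lborel (seg l)"
  interpret n: sigma_finite_measure "seg_pow l n" by (rule sigma_finite_seg_pow)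
  have "distr (seg_pow l m \<Otimes>\<^sub>M seg_pow l n) (seg_pow l (m + n)) (join_points m n) = PiM {..<m + n} (\<lambda>i. ?M)"
  proof (rule seg_product.PiM_eqI)
    show "finite {..<m + n}" by simp
    show "sets (distr (seg_pow l m \<Otimes>\<^sub>M seg_pow l n) (seg_pow l (m + n)) (join_points m n)) = sets (PiM {..<m + n} (\<lambda>i. ?M))"
      by (simp add: seg_pow_def)
    fix A :: "nat \<Rightarrow> real set" assume A: "\<And>i. i \<in> {..<m + n} \<Longrightarrow> A i \<in> sets ?M"
    have sub: "x \<in> A i \<Longrightarrow> i < m + n \<Longrightarrow> x \<in> seg l" for x i
      using sets.sets_into_space[OF A[of i]] by (auto simp: space_restrict_space)
    have "join_points m n -` (Pi\<^sub>E {..<m + n} A) \<inter> space (seg_pow l m \<Otimes>\<^sub>M seg_pow l n) =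
        Pi\<^sub>E {..<m} A \<times> Pi\<^sub>E {..<n} (\<lambda>i. A (m + i))"
    proof (intro equalityI subsetI)
      fix w assume w: "w \<in> join_points m n -` (Pi\<^sub>E {..<m + n} A) \<inter> space (seg_pow l m \<Otimes>\<^sub>M seg_pow l n)"
      obtain x y where xy: "w = (x, y)" by (cases w)
      have j: "join_points m n (x, y) i \<in> A i" if "i < m + n" for i
        using w xy that by auto
      have "x i \<in> A i" if "i < m" for i using j[of i] that by (simp add: join_points_def)
      moreover have "y i \<in> A (m + i)" if "i < n" for i using j[of "m + i"] that by (simp add: join_points_def)
      ultimately show "w \<in> Pi\<^sub>E {..<m} A \<times> Pi\<^sub>E {..<n} (\<lambda>i. A (m + i))"
        using w xy by (auto simp: space_pair_measure space_seg_pow PiE_def)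
    next
      fix w assume w: "w \<in> Pi\<^sub>E {..<m} A \<times> Pi\<^sub>E {..<n} (\<lambda>i. A (m + i))"
      obtain x y where xy: "w = (x, y)" by (cases w)
      have x: "x i \<in> A i" if "i < m" for i using w xy that by auto
      have y: "y i \<in> A (m + i)" if "i < n" for i using w xy that by auto
      have "x i \<in> seg l" if "i < m" for i using sub[OF x[OF that]] that by simp
      moreover have "y i \<in> seg l" if "i < n" for i using sub[OF y[OF that]] that by simp
      moreover have "join_points m n (x, y) i \<in> A i" if "i < m + n" for i
        using x[of i] y[of "i - m"] that by (auto simp: join_points_def)
      ultimately show "w \<in> join_points m n -` (Pi\<^sub>E {..<m + n} A) \<inter> space (seg_pow l m \<Otimes>\<^sub>M seg_pow l n)"
        using w xy by (auto simp: space_pair_measure space_seg_pow PiE_def join_points_def)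
    qed
    moreover have "Pi\<^sub>E {..<m + n} A \<in> sets (seg_pow l (m + n))"
      unfolding seg_pow_def using A by (intro sets_PiM_I_finite) auto
    ultimately have "emeasure (distr (seg_pow l m \<Otimes>\<^sub>M seg_pow l n) (seg_pow l (m + n)) (join_points m n)) (Pi\<^sub>E {..<m + n} A) =
        emeasure (seg_pow l m \<Otimes>\<^sub>M seg_pow l n) (Pi\<^sub>E {..<m} A \<times> Pi\<^sub>E {..<n} (\<lambda>i. A (m + i)))"
      using measurable_join_points by (simp add: emeasure_distr)
    also have "\<dots> = emeasure (seg_pow l m) (Pi\<^sub>E {..<m} A) * emeasure (seg_pow l n) (Pi\<^sub>E {..<n} (\<lambda>i. A (m + i)))"
      using A by (intro n.emeasure_pair_measure_Times) (auto simp: seg_pow_def intro!: sets_PiM_I_finite)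
    also have "\<dots> = (\<Prod>i<m. emeasure ?M (A i)) * (\<Prod>i<n. emeasure ?M (A (m + i)))"
      unfolding seg_pow_def using A by (intro arg_cong2[where f="(*)"] seg_product.emeasure_PiM) auto
    also have "\<dots> = (\<Prod>i<m + n. emeasure ?M (A i))"
    proof -
      have "(\<Prod>i<n. emeasure ?M (A (m + i))) = (\<Prod>i\<in>{m..<m + n}. emeasure ?M (A i))"
        by (rule prod.reindex_bij_witness[of _ "\<lambda>i. i - m" "\<lambda>i. m + i"]) auto
      moreover have "{..<m + n} = {..<m} \<union> {m..<m + n}" by auto
      ultimately show ?thesis by (simp add: prod.union_disjoint[of "{..<m}" "{m..<m + n}"] ivl_disj_int)
    qed
    finally show "emeasure (distr (seg_pow l m \<Otimes>\<^sub>M seg_pow l n) (seg_pow l (m + n)) (join_points m n)) (Pi\<^sub>E {..<m + n} A) =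
      (\<Prod>i<m + n. emeasure ?M (A i))" .
  qed
  then show ?thesis unfolding seg_pow_def .
qed

text \<open>Fubini in coordinate \<open>j\<close>: with all others fixed, \<open>x i = x j\<close>
  leaves one point of the segment, which is Lebesgue null.\<close>

lemma AE_seg_pow_neq:
  assumes "i < n" "j < n" "i \<noteq> j"
  shows "AE x in seg_pow l n. x i \<noteq> x j"
proof -
  let ?M = "restrict_space lborel (seg l)"
  let ?I = "{..<n} - {j}"
  have n: "insert j ?I = {..<n}" using assms by auto
  have [measurable]: "(\<lambda>x. indicator {x. x i = x j} x :: ennreal) \<in> borel_measurable (seg_pow l n)"
  proof -
    note measurable_seg_pow_component[OF assms(1)] measurable_seg_pow_component[OF assms(2)]
    have "Measurable.pred (seg_pow l n) (\<lambda>x. x i = x j)"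
      unfolding pred_def by (rule borel_measurable_eq) fact+
    then show ?thesis by (auto intro!: borel_measurable_indicator')
  qed
  have m: "(\<lambda>x. indicator {x. x i = x j} x :: ennreal) \<in> borel_measurable (PiM (insert j ?I) (\<lambda>_. ?M))"
    using n by (simp add: seg_pow_def[symmetric])
  have "(\<integral>\<^sup>+ x. indicator {x. x i = x j} x \<partial>PiM (insert j ?I) (\<lambda>_. ?M)) =
      (\<integral>\<^sup>+ x. \<integral>\<^sup>+ y. indicator {x. x i = x j} (x(j := y)) \<partial>?M \<partial>PiM ?I (\<lambda>_. ?M))"
    by (rule seg_product.product_nn_integral_insert[OF _ _ m]) auto
  also have "\<dots> = (\<integral>\<^sup>+ x. \<integral>\<^sup>+ y. indicator {x i} y \<partial>?M \<partial>PiM ?I (\<lambda>_. ?M))"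
    using assms by (intro nn_integral_cong) (auto simp: indicator_def)
  also have "\<dots> = 0"
  proof -
    have "(\<integral>\<^sup>+ y. indicator {t} y \<partial>?M) = 0" for t
    proof -
      have "(\<integral>\<^sup>+ y. indicator {t} y \<partial>?M) = (\<integral>\<^sup>+ y. indicator {t} y * indicator (seg l) y \<partial>lborel)"
        by (intro nn_integral_restrict_space) (simp add: seg_def)
      also have "\<dots> = (\<integral>\<^sup>+ y. 0 \<partial>(lborel :: real measure))"
        using AE_lborel_singleton[of t] by (intro nn_integral_cong_AE) auto
      finally show ?thesis by simp
    qed
    then show ?thesis by simp
  qed
  finally have "(\<integral>\<^sup>+ x. indicator {x. x i = x j} x \<partial>seg_pow l n) = 0"
    unfolding n seg_pow_def .
  then have "AE x in seg_pow l n. (indicator {x. x i = x j} x :: ennreal) = 0"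
    by (subst (asm) nn_integral_0_iff_AE) auto
  then show ?thesis
    by eventually_elim (auto simp: indicator_def split: if_splits)
qed

end

section \<open>Decomposition of the cube into permuted simplices\<close>

lemma ordered_points_iff_sorted: "x \<in> ordered_points n \<longleftrightarrow> sorted_wrt (<) (map x [0..<n])"
  by (auto simp: ordered_points_def sorted_wrt_iff_nth_less)

text \<open>Sorting the list of values gives existence. Two strictly increasing arrangements have
  the same set of values and so coincide as lists; injectivity of \<open>w\<close> carries this
  equality over to the permutations.\<close>

lemma ex1_sorting_permutation:
  assumes "inj_on w {..<n}"
  shows "\<exists>!p. p permutes {..<n} \<and> w \<circ> p \<in> ordered_points n"
proof -
  let ?ws = "map w [0..<n]"
  have d: "distinct ?ws" using assms by (simp add: distinct_map lessThan_atLeast0)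
  obtain p where p: "p permutes {..<length ?ws}" "permute_list p ?ws = sort ?ws"
    by (rule mset_eq_permutation[of "sort ?ws" ?ws]) auto
  have pn: "p permutes {..<n}" using p by simp
  have "map (w \<circ> p) [0..<n] = sort ?ws"
    unfolding p(2)[symmetric] permute_list_def
    by (rule map_cong) (use permutes_in_image[OF pn] in auto)
  then have 1: "w \<circ> p \<in> ordered_points n"
    using d by (simp only: ordered_points_iff_sorted strict_sorted_iff distinct_sort sorted_sort simp_thms)
  have "q = p" if q: "q permutes {..<n}" "w \<circ> q \<in> ordered_points n" for q
  proof
    fix i
    have im: "set (map (w \<circ> r) [0..<n]) = w ` {..<n}" if "r permutes {..<n}" for r
      by (simp only: set_map set_upt lessThan_atLeast0[symmetric] image_comp[symmetric] permutes_image[OF that])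
    have "map (w \<circ> q) [0..<n] = map (w \<circ> p) [0..<n]"
      using q(2) 1 im[OF q(1)] im[OF pn] unfolding ordered_points_iff_sorted
      by (intro sorted_distinct_set_unique) (simp_all only: strict_sorted_iff)
    then have "w (q i) = w (p i)" if "i < n"
      using that by (auto dest: map_eq_conv[THEN iffD1])
    moreover have "q i \<in> {..<n} \<longleftrightarrow> i < n" "p i \<in> {..<n} \<longleftrightarrow> i < n"
      using permutes_in_image[OF q(1)] permutes_in_image[OF pn] by auto
    ultimately show "q i = p i"
      using inj_onD[OF assms] permutes_not_in[OF q(1)] permutes_not_in[OF pn]
      by (cases "i < n") auto
  qed
  with pn 1 show ?thesis by blast
qed

lemma AE_seg_pow_inj: "AE x in seg_pow l n. inj_on x {..<n}"
proof -
  have "AE x in seg_pow l n. \<forall>i\<in>{..<n}. \<forall>j\<in>{..<n}. i \<noteq> j \<longrightarrow> x i \<noteq> x j"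
    by (intro AE_finite_allI AE_impI) (use AE_seg_pow_neq in auto)
  then show ?thesis by eventually_elim (auto simp: inj_on_def)
qed

lemma integrable_permute_seg_pow:
  fixes f :: "(nat \<Rightarrow> real) \<Rightarrow> complex"
  assumes "integrable (seg_pow l n) f" "p permutes {..<n}"
  shows "integrable (seg_pow l n) (\<lambda>x. f (x \<circ> p))"
    and "(LINT x|seg_pow l n. f (x \<circ> p)) = (LINT x|seg_pow l n. f x)"
proof -
  note m = measurable_permute_seg_pow[OF assms(2)]
  show "integrable (seg_pow l n) (\<lambda>x. f (x \<circ> p))"
    using assms(1) by (intro integrable_distr[OF m]) (simp add: seg_pow_distr_permute[OF assms(2)])
  show "(LINT x|seg_pow l n. f (x \<circ> p)) = (LINT x|seg_pow l n. f x)"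
    using integral_distr[OF m, of f] assms(1) by (simp add: seg_pow_distr_permute[OF assms(2)])
qed

lemma set_integrable_ordered_points:
  fixes f :: "(nat \<Rightarrow> real) \<Rightarrow> complex"
  assumes "integrable (seg_pow l n) f"
  shows "set_integrable (seg_pow l n) (ordered_points n) f"
proof -
  have [measurable]: "f \<in> borel_measurable (seg_pow l n)" using assms by simp
  have "(\<lambda>x. indicat_real (ordered_points n) x *\<^sub>R f x) \<in> borel_measurable (seg_pow l n)"
    using ordered_points_measurable[of n l] by measurable
  then show ?thesis
    unfolding set_integrable_def
    by (rule Bochner_Integration.integrable_bound[OF assms]) (auto simp: indicator_def)
qed

text \<open>Up to a null set the cube is the disjoint union of the \<open>fact n\<close> images of
  the simplex of ordered points, one for each permutation.\<close>

lemma integral_eq_sum_ordered_points: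
  fixes f :: "(nat \<Rightarrow> real) \<Rightarrow> complex"
  assumes f: "integrable (seg_pow l n) f"
  shows "(LINT x|seg_pow l n. f x) =
    (\<Sum>p | p permutes {..<n}. LINT x:ordered_points n|seg_pow l n. f (x \<circ> p))"
proof -
  let ?P = "{p. p permutes {..<n}}"
  \<comment> \<open>The restriction of \<open>f\<close> to the chamber of configurations that
    \<open>p\<close> sorts.\<close>
  define g where "g p w = indicat_real (ordered_points n) (w \<circ> p) *\<^sub>R f w" for p w
  have g: "integrable (seg_pow l n) (g p)" if p: "p permutes {..<n}" for p
  proof -
    have [measurable]: "f \<in> borel_measurable (seg_pow l n)" using f by simp
    have "Measurable.pred (seg_pow l n) (\<lambda>w. w \<circ> p \<in> ordered_points n)"
      using measurable_compose[OF measurable_permute_seg_pow[OF p] ordered_points_measurable] .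
    then have "(\<lambda>w. (if w \<circ> p \<in> ordered_points n then f w else 0)) \<in> borel_measurable (seg_pow l n)"
      by measurable
    also have "(\<lambda>w. (if w \<circ> p \<in> ordered_points n then f w else 0)) = g p"
      by (auto simp: g_def indicator_def)
    finally show ?thesis
      by (rule Bochner_Integration.integrable_bound[OF f]) (auto simp: g_def indicator_def)
  qed
  \<comment> \<open>Substituting in the ordered integral turns \<open>p\<close> into its inverse;
    the sum over all permutations is invariant under inversion.\<close>
  have "(\<Sum>p\<in>?P. LINT x:ordered_points n|seg_pow l n. f (x \<circ> p)) =
      (\<Sum>p\<in>?P. LINT x|seg_pow l n. g (Hilbert_Choice.inv p) x)"
  proof (rule sum.cong[OF refl])
    fix p assume "p \<in> ?P"
    then have p: "p permutes {..<n}" by simp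
    have "(LINT x:ordered_points n|seg_pow l n. f (x \<circ> p)) = (LINT x|seg_pow l n. g (Hilbert_Choice.inv p) (x \<circ> p))"
      unfolding set_lebesgue_integral_def g_def
      by (simp add: comp_assoc permutes_inv_o[OF p])
    also have "\<dots> = (LINT x|seg_pow l n. g (Hilbert_Choice.inv p) x)"
      by (rule integrable_permute_seg_pow(2)[OF g[OF permutes_inv[OF p]] p])
    finally show "(LINT x:ordered_points n|seg_pow l n. f (x \<circ> p)) = (LINT x|seg_pow l n. g (Hilbert_Choice.inv p) x)" .
  qed
  also have "\<dots> = (\<Sum>p\<in>?P. LINT x|seg_pow l n. g p x)"
    by (rule sum_permutations_inverse[symmetric])
  also have "\<dots> = (LINT x|seg_pow l n. (\<Sum>p\<in>?P. g p x))"
    using g by (intro Bochner_Integration.integral_sum[symmetric]) auto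
  also have "\<dots> = (LINT x|seg_pow l n. f x)"
  proof (rule integral_cong_AE)
    show "(\<lambda>x. \<Sum>p\<in>?P. g p x) \<in> borel_measurable (seg_pow l n)"
      using g by (intro borel_measurable_sum) auto
    show "f \<in> borel_measurable (seg_pow l n)" using f by simp
    show "AE x in seg_pow l n. (\<Sum>p\<in>?P. g p x) = f x"
      using AE_seg_pow_inj
    proof eventually_elim
      fix x :: "nat \<Rightarrow> real" assume "inj_on x {..<n}"
      then obtain q where q: "q permutes {..<n}" "x \<circ> q \<in> ordered_points n"
        and u: "\<And>p. p permutes {..<n} \<Longrightarrow> x \<circ> p \<in> ordered_points n \<Longrightarrow> p = q"
        using ex1_sorting_permutation by blast
      have "(\<Sum>p\<in>?P. g p x) = (\<Sum>p\<in>?P. if p = q then f x else 0)"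
      proof (intro sum.cong refl)
        fix p assume "p \<in> ?P"
        then have "x \<circ> p \<in> ordered_points n \<longleftrightarrow> p = q" using q u[of p] by blast
        then show "g p x = (if p = q then f x else 0)"
          unfolding g_def indicator_def by simp
      qed
      then show "(\<Sum>p\<in>?P. g p x) = f x"
        using q finite_permutations[of "{..<n}"] by simp
    qed
  qed
  finally show ?thesis by simp
qed

text \<open>
  The interleavings of \<open>m\<close> creators with \<open>n\<close> annihilators correspond to the permutations that
  are increasing on the first \<open>m\<close> and on the last \<open>n\<close> indices.
\<close>

definition ket_positions :: "leg list \<Rightarrow> nat list" where
  "ket_positions \<alpha> = filter (\<lambda>i. \<alpha> ! i \<noteq> Right_leg) [0..<length \<alpha>]"

definition bra_positions :: "leg list \<Rightarrow> nat list" where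
  "bra_positions \<alpha> = filter (\<lambda>i. \<alpha> ! i \<noteq> Left_leg) [0..<length \<alpha>]"

text \<open>Only the number of creators is prescribed. In the absence of \<open>Ad_leg\<close>, the
  other \<open>n\<close> positions are annihilators.\<close>

definition shuffle_legs :: "nat \<Rightarrow> nat \<Rightarrow> leg list set" where
  "shuffle_legs m n = {\<alpha>. Ad_leg \<notin> set \<alpha> \<and> length \<alpha> = m + n \<and> length (ket_positions \<alpha>) = m}"

definition shuffle_perms :: "nat \<Rightarrow> nat \<Rightarrow> (nat \<Rightarrow> nat) set" where
  "shuffle_perms m n = {p. p permutes {..<m + n} \<and> strict_mono_on {..<m} p \<and> strict_mono_on {m..<m + n} p}"

text \<open>For a shuffle, index \<open>i\<close> goes to the position of the \<open>i\<close>-th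
  creator while \<open>i < m\<close>, and index \<open>m + i\<close> to that of the
  \<open>i\<close>-th annihilator. The identity beyond the word is demanded by
  \<open>permutes\<close>.\<close>

definition legs_perm :: "leg list \<Rightarrow> nat \<Rightarrow> nat" where
  "legs_perm \<alpha> i = (if i < length \<alpha> then (ket_positions \<alpha> @ bra_positions \<alpha>) ! i else i)"

text \<open>The image of the first block suffices to recover the word, because monotonicity on each
  block determines the order within it.\<close>

definition perm_legs :: "nat \<Rightarrow> nat \<Rightarrow> (nat \<Rightarrow> nat) \<Rightarrow> leg list" where
  "perm_legs m n p = map (\<lambda>k. if k \<in> p ` {..<m} then Left_leg else Right_leg) [0..<m + n]"

lemma ket_points_positions: "ket_points \<alpha> x = map x (ket_positions \<alpha>)"
  and bra_points_positions: "bra_points \<alpha> x = map x (bra_positions \<alpha>)"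
  by (simp_all add: ket_points_def bra_points_def ket_positions_def bra_positions_def)

lemma sorted_ket_positions: "sorted_wrt (<) (ket_positions \<alpha>)"
  and sorted_bra_positions: "sorted_wrt (<) (bra_positions \<alpha>)"
  by (simp_all add: ket_positions_def bra_positions_def sorted_wrt_filter)

lemma set_positions:
  assumes "Ad_leg \<notin> set \<alpha>"
  shows "set (ket_positions \<alpha>) = {i. i < length \<alpha> \<and> \<alpha> ! i = Left_leg}"
    "set (bra_positions \<alpha>) = {i. i < length \<alpha> \<and> \<alpha> ! i = Right_leg}"
proof -
  have "\<alpha> ! i = Left_leg \<or> \<alpha> ! i = Right_leg" if "i < length \<alpha>" for i
    using assms nth_mem[OF that] by (cases "\<alpha> ! i") auto
  then show "set (ket_positions \<alpha>) = {i. i < length \<alpha> \<and> \<alpha> ! i = Left_leg}"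
    "set (bra_positions \<alpha>) = {i. i < length \<alpha> \<and> \<alpha> ! i = Right_leg}"
    by (auto simp: ket_positions_def bra_positions_def)
qed

lemma shuffle_legs_positions:
  assumes "\<alpha> \<in> shuffle_legs m n"
  shows "distinct (ket_positions \<alpha> @ bra_positions \<alpha>)"
    "set (ket_positions \<alpha> @ bra_positions \<alpha>) = {..<m + n}"
    "length (ket_positions \<alpha>) = m" "length (bra_positions \<alpha>) = n"
proof -
  have \<alpha>: "Ad_leg \<notin> set \<alpha>" "length \<alpha> = m + n" and m: "length (ket_positions \<alpha>) = m"
    using assms by (auto simp: shuffle_legs_def)
  have "distinct (ket_positions \<alpha>)" "distinct (bra_positions \<alpha>)"
    by (simp_all add: ket_positions_def bra_positions_def)
  then show d: "distinct (ket_positions \<alpha> @ bra_positions \<alpha>)"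
    unfolding distinct_append set_positions[OF \<alpha>(1)] by (simp add: disjoint_iff)
  have "\<alpha> ! i = Left_leg \<or> \<alpha> ! i = Right_leg" if "i < length \<alpha>" for i
    using \<alpha> nth_mem[OF that] by (cases "\<alpha> ! i") auto
  then show s: "set (ket_positions \<alpha> @ bra_positions \<alpha>) = {..<m + n}"
    unfolding set_append set_positions[OF \<alpha>(1)] \<alpha>(2) lessThan_def by blast
  show "length (ket_positions \<alpha>) = m" by (rule m)
  show "length (bra_positions \<alpha>) = n"
    using distinct_card[OF d] m unfolding s by simp
qed

text \<open>The positions of either kind are listed in increasing order, so their concatenation is a
  permutation with two increasing runs. The last two claims present the ket and bra points as the
  two blocks of coordinates of one permuted configuration, ready for a change of variables.\<close>

lemma legs_perm_shuffle:
  assumes "\<alpha> \<in> shuffle_legs m n"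
  shows "legs_perm \<alpha> \<in> shuffle_perms m n" "perm_legs m n (legs_perm \<alpha>) = \<alpha>"
    and "ket_points \<alpha> x = map (x \<circ> legs_perm \<alpha>) [0..<m]"
    and "bra_points \<alpha> x = map (x \<circ> legs_perm \<alpha>) [m..<m + n]"
proof -
  note S = shuffle_legs_positions[OF assms]
  have len: "length \<alpha> = m + n" and Ad: "Ad_leg \<notin> set \<alpha>" using assms by (auto simp: shuffle_legs_def)
  have k: "legs_perm \<alpha> i = ket_positions \<alpha> ! i" if "i < m" for i
    using that S len by (simp add: legs_perm_def nth_append)
  have b: "legs_perm \<alpha> (m + i) = bra_positions \<alpha> ! i" if "i < n" for i
    using that S len by (simp add: legs_perm_def nth_append)
  have "bij_betw (\<lambda>i. (ket_positions \<alpha> @ bra_positions \<alpha>) ! i) {..<m + n} {..<m + n}"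
    by (rule bij_betw_nth) (use S in auto)
  then have "bij_betw (legs_perm \<alpha>) {..<m + n} {..<m + n}"
    by (rule bij_betw_cong[THEN iffD1, rotated]) (simp add: legs_perm_def len)
  then have "legs_perm \<alpha> permutes {..<m + n}"
    by (rule bij_imp_permutes) (simp add: legs_perm_def len)
  moreover have "strict_mono_on {..<m} (legs_perm \<alpha>)"
    using sorted_wrt_nth_less[OF sorted_ket_positions] S(3) by (auto simp: k intro!: strict_mono_onI)
  moreover have "strict_mono_on {m..<m + n} (legs_perm \<alpha>)"
  proof (rule strict_mono_onI)
    fix i j assume "i \<in> {m..<m + n}" "j \<in> {m..<m + n}" "i < j"
    then show "legs_perm \<alpha> i < legs_perm \<alpha> j"
      using sorted_wrt_nth_less[OF sorted_bra_positions, of "i - m" "j - m" \<alpha>] S(4) b[of "i - m"] b[of "j - m"]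
      by auto
  qed
  ultimately show "legs_perm \<alpha> \<in> shuffle_perms m n" by (simp add: shuffle_perms_def)
  have "map (legs_perm \<alpha>) [0..<m] = ket_positions \<alpha>"
    using S(3) k by (intro nth_equalityI) auto
  then show "ket_points \<alpha> x = map (x \<circ> legs_perm \<alpha>) [0..<m]"
    by (simp add: ket_points_positions flip: map_map)
  have "map (legs_perm \<alpha>) [m..<m + n] = bra_positions \<alpha>"
    using S(4) b by (intro nth_equalityI) auto
  then show "bra_points \<alpha> x = map (x \<circ> legs_perm \<alpha>) [m..<m + n]"
    by (simp add: bra_points_positions flip: map_map)
  have "legs_perm \<alpha> ` {..<m} = set (map (legs_perm \<alpha>) [0..<m])"
    by (simp add: lessThan_atLeast0)
  also have "\<dots> = set (ket_positions \<alpha>)" by (simp only: \<open>map (legs_perm \<alpha>) [0..<m] = ket_positions \<alpha>\<close>)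
  finally have im: "legs_perm \<alpha> ` {..<m} = {i. i < length \<alpha> \<and> \<alpha> ! i = Left_leg}"
    using set_positions[OF Ad] by simp
  have "Right_leg = \<alpha> ! i" if "i < length \<alpha>" "\<alpha> ! i \<noteq> Left_leg" for i
    using Ad nth_mem[OF that(1)] that(2) by (cases "\<alpha> ! i") auto
  then show "perm_legs m n (legs_perm \<alpha>) = \<alpha>"
    unfolding perm_legs_def im using len by (intro nth_equalityI) auto
qed

text \<open>A strictly increasing enumeration of a finite set is unique. Hence the creator
  positions, filtered from \<open>[0..<m + n]\<close>, list the values of \<open>p\<close> on the
  first block, and likewise for the annihilators.\<close>

lemma perm_legs_shuffle:
  assumes "p \<in> shuffle_perms m n"
  shows "perm_legs m n p \<in> shuffle_legs m n" "legs_perm (perm_legs m n p) = p"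
proof -
  have p: "p permutes {..<m + n}" and mono: "strict_mono_on {..<m} p" "strict_mono_on {m..<m + n} p"
    using assms by (auto simp: shuffle_perms_def)
  have pm: "p i < m + n \<longleftrightarrow> i < m + n" for i using permutes_in_image[OF p, of i] by simp
  have inj: "p i = p j \<longleftrightarrow> i = j" for i j using permutes_inj[OF p] by (simp add: inj_eq)
  have surj: "\<exists>j<m + n. p j = i" if "i < m + n" for i
    using permutes_image[OF p] that by (metis imageE lessThan_iff)
  let ?\<alpha> = "perm_legs m n p"
  have len: "length ?\<alpha> = m + n" by (simp add: perm_legs_def)
  have "ket_positions ?\<alpha> = filter (\<lambda>i. i \<in> p ` {..<m}) [0..<m + n]"
    unfolding ket_positions_def len by (rule filter_cong) (auto simp: perm_legs_def)
  also have "\<dots> = map p [0..<m]"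
  proof (rule sorted_distinct_set_unique)
    show "sorted (map p [0..<m])"
      by (auto simp: sorted_iff_nth_mono_less intro!: less_imp_le strict_mono_onD[OF mono(1)])
    show "set (filter (\<lambda>i. i \<in> p ` {..<m}) [0..<m + n]) = set (map p [0..<m])"
    proof (intro equalityI subsetI)
      fix i assume "i \<in> set (map p [0..<m])"
      then obtain j where "j < m" "i = p j" by auto
      then show "i \<in> set (filter (\<lambda>i. i \<in> p ` {..<m}) [0..<m + n])" using pm[of j] by simp
    qed auto
  qed (auto simp: distinct_map inj_on_def inj sorted_wrt_filter)
  finally have k: "ket_positions ?\<alpha> = map p [0..<m]" .
  have "bra_positions ?\<alpha> = filter (\<lambda>i. i \<notin> p ` {..<m}) [0..<m + n]"
    unfolding bra_positions_def len by (rule filter_cong) (auto simp: perm_legs_def)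
  also have "\<dots> = map p [m..<m + n]"
  proof (rule sorted_distinct_set_unique)
    show "sorted (map p [m..<m + n])"
      by (auto simp: sorted_iff_nth_mono_less intro!: less_imp_le strict_mono_onD[OF mono(2)])
    show "set (filter (\<lambda>i. i \<notin> p ` {..<m}) [0..<m + n]) = set (map p [m..<m + n])"
    proof (intro equalityI subsetI)
      fix i assume "i \<in> set (filter (\<lambda>i. i \<notin> p ` {..<m}) [0..<m + n])"
      then have i: "i < m + n" "i \<notin> p ` {..<m}" by auto
      then obtain j where "j < m + n" "p j = i" using surj by blast
      with i show "i \<in> set (map p [m..<m + n])" by (cases "j < m") auto
    qed (use pm inj in auto)
  qed (auto simp: distinct_map inj_on_def inj sorted_wrt_filter)
  finally have b: "bra_positions ?\<alpha> = map p [m..<m + n]" .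
  show "?\<alpha> \<in> shuffle_legs m n"
    using k len by (auto simp: shuffle_legs_def perm_legs_def)
  show "legs_perm ?\<alpha> = p"
  proof
    fix i
    show "legs_perm ?\<alpha> i = p i"
      using permutes_not_in[OF p, of i] by (auto simp: legs_perm_def len k b nth_append)
  qed
qed

section \<open>Product integrals and the shuffle identity\<close>

lemma
  fixes F G :: "(nat \<Rightarrow> real) \<Rightarrow> complex"
  assumes F: "integrable (seg_pow l m) F" and G: "integrable (seg_pow l n) G"
  shows integrable_join: "integrable (seg_pow l (m + n)) (\<lambda>w. F (\<lambda>i\<in>{..<m}. w i) * G (\<lambda>i\<in>{..<n}. w (m + i)))"
    and integral_join: "(LINT w|seg_pow l (m + n). F (\<lambda>i\<in>{..<m}. w i) * G (\<lambda>i\<in>{..<n}. w (m + i))) =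
      (LINT x|seg_pow l m. F x) * (LINT y|seg_pow l n. G y)"
proof -
  interpret m: sigma_finite_measure "seg_pow l m" by (rule sigma_finite_seg_pow)
  interpret n: sigma_finite_measure "seg_pow l n" by (rule sigma_finite_seg_pow)
  interpret pair_sigma_finite "seg_pow l m" "seg_pow l n" ..
  let ?h = "\<lambda>w. F (\<lambda>i\<in>{..<m}. w i) * G (\<lambda>i\<in>{..<n}. w (m + i))"
  have [measurable]: "F \<in> borel_measurable (seg_pow l m)" "G \<in> borel_measurable (seg_pow l n)"
    using F G by auto
  have 1: "(\<lambda>w. \<lambda>i\<in>{..<m}. w i) \<in> measurable (seg_pow l (m + n)) (seg_pow l m)"
    unfolding seg_pow_def by (rule measurable_restrict_subset) auto
  have 2: "(\<lambda>w. \<lambda>i\<in>{..<n}. w (m + i)) \<in> measurable (seg_pow l (m + n)) (seg_pow l n)"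
    unfolding seg_pow_def by (intro measurable_restrict measurable_component_singleton) auto
  have h: "?h \<in> borel_measurable (seg_pow l (m + n))"
    by (rule borel_measurable_times[OF measurable_compose[OF 1] measurable_compose[OF 2]]) fact+
  have FG: "integrable (seg_pow l m \<Otimes>\<^sub>M seg_pow l n) (\<lambda>w. F (fst w) * G (snd w))"
    by (rule Fubini_integrable) (use F G in \<open>auto simp: norm_mult\<close>)
  \<comment> \<open>Splitting a joined configuration returns the original pair only for extensional
    functions, hence the restriction to the space.\<close>
  have eq: "F (fst w) * G (snd w) = ?h (join_points m n w)"
    if "w \<in> space (seg_pow l m \<Otimes>\<^sub>M seg_pow l n)" for w
  proof -
    have "fst w \<in> extensional {..<m}" "snd w \<in> extensional {..<n}"
      using that by (auto simp: space_pair_measure space_seg_pow PiE_def)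
    then have "(\<lambda>i\<in>{..<m}. join_points m n w i) = fst w" "(\<lambda>i\<in>{..<n}. join_points m n w (m + i)) = snd w"
      by (auto simp: join_points_def fun_eq_iff extensional_def case_prod_beta)
    then show ?thesis by simp
  qed
  have "integrable (seg_pow l m \<Otimes>\<^sub>M seg_pow l n) (\<lambda>w. ?h (join_points m n w))"
    using FG by (rule Bochner_Integration.integrable_cong[THEN iffD1, rotated -1]) (use eq in auto)
  then have "integrable (distr (seg_pow l m \<Otimes>\<^sub>M seg_pow l n) (seg_pow l (m + n)) (join_points m n)) ?h"
    by (subst integrable_distr_eq[OF measurable_join_points h])
  then show "integrable (seg_pow l (m + n)) ?h" unfolding seg_pow_distr_join .
  have "(LINT w|seg_pow l (m + n). ?h w) =
      (LINT w|distr (seg_pow l m \<Otimes>\<^sub>M seg_pow l n) (seg_pow l (m + n)) (join_points m n). ?h w)"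
    unfolding seg_pow_distr_join ..
  also have "\<dots> = (LINT w|(seg_pow l m \<Otimes>\<^sub>M seg_pow l n). ?h (join_points m n w))"
    by (rule integral_distr[OF measurable_join_points h])
  also have "\<dots> = (LINT w|(seg_pow l m \<Otimes>\<^sub>M seg_pow l n). F (fst w) * G (snd w))"
    by (rule Bochner_Integration.integral_cong) (use eq in auto)
  also have "\<dots> = (LINT x|seg_pow l m. LINT y|seg_pow l n. F x * G y)"
    using integral_fst'[OF FG] by simp
  also have "\<dots> = (LINT x|seg_pow l m. F x) * (LINT y|seg_pow l n. G y)"
    by simp
  finally show "(LINT w|seg_pow l (m + n). ?h w) = (LINT x|seg_pow l m. F x) * (LINT y|seg_pow l n. G y)" .
qed

text \<open>The product of two ordered integrals is an integral over the whole cube of dimension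
  \<open>m + n\<close>. In its decomposition into chambers, those whose permutation increases on
  both blocks survive, and these are the interleavings.\<close>

lemma
  fixes F G :: "(nat \<Rightarrow> real) \<Rightarrow> complex"
  assumes F: "integrable (seg_pow l m) F" and G: "integrable (seg_pow l n) G"
  shows integrable_shuffle: "\<alpha> \<in> shuffle_legs m n \<Longrightarrow>
      set_integrable (seg_pow l (m + n)) (ordered_points (m + n))
        (\<lambda>x. F (\<lambda>i\<in>{..<m}. ket_points \<alpha> x ! i) * G (\<lambda>i\<in>{..<n}. bra_points \<alpha> x ! i))"
    and integral_shuffle: "(\<Sum>\<alpha>\<in>shuffle_legs m n. LINT x:ordered_points (m + n)|seg_pow l (m + n).
        F (\<lambda>i\<in>{..<m}. ket_points \<alpha> x ! i) * G (\<lambda>i\<in>{..<n}. bra_points \<alpha> x ! i)) =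
      (LINT x:ordered_points m|seg_pow l m. F x) * (LINT y:ordered_points n|seg_pow l n. G y)"
proof -
  let ?N = "m + n"
  let ?h = "\<lambda>w. F (\<lambda>i\<in>{..<m}. w i) * G (\<lambda>i\<in>{..<n}. w (m + i))"
  have points: "F (\<lambda>i\<in>{..<m}. ket_points \<alpha> x ! i) * G (\<lambda>i\<in>{..<n}. bra_points \<alpha> x ! i) = ?h (x \<circ> legs_perm \<alpha>)"
    if "\<alpha> \<in> shuffle_legs m n" for \<alpha> x
    unfolding legs_perm_shuffle(3,4)[OF that]
    by (intro arg_cong2[where f="(*)"] arg_cong[where f=F] arg_cong[where f=G] restrict_ext) auto
  show "set_integrable (seg_pow l ?N) (ordered_points ?N)
        (\<lambda>x. F (\<lambda>i\<in>{..<m}. ket_points \<alpha> x ! i) * G (\<lambda>i\<in>{..<n}. bra_points \<alpha> x ! i))"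
    if "\<alpha> \<in> shuffle_legs m n"
    unfolding points[OF that] using legs_perm_shuffle(1)[OF that]
    by (intro set_integrable_ordered_points integrable_permute_seg_pow(1)[OF integrable_join[OF F G]])
       (simp add: shuffle_perms_def)
  \<comment> \<open>Moving the two order constraints into the integrands makes the unconstrained
    product formula applicable.\<close>
  define F' where "F' x = indicat_real (ordered_points m) x *\<^sub>R F x" for x
  define G' where "G' y = indicat_real (ordered_points n) y *\<^sub>R G y" for y
  let ?h' = "\<lambda>w. F' (\<lambda>i\<in>{..<m}. w i) * G' (\<lambda>i\<in>{..<n}. w (m + i))"
  have F': "integrable (seg_pow l m) F'" and G': "integrable (seg_pow l n) G'"
    using set_integrable_ordered_points[OF F] set_integrable_ordered_points[OF G]
    by (simp_all add: F'_def[abs_def] G'_def[abs_def] set_integrable_def)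
  \<comment> \<open>For ordered \<open>x\<close>, comparing \<open>x (p i)\<close> with
    \<open>x (p j)\<close> amounts to comparing \<open>p i\<close> with \<open>p j\<close>; the
    cut-offs therefore depend on \<open>p\<close> alone.\<close>
  have h': "?h' (x \<circ> p) = (if p \<in> shuffle_perms m n then ?h (x \<circ> p) else 0)"
    if p: "p permutes {..<?N}" and x: "x \<in> ordered_points ?N" for p x
  proof -
    have mono: "x (p i) < x (p j) \<longleftrightarrow> p i < p j" if "i < ?N" "j < ?N" for i j
    proof -
      have "p i < ?N" "p j < ?N" using permutes_in_image[OF p] that by auto
      then show ?thesis
        using x unfolding ordered_points_def by (metis (mono_tags, lifting) less_asym mem_Collect_eq not_less_iff_gr_or_eq)
    qed
    have "(\<lambda>i\<in>{..<m}. (x \<circ> p) i) \<in> ordered_points m \<longleftrightarrow> strict_mono_on {..<m} p"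
      using mono by (auto simp: ordered_points_def strict_mono_on_def)
    moreover have "(\<lambda>i\<in>{..<n}. (x \<circ> p) (m + i)) \<in> ordered_points n \<longleftrightarrow> strict_mono_on {m..<?N} p"
    proof
      assume o: "(\<lambda>i\<in>{..<n}. (x \<circ> p) (m + i)) \<in> ordered_points n"
      show "strict_mono_on {m..<?N} p"
      proof (rule strict_mono_onI)
        fix i j assume ij: "i \<in> {m..<?N}" "j \<in> {m..<?N}" "i < j"
        have "x (p (m + a)) < x (p (m + b))" if "a < b" "b < n" for a b
          using o that unfolding ordered_points_def by auto
        from this[of "i - m" "j - m"] show "p i < p j" using ij mono[of i j] by auto
      qed
    next
      assume "strict_mono_on {m..<?N} p"
      then show "(\<lambda>i\<in>{..<n}. (x \<circ> p) (m + i)) \<in> ordered_points n"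
        using mono by (auto simp: ordered_points_def strict_mono_on_def)
    qed
    ultimately show ?thesis
      using p by (auto simp: F'_def G'_def shuffle_perms_def indicator_def)
  qed
  have "(LINT x:ordered_points m|seg_pow l m. F x) * (LINT y:ordered_points n|seg_pow l n. G y) =
      (LINT x|seg_pow l ?N. ?h' x)"
    unfolding integral_join[OF F' G'] by (simp only: set_lebesgue_integral_def F'_def[abs_def] G'_def[abs_def])
  also have "\<dots> = (\<Sum>p | p permutes {..<?N}. LINT x:ordered_points ?N|seg_pow l ?N. ?h' (x \<circ> p))"
    by (rule integral_eq_sum_ordered_points[OF integrable_join[OF F' G']])
  also have "\<dots> = (\<Sum>p | p permutes {..<?N}. if p \<in> shuffle_perms m n
      then LINT x:ordered_points ?N|seg_pow l ?N. ?h (x \<circ> p) else 0)"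
  proof (rule sum.cong[OF refl])
    fix p assume "p \<in> {p. p permutes {..<?N}}"
    then have p: "p permutes {..<?N}" by simp
    have "(LINT x:ordered_points ?N|seg_pow l ?N. ?h' (x \<circ> p)) =
        (LINT x:ordered_points ?N|seg_pow l ?N. if p \<in> shuffle_perms m n then ?h (x \<circ> p) else 0)"
      unfolding set_lebesgue_integral_def
    proof (rule Bochner_Integration.integral_cong[OF refl])
      fix x
      show "indicat_real (ordered_points ?N) x *\<^sub>R ?h' (x \<circ> p) =
          indicat_real (ordered_points ?N) x *\<^sub>R (if p \<in> shuffle_perms m n then ?h (x \<circ> p) else 0)"
      proof (cases "x \<in> ordered_points ?N")
        case True
        then show ?thesis by (simp only: h'[OF p])
      qed simp
    qed
    also have "\<dots> = (if p \<in> shuffle_perms m n then LINT x:ordered_points ?N|seg_pow l ?N. ?h (x \<circ> p) else 0)"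
      by (cases "p \<in> shuffle_perms m n") (simp_all only: if_True if_False set_lebesgue_integral_def scaleR_zero_right integral_zero)
    finally show "(LINT x:ordered_points ?N|seg_pow l ?N. ?h' (x \<circ> p)) =
        (if p \<in> shuffle_perms m n then LINT x:ordered_points ?N|seg_pow l ?N. ?h (x \<circ> p) else 0)" .
  qed
  also have "\<dots> = (\<Sum>p\<in>shuffle_perms m n. LINT x:ordered_points ?N|seg_pow l ?N. ?h (x \<circ> p))"
  proof (rule sum.mono_neutral_cong_right)
    show "finite {p. p permutes {..<?N}}" by (rule finite_permutations) simp
    show "shuffle_perms m n \<subseteq> {p. p permutes {..<?N}}" by (auto simp: shuffle_perms_def)
  qed (rule ballI, simp only: Diff_iff if_False simp_thms, simp only: if_True)
  also have "\<dots> = (\<Sum>\<alpha>\<in>shuffle_legs m n. LINT x:ordered_points ?N|seg_pow l ?N. ?h (x \<circ> legs_perm \<alpha>))"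
    by (rule sum.reindex_bij_witness[of _ legs_perm "perm_legs m n"])
       (simp_all only: legs_perm_shuffle perm_legs_shuffle)
  also have "\<dots> = (\<Sum>\<alpha>\<in>shuffle_legs m n. LINT x:ordered_points ?N|seg_pow l ?N.
        F (\<lambda>i\<in>{..<m}. ket_points \<alpha> x ! i) * G (\<lambda>i\<in>{..<n}. bra_points \<alpha> x ! i))"
    by (rule sum.cong[OF refl]) (simp only: points)
  finally show "(\<Sum>\<alpha>\<in>shuffle_legs m n. LINT x:ordered_points ?N|seg_pow l ?N.
        F (\<lambda>i\<in>{..<m}. ket_points \<alpha> x ! i) * G (\<lambda>i\<in>{..<n}. bra_points \<alpha> x ! i)) =
      (LINT x:ordered_points m|seg_pow l m. F x) * (LINT y:ordered_points n|seg_pow l n. G y)" ..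
qed

text \<open>All \<open>fact n\<close> chambers contribute equally. Wave functions are symmetric only
  up to null sets, which fixes the form of \<open>sym\<close>.\<close>

lemma integral_ordered_points_symmetric:
  fixes f :: "(nat \<Rightarrow> real) \<Rightarrow> complex"
  assumes f: "integrable (seg_pow l n) f"
    and sym: "\<And>p. p permutes {..<n} \<Longrightarrow> AE x in seg_pow l n. f (x \<circ> p) = f x"
  shows "(LINT x|seg_pow l n. f x) = fact n * (LINT x:ordered_points n|seg_pow l n. f x)"
proof -
  have "(LINT x:ordered_points n|seg_pow l n. f (x \<circ> p)) = (LINT x:ordered_points n|seg_pow l n. f x)"
    if p: "p permutes {..<n}" for p
    unfolding set_lebesgue_integral_def
  proof (rule integral_cong_AE)
    show "AE x in seg_pow l n. indicat_real (ordered_points n) x *\<^sub>R f (x \<circ> p) = indicat_real (ordered_points n) x *\<^sub>R f x"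
      using sym[OF p] by eventually_elim simp
    show "(\<lambda>x. indicat_real (ordered_points n) x *\<^sub>R f (x \<circ> p)) \<in> borel_measurable (seg_pow l n)"
      using set_integrable_ordered_points[OF integrable_permute_seg_pow(1)[OF f p]]
      unfolding set_integrable_def by (rule borel_measurable_integrable)
    show "(\<lambda>x. indicat_real (ordered_points n) x *\<^sub>R f x) \<in> borel_measurable (seg_pow l n)"
      using set_integrable_ordered_points[OF f]
      unfolding set_integrable_def by (rule borel_measurable_integrable)
  qed
  then have "(LINT x|seg_pow l n. f x) = (\<Sum>p | p permutes {..<n}. LINT x:ordered_points n|seg_pow l n. f x)"
    unfolding integral_eq_sum_ordered_points[OF f] by (intro sum.cong refl) simp
  then show ?thesis
    by (simp add: card_permutations[OF refl])
qed

section \<open>The Fock space inner product\<close>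

lemma fock_space_measurable: "\<Phi> \<in> fock_space l \<Longrightarrow> \<Phi> n \<in> borel_measurable (seg_pow l n)"
  and fock_space_symmetric:
    "\<Phi> \<in> fock_space l \<Longrightarrow> p permutes {..<n} \<Longrightarrow> AE x in seg_pow l n. \<Phi> n (x \<circ> p) = \<Phi> n x"
  and fock_space_square_integrable: "\<Phi> \<in> fock_space l \<Longrightarrow> integrable (seg_pow l n) (\<lambda>x. (cmod (\<Phi> n x))\<^sup>2)"
  and fock_space_summable: "\<Phi> \<in> fock_space l \<Longrightarrow> summable (\<lambda>n. LINT x|seg_pow l n. (cmod (\<Phi> n x))\<^sup>2)"
  by (auto simp: fock_space_def)

text \<open>A crude form of the arithmetic-geometric mean inequality. It takes the place of
  Cauchy-Schwarz in proving that products of wave functions are integrable and that their integrals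
  are summable over the sectors.\<close>

lemma cnj_mult_le: "cmod (cnj a * b) \<le> (cmod a)\<^sup>2 + (cmod b)\<^sup>2"
proof -
  have "2 * (cmod a * cmod b) \<le> (cmod a)\<^sup>2 + (cmod b)\<^sup>2"
    using sum_squares_bound[of "cmod a" "cmod b"] by (simp add: power2_eq_square mult_ac)
  moreover have "0 \<le> cmod a * cmod b" by simp
  ultimately show ?thesis unfolding norm_mult complex_mod_cnj by linarith
qed

lemma borel_measurable_cnj_comp:
  "f \<in> borel_measurable M \<Longrightarrow> (\<lambda>x. cnj (f x)) \<in> borel_measurable M"
  by (rule measurable_compose[OF _ borel_measurable_continuous_onI[of cnj]])
     (auto intro: bounded_linear.continuous_on[OF bounded_linear_cnj continuous_on_id])

context
  fixes l :: real
begin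

lemma fock_product_integrable:
  assumes "\<Phi> \<in> fock_space l" "\<Psi> \<in> fock_space l"
  shows "integrable (seg_pow l n) (\<lambda>x. cnj (\<Phi> n x) * \<Psi> n x)"
proof (rule Bochner_Integration.integrable_bound)
  show "integrable (seg_pow l n) (\<lambda>x. (cmod (\<Phi> n x))\<^sup>2 + (cmod (\<Psi> n x))\<^sup>2)"
    using assms by (intro Bochner_Integration.integrable_add fock_space_square_integrable)
  show "(\<lambda>x. cnj (\<Phi> n x) * \<Psi> n x) \<in> borel_measurable (seg_pow l n)"
    using assms by (intro borel_measurable_times borel_measurable_cnj_comp fock_space_measurable)
  show "AE x in seg_pow l n. norm (cnj (\<Phi> n x) * \<Psi> n x) \<le> norm ((cmod (\<Phi> n x))\<^sup>2 + (cmod (\<Psi> n x))\<^sup>2)"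
    using cnj_mult_le by simp
qed

lemma fock_product_summable:
  assumes "\<Phi> \<in> fock_space l" "\<Psi> \<in> fock_space l"
  shows "summable (\<lambda>n. LINT x|seg_pow l n. cnj (\<Phi> n x) * \<Psi> n x)"
proof (rule summable_comparison_test')
  show "summable (\<lambda>n. (LINT x|seg_pow l n. (cmod (\<Phi> n x))\<^sup>2) + (LINT x|seg_pow l n. (cmod (\<Psi> n x))\<^sup>2))"
    using assms by (intro summable_add fock_space_summable)
  fix n
  have "norm (LINT x|seg_pow l n. cnj (\<Phi> n x) * \<Psi> n x) \<le> (LINT x|seg_pow l n. norm (cnj (\<Phi> n x) * \<Psi> n x))"
    by (rule integral_norm_bound)
  also have "\<dots> \<le> (LINT x|seg_pow l n. (cmod (\<Phi> n x))\<^sup>2 + (cmod (\<Psi> n x))\<^sup>2)"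
    using assms by (intro integral_mono integrable_norm fock_product_integrable
        Bochner_Integration.integrable_add fock_space_square_integrable cnj_mult_le)
  also have "\<dots> = (LINT x|seg_pow l n. (cmod (\<Phi> n x))\<^sup>2) + (LINT x|seg_pow l n. (cmod (\<Psi> n x))\<^sup>2)"
    using assms by (intro Bochner_Integration.integral_add fock_space_square_integrable)
  finally show "norm (LINT x|seg_pow l n. cnj (\<Phi> n x) * \<Psi> n x) \<le>
    (LINT x|seg_pow l n. (cmod (\<Phi> n x))\<^sup>2) + (LINT x|seg_pow l n. (cmod (\<Psi> n x))\<^sup>2)" .
qed

lemma fock_space_lin:
  assumes "\<Phi> \<in> fock_space l" "\<Psi> \<in> fock_space l"
  shows "(\<lambda>n x. c * \<Phi> n x + \<Psi> n x) \<in> fock_space l"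
proof -
  \<comment> \<open>The pointwise majorant from
    \<open>(a + b)^2 \<le> 2 * a^2 + 2 * b^2\<close>.\<close>
  let ?b = "\<lambda>n x. 2 * ((cmod c)\<^sup>2 * (cmod (\<Phi> n x))\<^sup>2) + 2 * (cmod (\<Psi> n x))\<^sup>2"
  have m: "(\<lambda>x. c * \<Phi> n x + \<Psi> n x) \<in> borel_measurable (seg_pow l n)" for n
    using assms by (intro borel_measurable_add borel_measurable_times borel_measurable_const fock_space_measurable)
  have le: "(cmod (c * \<Phi> n x + \<Psi> n x))\<^sup>2 \<le> ?b n x" for n x
  proof -
    have "(cmod (c * \<Phi> n x + \<Psi> n x))\<^sup>2 \<le> (cmod (c * \<Phi> n x) + cmod (\<Psi> n x))\<^sup>2"
      by (intro power_mono norm_triangle_ineq) simp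
    also have "\<dots> \<le> 2 * (cmod (c * \<Phi> n x))\<^sup>2 + 2 * (cmod (\<Psi> n x))\<^sup>2"
      using sum_squares_bound[of "cmod (c * \<Phi> n x)" "cmod (\<Psi> n x)"] by (simp add: power2_sum)
    finally show ?thesis by (simp add: norm_mult power_mult_distrib)
  qed
  have b: "integrable (seg_pow l n) (?b n)" for n
    using assms by (intro Bochner_Integration.integrable_add integrable_mult_right fock_space_square_integrable)
  have i: "integrable (seg_pow l n) (\<lambda>x. (cmod (c * \<Phi> n x + \<Psi> n x))\<^sup>2)" for n
    by (rule Bochner_Integration.integrable_bound[OF b])
       (use m le in \<open>auto intro!: borel_measurable_power borel_measurable_norm order_trans[OF le abs_ge_self]\<close>)
  have "summable (\<lambda>n. LINT x|seg_pow l n. (cmod (c * \<Phi> n x + \<Psi> n x))\<^sup>2)"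
  proof (rule summable_comparison_test')
    show "summable (\<lambda>n. 2 * ((cmod c)\<^sup>2 * (LINT x|seg_pow l n. (cmod (\<Phi> n x))\<^sup>2)) + 2 * (LINT x|seg_pow l n. (cmod (\<Psi> n x))\<^sup>2))"
      using assms by (intro summable_add summable_mult fock_space_summable)
    fix n
    have "(LINT x|seg_pow l n. (cmod (c * \<Phi> n x + \<Psi> n x))\<^sup>2) \<le> (LINT x|seg_pow l n. ?b n x)"
      by (intro integral_mono i b le)
    also have "\<dots> = 2 * ((cmod c)\<^sup>2 * (LINT x|seg_pow l n. (cmod (\<Phi> n x))\<^sup>2)) + 2 * (LINT x|seg_pow l n. (cmod (\<Psi> n x))\<^sup>2)"
      using assms by (subst Bochner_Integration.integral_add) (auto intro!: fock_space_square_integrable)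
    finally show "norm (LINT x|seg_pow l n. (cmod (c * \<Phi> n x + \<Psi> n x))\<^sup>2) \<le>
       2 * ((cmod c)\<^sup>2 * (LINT x|seg_pow l n. (cmod (\<Phi> n x))\<^sup>2)) + 2 * (LINT x|seg_pow l n. (cmod (\<Psi> n x))\<^sup>2)"
      by (simp add: integral_nonneg_AE)
  qed
  moreover have "AE x in seg_pow l n. c * \<Phi> n (x \<circ> p) + \<Psi> n (x \<circ> p) = c * \<Phi> n x + \<Psi> n x"
    if "p permutes {..<n}" for n p
    using fock_space_symmetric[OF assms(1) that] fock_space_symmetric[OF assms(2) that]
    by eventually_elim simp
  ultimately show ?thesis
    using m i unfolding fock_space_def by blast
qed

lemma fock_inner_lin_right:
  assumes "\<Phi> \<in> fock_space l" "\<Psi> \<in> fock_space l" "\<Xi> \<in> fock_space l"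
  shows "fock_inner l \<Phi> (\<lambda>n x. c * \<Psi> n x + \<Xi> n x) = c * fock_inner l \<Phi> \<Psi> + fock_inner l \<Phi> \<Xi>"
proof -
  have "(LINT x|seg_pow l n. cnj (\<Phi> n x) * (c * \<Psi> n x + \<Xi> n x)) =
      c * (LINT x|seg_pow l n. cnj (\<Phi> n x) * \<Psi> n x) + (LINT x|seg_pow l n. cnj (\<Phi> n x) * \<Xi> n x)" for n
  proof -
    have "(LINT x|seg_pow l n. cnj (\<Phi> n x) * (c * \<Psi> n x + \<Xi> n x)) =
        (LINT x|seg_pow l n. c * (cnj (\<Phi> n x) * \<Psi> n x) + cnj (\<Phi> n x) * \<Xi> n x)"
      by (simp add: algebra_simps)
    also have "\<dots> = c * (LINT x|seg_pow l n. cnj (\<Phi> n x) * \<Psi> n x) + (LINT x|seg_pow l n. cnj (\<Phi> n x) * \<Xi> n x)"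
      using fock_product_integrable[OF assms(1,2)] fock_product_integrable[OF assms(1,3)] by simp
    finally show ?thesis .
  qed
  then show ?thesis
    unfolding fock_inner_def
    using fock_product_summable[OF assms(1,2)] fock_product_summable[OF assms(1,3)]
    by (simp add: suminf_add[symmetric] suminf_mult summable_mult)
qed

lemma fock_inner_cnj:
  assumes "\<Phi> \<in> fock_space l" "\<Psi> \<in> fock_space l"
  shows "fock_inner l \<Psi> \<Phi> = cnj (fock_inner l \<Phi> \<Psi>)"
proof -
  have "(LINT x|seg_pow l n. cnj (\<Psi> n x) * \<Phi> n x) = cnj (LINT x|seg_pow l n. cnj (\<Phi> n x) * \<Psi> n x)" for n
    unfolding Bochner_Integration.integral_cnj[symmetric] by (simp add: mult.commute)
  then show ?thesis
    unfolding fock_inner_def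
    using sums_cnj[THEN iffD2, OF summable_sums[OF fock_product_summable[OF assms]]] by (simp add: sums_iff)
qed

lemma fock_inner_lin_left:
  assumes "\<Phi> \<in> fock_space l" "\<Psi> \<in> fock_space l" "\<Xi> \<in> fock_space l"
  shows "fock_inner l (\<lambda>n x. c * \<Psi> n x + \<Xi> n x) \<Phi> = cnj c * fock_inner l \<Psi> \<Phi> + fock_inner l \<Xi> \<Phi>"
  using fock_inner_lin_right[OF assms] fock_inner_cnj[OF assms(1) fock_space_lin[OF assms(2,3)]]
    fock_inner_cnj[OF assms(1,2)] fock_inner_cnj[OF assms(1,3)]
  by simp

lemma fock_inner_cong_right:
  assumes "\<Phi> \<in> fock_space l" "\<Psi> \<in> fock_space l" "\<Xi> \<in> fock_space l" "fock_eq l \<Psi> \<Xi>"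
  shows "fock_inner l \<Phi> \<Psi> = fock_inner l \<Phi> \<Xi>"
proof -
  have "(LINT x|seg_pow l n. cnj (\<Phi> n x) * \<Psi> n x) = (LINT x|seg_pow l n. cnj (\<Phi> n x) * \<Xi> n x)" for n
  proof (rule integral_cong_AE)
    have "AE x in seg_pow l n. \<Psi> n x = \<Xi> n x" using assms(4) by (simp add: fock_eq_def)
    then show "AE x in seg_pow l n. cnj (\<Phi> n x) * \<Psi> n x = cnj (\<Phi> n x) * \<Xi> n x"
      by eventually_elim simp
  qed (use assms fock_product_integrable in auto)
  then show ?thesis by (simp add: fock_inner_def)
qed

lemma sector_fock_space: "\<Phi> \<in> fock_space l \<Longrightarrow> sector N \<Phi> \<in> fock_space l"
proof -
  assume \<Phi>: "\<Phi> \<in> fock_space l"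
  have "summable (\<lambda>n. LINT x|seg_pow l n. (cmod (sector N \<Phi> n x))\<^sup>2)"
    by (rule summable_finite[of "{N}"]) (auto simp: sector_def)
  moreover have "sector N \<Phi> n \<in> borel_measurable (seg_pow l n)" for n
    using fock_space_measurable[OF \<Phi>, of n] by (simp add: sector_def)
  moreover have "AE x in seg_pow l n. sector N \<Phi> n (x \<circ> p) = sector N \<Phi> n x" if "p permutes {..<n}" for n p
    using fock_space_symmetric[OF \<Phi> that] by (cases "n = N") (simp_all add: sector_def)
  moreover have "integrable (seg_pow l n) (\<lambda>x. (cmod (sector N \<Phi> n x))\<^sup>2)" for n
    using fock_space_square_integrable[OF \<Phi>, of n] by (cases "n = N") (simp_all add: sector_def)
  ultimately show ?thesis unfolding fock_space_def by blast
qed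

lemma fock_inner_sector_left:
  "fock_inner l (sector M \<Phi>) \<Psi> = (LINT x|seg_pow l M. cnj (\<Phi> M x) * \<Psi> M x)"
  unfolding fock_inner_def by (subst suminf_finite[of "{M}"]) (auto simp: sector_def)

lemma fock_inner_sector_right:
  "fock_inner l \<Phi> (sector N \<Psi>) = (LINT x|seg_pow l N. cnj (\<Phi> N x) * \<Psi> N x)"
  unfolding fock_inner_def by (subst suminf_finite[of "{N}"]) (auto simp: sector_def)

subsection \<open>Unitary modifications on a two-dimensional subspace\<close>

text \<open>The operator changes a vector only by an element of the span of the orthonormal pair, so
  everything reduces to the two overlaps with that pair. Isometry uses \<open>V\<close>-adjoint
  times \<open>V\<close>, and surjectivity the product in the other order.\<close>

lemma fock_unitary_two_dim:
  fixes \<psi> :: "nat \<Rightarrow> fock" and V :: "complex mat"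
  assumes \<psi>: "\<And>i. i < 2 \<Longrightarrow> \<psi> i \<in> fock_space l"
    and on: "\<And>i j. i < 2 \<Longrightarrow> j < 2 \<Longrightarrow> fock_inner l (\<psi> i) (\<psi> j) = of_bool (i = j)"
    and V: "V \<in> carrier_mat 2 2" "mat_adjoint V * V = 1\<^sub>m 2" "V * mat_adjoint V = 1\<^sub>m 2"
    and U: "U = (\<lambda>\<Psi> n x. \<Psi> n x +
           (\<Sum>i<2. \<Sum>j<2. (V $$ (i, j) - of_bool (i = j)) * ket_bra l (\<psi> i) (\<psi> j) \<Psi> n x))"
  shows "fock_unitary l U"
proof -
  define \<phi> \<eta> where \<phi>_def: "\<phi> = \<psi> 0" and \<eta>_def: "\<eta> = \<psi> 1"
  define va vb vc vd where v_def: "va = V $$ (0, 0)" "vb = V $$ (0, 1)" "vc = V $$ (1, 0)" "vd = V $$ (1, 1)"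
  have F: "\<phi> \<in> fock_space l" "\<eta> \<in> fock_space l" using \<psi> by (auto simp: \<phi>_def \<eta>_def)
  have on': "fock_inner l \<phi> \<phi> = 1" "fock_inner l \<phi> \<eta> = 0" "fock_inner l \<eta> \<phi> = 0" "fock_inner l \<eta> \<eta> = 1"
    using on[of 0 0] on[of 0 1] on[of 1 0] on[of 1 1] by (auto simp: \<phi>_def \<eta>_def)
  have adj: "mat_adjoint V \<in> carrier_mat 2 2" "\<And>i j. i < 2 \<Longrightarrow> j < 2 \<Longrightarrow> mat_adjoint V $$ (i, j) = cnj (V $$ (j, i))"
    using V(1) by (auto simp: mat_adjoint_def mat_of_rows_def)
  have VV: "(\<Sum>k<2. cnj (V $$ (k, i)) * V $$ (k, j)) = of_bool (i = j)"
    and VV': "(\<Sum>k<2. V $$ (i, k) * cnj (V $$ (j, k))) = of_bool (i = j)" if "i < 2" "j < 2" for i j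
  proof -
    have "(\<Sum>k<2. cnj (V $$ (k, i)) * V $$ (k, j)) = (mat_adjoint V * V) $$ (i, j)"
      unfolding mult_mat_index_sum[OF adj(1) V(1) that] using that by (intro sum.cong) (auto simp: adj)
    then show "(\<Sum>k<2. cnj (V $$ (k, i)) * V $$ (k, j)) = of_bool (i = j)"
      unfolding V(2) using that by simp
    have "(\<Sum>k<2. V $$ (i, k) * cnj (V $$ (j, k))) = (V * mat_adjoint V) $$ (i, j)"
      unfolding mult_mat_index_sum[OF V(1) adj(1) that] using that by (intro sum.cong) (auto simp: adj)
    then show "(\<Sum>k<2. V $$ (i, k) * cnj (V $$ (j, k))) = of_bool (i = j)"
      unfolding V(3) using that by simp
  qed
  have v: "cnj va * va + cnj vc * vc = 1" "cnj va * vb + cnj vc * vd = 0"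
      "cnj vb * va + cnj vd * vc = 0" "cnj vb * vb + cnj vd * vd = 1"
    using VV[of 0 0] VV[of 0 1] VV[of 1 0] VV[of 1 1] by (simp_all add: numeral_2_eq_2 v_def)
  have v': "va * cnj va + vb * cnj vb = 1" "va * cnj vc + vb * cnj vd = 0"
      "vc * cnj va + vd * cnj vb = 0" "vc * cnj vc + vd * cnj vd = 1"
    using VV'[of 0 0] VV'[of 0 1] VV'[of 1 0] VV'[of 1 1] by (simp_all add: numeral_2_eq_2 v_def)
  define lin where "lin p q \<Psi> = (\<lambda>n x. p * \<phi> n x + (q * \<eta> n x + \<Psi> n x))" for p q :: complex and \<Psi> :: fock
  have lin_F: "\<Psi> \<in> fock_space l \<Longrightarrow> lin p q \<Psi> \<in> fock_space l" for p q \<Psi>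
    unfolding lin_def by (intro fock_space_lin F)
  have lin_right: "fock_inner l \<Phi> (lin p q \<Psi>) = p * fock_inner l \<Phi> \<phi> + (q * fock_inner l \<Phi> \<eta> + fock_inner l \<Phi> \<Psi>)"
    if "\<Phi> \<in> fock_space l" "\<Psi> \<in> fock_space l" for \<Phi> \<Psi> p q
    unfolding lin_def using that F by (simp add: fock_inner_lin_right fock_space_lin)
  have lin_left: "fock_inner l (lin p q \<Psi>) \<Phi> = cnj p * fock_inner l \<phi> \<Phi> + (cnj q * fock_inner l \<eta> \<Phi> + fock_inner l \<Psi> \<Phi>)"
    if "\<Phi> \<in> fock_space l" "\<Psi> \<in> fock_space l" for \<Phi> \<Psi> p q
    unfolding lin_def using that F by (simp add: fock_inner_lin_left fock_space_lin)
  \<comment> \<open>\<open>P\<close> and \<open>R\<close> are the two components of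
    \<open>V - 1\<close> applied to the vector of overlaps of \<open>\<Psi>\<close> with the
    pair.\<close>
  define P where "P \<Psi> = (va - 1) * fock_inner l \<phi> \<Psi> + vb * fock_inner l \<eta> \<Psi>" for \<Psi>
  define R where "R \<Psi> = vc * fock_inner l \<phi> \<Psi> + (vd - 1) * fock_inner l \<eta> \<Psi>" for \<Psi>
  have UE: "U \<Psi> = lin (P \<Psi>) (R \<Psi>) \<Psi>" for \<Psi>
    unfolding U lin_def P_def R_def ket_bra_def v_def \<phi>_def \<eta>_def
    by (simp add: numeral_2_eq_2 algebra_simps)
  have isometry: "fock_inner l (U \<Phi>) (U \<Psi>) = fock_inner l \<Phi> \<Psi>"
    if F': "\<Phi> \<in> fock_space l" "\<Psi> \<in> fock_space l" for \<Phi> \<Psi>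
  proof -
    let ?p = "fock_inner l \<phi> \<Phi>" and ?q = "fock_inner l \<eta> \<Phi>"
    let ?r = "fock_inner l \<phi> \<Psi>" and ?s = "fock_inner l \<eta> \<Psi>"
    have c: "fock_inner l \<Phi> \<phi> = cnj ?p" "fock_inner l \<Phi> \<eta> = cnj ?q"
      by (rule fock_inner_cnj[OF F(1) F'(1)]) (rule fock_inner_cnj[OF F(2) F'(1)])
    have "fock_inner l (U \<Phi>) (U \<Psi>) = fock_inner l \<Phi> \<Psi> +
       (cnj (P \<Phi>) * ?r + cnj (R \<Phi>) * ?s + P \<Psi> * cnj ?p + R \<Psi> * cnj ?q + cnj (P \<Phi>) * P \<Psi> + cnj (R \<Phi>) * R \<Psi>)"
      unfolding UE using F F' by (simp add: lin_right lin_left lin_F on' c algebra_simps)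
    \<comment> \<open>Grouped by products of overlaps, the four coefficients are the entries of the
      adjoint of \<open>V\<close> times \<open>V\<close>, minus the identity.\<close>
    also have "cnj (P \<Phi>) * ?r + cnj (R \<Phi>) * ?s + P \<Psi> * cnj ?p + R \<Psi> * cnj ?q + cnj (P \<Phi>) * P \<Psi> + cnj (R \<Phi>) * R \<Psi> =
       cnj ?p * ?r * (cnj va * va + cnj vc * vc - 1) + cnj ?p * ?s * (cnj va * vb + cnj vc * vd) +
       cnj ?q * ?r * (cnj vb * va + cnj vd * vc) + cnj ?q * ?s * (cnj vb * vb + cnj vd * vd - 1)"
      by (simp add: P_def R_def algebra_simps)
    also have "\<dots> = 0" unfolding v by simp
    finally show ?thesis by simp
  qed
  have surj: "\<exists>\<Psi>\<in>fock_space l. fock_eq l (U \<Psi>) \<Phi>" if \<Phi>: "\<Phi> \<in> fock_space l" for \<Phi>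
  proof -
    let ?p = "fock_inner l \<phi> \<Phi>" and ?q = "fock_inner l \<eta> \<Phi>"
    \<comment> \<open>The preimage of \<open>\<Phi>\<close> is its image under the adjoint operator:
      \<open>p\<close> and \<open>q\<close> are the components of the adjoint of \<open>V\<close>
      minus the identity, applied to the overlaps of \<open>\<Phi>\<close>.\<close>
    define p where "p = (cnj va - 1) * ?p + cnj vc * ?q"
    define q where "q = cnj vb * ?p + (cnj vd - 1) * ?q"
    have i: "fock_inner l \<phi> (lin p q \<Phi>) = p + ?p" "fock_inner l \<eta> (lin p q \<Phi>) = q + ?q"
      using F \<Phi> by (simp_all add: lin_right on')
    have "P (lin p q \<Phi>) + p = ?p * (va * cnj va + vb * cnj vb - 1) + ?q * (va * cnj vc + vb * cnj vd)"
      unfolding P_def i by (simp add: p_def q_def algebra_simps)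
    then have 1: "P (lin p q \<Phi>) + p = 0" unfolding v' by simp
    have "R (lin p q \<Phi>) + q = ?p * (vc * cnj va + vd * cnj vb) + ?q * (vc * cnj vc + vd * cnj vd - 1)"
      unfolding R_def i by (simp add: p_def q_def algebra_simps)
    then have 2: "R (lin p q \<Phi>) + q = 0" unfolding v' by simp
    have "U (lin p q \<Phi>) n x = (P (lin p q \<Phi>) + p) * \<phi> n x + (R (lin p q \<Phi>) + q) * \<eta> n x + \<Phi> n x" for n x
      unfolding UE by (simp add: lin_def algebra_simps)
    then have "fock_eq l (U (lin p q \<Phi>)) \<Phi>" unfolding 1 2 by (simp add: fock_eq_def)
    then show ?thesis using lin_F[OF \<Phi>] by blast
  qed
  have cong: "fock_eq l (U \<Phi>) (U \<Psi>)" if "\<Phi> \<in> fock_space l" "\<Psi> \<in> fock_space l" "fock_eq l \<Phi> \<Psi>" for \<Phi> \<Psi>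
  proof -
    have "P \<Phi> = P \<Psi>" "R \<Phi> = R \<Psi>"
      using fock_inner_cong_right[OF _ that] F by (simp_all add: P_def R_def)
    then show ?thesis
      using that(3) unfolding UE lin_def fock_eq_def by (auto elim!: eventually_mono)
  qed
  have lin_U: "U (\<lambda>n x. c * \<Phi> n x + \<Psi> n x) = (\<lambda>n x. c * U \<Phi> n x + U \<Psi> n x)"
    if "\<Phi> \<in> fock_space l" "\<Psi> \<in> fock_space l" for \<Phi> \<Psi> c
  proof -
    have "P (\<lambda>n x. c * \<Phi> n x + \<Psi> n x) = c * P \<Phi> + P \<Psi>" "R (\<lambda>n x. c * \<Phi> n x + \<Psi> n x) = c * R \<Phi> + R \<Psi>"
      unfolding P_def R_def by (simp_all only: fock_inner_lin_right[OF F(1) that] fock_inner_lin_right[OF F(2) that])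
        (simp_all add: algebra_simps)
    then show ?thesis unfolding UE by (simp add: lin_def algebra_simps)
  qed
  show ?thesis
    unfolding fock_unitary_def
  proof (intro conjI ballI allI impI)
    show "U \<Phi> \<in> fock_space l" if "\<Phi> \<in> fock_space l" for \<Phi>
      using that unfolding UE by (rule lin_F)
    show "fock_eq l (U (\<lambda>n x. c * \<Phi> n x + \<Psi> n x)) (\<lambda>n x. c * U \<Phi> n x + U \<Psi> n x)"
      if "\<Phi> \<in> fock_space l" "\<Psi> \<in> fock_space l" for \<Phi> \<Psi> c
      unfolding lin_U[OF that] by (simp add: fock_eq_def)
  qed (fact cong isometry surj)+
qed

end

section \<open>Matrix elements of continuous matrix product operators\<close>

text \<open>One summand of the Dyson expansion, with the string written as an image of the list of
  pairs of position and leg. This is the form in which strings of direct sums and Kronecker products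
  are decomposed.\<close>

definition cmpo_integrand ::
  "real \<Rightarrow> nat \<Rightarrow> complex mat \<Rightarrow> (real \<Rightarrow> complex mat) \<Rightarrow> (real \<Rightarrow> complex mat) \<Rightarrow>
   (real \<Rightarrow> complex mat) \<Rightarrow> (real \<Rightarrow> complex mat) \<Rightarrow> fock \<Rightarrow> fock \<Rightarrow> leg list \<Rightarrow> (nat \<Rightarrow> real) \<Rightarrow> complex" where
  "cmpo_integrand l D B Q L R T \<Phi> \<Psi> \<alpha> x =
     mat_trace (B * mat_string D Q (- l / 2) (l / 2)
       (map (\<lambda>(y, g). (y, leg_mat (L y) (R y) (T y) g)) (map (\<lambda>i. (x i, \<alpha> ! i)) [0..<length \<alpha>])))
     * cnj (vac_amp \<Phi> (ket_points \<alpha> x)) * vac_amp \<Psi> (bra_points \<alpha> x)"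

lemma leg_mat_apply: "leg_mat L R T g y = leg_mat (L y) (R y) (T y) g"
  by (cases g) auto

lemma cmpo_elem_integrand:
  "cmpo_elem l D B Q L R T \<Phi> \<Psi> = (\<Sum>n. \<Sum>\<alpha> | length \<alpha> = n.
     LINT x:ordered_points n|seg_pow l n. cmpo_integrand l D B Q L R T \<Phi> \<Psi> \<alpha> x)"
  unfolding cmpo_elem_def cmpo_integrand_def
  by (intro suminf_cong sum.cong refl) (simp add: comp_def leg_mat_apply)

lemma finite_legs: "finite {\<alpha> :: leg list. length \<alpha> = n}"
proof -
  have "(UNIV :: leg set) = {Left_leg, Right_leg, Ad_leg}" using leg.exhaust by blast
  then have "finite (UNIV :: leg set)" by (metis finite.emptyI finite_insert)
  from finite_lists_length_eq[OF this, of n] show ?thesis by simp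
qed

lemma vac_amp_sector: "length ys \<noteq> N \<Longrightarrow> vac_amp (sector N \<Phi>) ys = 0"
  by (simp add: vac_amp_def sector_def)

text \<open>Every letter consumes a ket point or a bra point, and an \<open>Ad_leg\<close> consumes
  both. A word longer than \<open>M + N\<close> thus cannot connect the sectors \<open>M\<close> and
  \<open>N\<close>.\<close>

lemma length_le_positions: "length \<alpha> \<le> length (ket_positions \<alpha>) + length (bra_positions \<alpha>)"
proof -
  have "{..<length \<alpha>} \<subseteq> set (ket_positions \<alpha>) \<union> set (bra_positions \<alpha>)"
    by (auto simp: ket_positions_def bra_positions_def)
  then have "card {..<length \<alpha>} \<le> card (set (ket_positions \<alpha>) \<union> set (bra_positions \<alpha>))"
    by (intro card_mono) auto
  also have "\<dots> \<le> length (ket_positions \<alpha>) + length (bra_positions \<alpha>)"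
    by (intro order_trans[OF card_Un_le] add_mono card_length)
  finally show ?thesis by simp
qed

lemma cmpo_integrand_sector_zero:
  assumes "length (ket_positions \<alpha>) \<noteq> M \<or> length (bra_positions \<alpha>) \<noteq> N"
  shows "cmpo_integrand l D B Q L R T (sector M \<Phi>) (sector N \<Psi>) \<alpha> x = 0"
  using assms by (auto simp: cmpo_integrand_def vac_amp_sector ket_points_positions bra_points_positions)

text \<open>Between fixed sectors the series has finitely many nonzero terms. The resulting
  \<open>sums\<close> statement, unlike a bare \<open>suminf\<close>, can be added to another
  one.\<close>

lemma cmpo_elem_sector_sums:
  "(\<lambda>n. \<Sum>\<alpha> | length \<alpha> = n. LINT x:ordered_points n|seg_pow l n.
      cmpo_integrand l D B Q L R T (sector M \<Phi>) (sector N \<Psi>) \<alpha> x)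
    sums cmpo_elem l D B Q L R T (sector M \<Phi>) (sector N \<Psi>)"
  unfolding cmpo_elem_integrand
proof (rule summable_sums, rule summable_finite[of "{..M + N}"])
  fix n assume n: "n \<notin> {..M + N}"
  show "(\<Sum>\<alpha> | length \<alpha> = n. LINT x:ordered_points n|seg_pow l n.
      cmpo_integrand l D B Q L R T (sector M \<Phi>) (sector N \<Psi>) \<alpha> x) = 0"
  proof (rule sum.neutral, intro ballI)
    fix \<alpha> :: "leg list" assume "\<alpha> \<in> {\<alpha>. length \<alpha> = n}"
    then have "length (ket_positions \<alpha>) \<noteq> M \<or> length (bra_positions \<alpha>) \<noteq> N"
      using n length_le_positions[of \<alpha>] by auto
    then show "(LINT x:ordered_points n|seg_pow l n.
      cmpo_integrand l D B Q L R T (sector M \<Phi>) (sector N \<Psi>) \<alpha> x) = 0"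
      by (simp add: cmpo_integrand_sector_zero set_lebesgue_integral_def)
  qed
qed simp

text \<open>
  Integrability of every summand is part of the predicate because the integral of a
  non-integrable function is zero, which would break additivity.
\<close>

definition cmpo_represents :: "real \<Rightarrow> nat \<Rightarrow> (fock \<Rightarrow> fock \<Rightarrow> complex) \<Rightarrow> bool" where
  "cmpo_represents l D E \<longleftrightarrow> (\<exists>B Q L R T. cmpo_data l D B Q L R T \<and>
     (\<forall>\<Phi>\<in>fock_space l. \<forall>\<Psi>\<in>fock_space l. \<forall>M N.
        (\<forall>\<alpha>. set_integrable (seg_pow l (length \<alpha>)) (ordered_points (length \<alpha>))
           (cmpo_integrand l D B Q L R T (sector M \<Phi>) (sector N \<Psi>) \<alpha>)) \<and>
        cmpo_elem l D B Q L R T (sector M \<Phi>) (sector N \<Psi>) = E (sector M \<Phi>) (sector N \<Psi>)))"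

text \<open>\<open>ordered_points\<close> also contains functions that are not extensional and so
  lie outside the space of \<open>seg_pow\<close>; the formulas for the integrands are available on
  the intersection only.\<close>

lemma set_integral_cong_space:
  fixes f g :: "'a \<Rightarrow> 'b::{banach,second_countable_topology}"
  assumes "\<And>x. x \<in> space M \<Longrightarrow> x \<in> A \<Longrightarrow> f x = g x"
  shows "(LINT x:A|M. f x) = (LINT x:A|M. g x)" "set_integrable M A f \<longleftrightarrow> set_integrable M A g"
proof -
  show "(LINT x:A|M. f x) = (LINT x:A|M. g x)"
    unfolding set_lebesgue_integral_def
    by (rule Bochner_Integration.integral_cong) (auto simp: indicator_def assms)
  show "set_integrable M A f \<longleftrightarrow> set_integrable M A g"
    unfolding set_integrable_def
    by (rule Bochner_Integration.integrable_cong) (auto simp: indicator_def assms)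
qed

lemma seg_endpoints:
  "l > 0 \<Longrightarrow> - l / 2 \<in> seg l" "l > 0 \<Longrightarrow> l / 2 \<in> seg l"
  by (auto simp: seg_def)

lemma leg_mat_carrier:
  "cmpo_data l D B Q L R T \<Longrightarrow> y \<in> seg l \<Longrightarrow> leg_mat (L y) (R y) (T y) g \<in> carrier_mat D D"
  by (cases g) (auto simp: cmpo_data_def mat_fun_def)

lemma seg_pow_space_seg: "x \<in> space (seg_pow l n) \<Longrightarrow> i < n \<Longrightarrow> x i \<in> seg l"
  by (auto simp: space_seg_pow)

text \<open>Both blocks are driven by the same word at the same points, so strings stay block
  diagonal and each integrand is a pointwise sum of traces. This sum passes through the integral by
  integrability and through the series by its finiteness.\<close>

lemma cmpo_represents_add:
  assumes l: "l > 0" and 1: "cmpo_represents l D1 E1" and 2: "cmpo_represents l D2 E2"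
  shows "cmpo_represents l (D1 + D2) (\<lambda>\<Phi> \<Psi>. E1 \<Phi> \<Psi> + E2 \<Phi> \<Psi>)"
proof -
  obtain B1 Q1 L1' R1 T1 where c1: "cmpo_data l D1 B1 Q1 L1' R1 T1"
    and r1: "\<And>\<Phi> \<Psi> M N. \<Phi> \<in> fock_space l \<Longrightarrow> \<Psi> \<in> fock_space l \<Longrightarrow>
        (\<forall>\<alpha>. set_integrable (seg_pow l (length \<alpha>)) (ordered_points (length \<alpha>))
           (cmpo_integrand l D1 B1 Q1 L1' R1 T1 (sector M \<Phi>) (sector N \<Psi>) \<alpha>)) \<and>
        cmpo_elem l D1 B1 Q1 L1' R1 T1 (sector M \<Phi>) (sector N \<Psi>) = E1 (sector M \<Phi>) (sector N \<Psi>)"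
    using 1 unfolding cmpo_represents_def by blast
  obtain B2 Q2 L2' R2 T2 where c2: "cmpo_data l D2 B2 Q2 L2' R2 T2"
    and r2: "\<And>\<Phi> \<Psi> M N. \<Phi> \<in> fock_space l \<Longrightarrow> \<Psi> \<in> fock_space l \<Longrightarrow>
        (\<forall>\<alpha>. set_integrable (seg_pow l (length \<alpha>)) (ordered_points (length \<alpha>))
           (cmpo_integrand l D2 B2 Q2 L2' R2 T2 (sector M \<Phi>) (sector N \<Psi>) \<alpha>)) \<and>
        cmpo_elem l D2 B2 Q2 L2' R2 T2 (sector M \<Phi>) (sector N \<Psi>) = E2 (sector M \<Phi>) (sector N \<Psi>)"
    using 2 unfolding cmpo_represents_def by blast
  let ?B = "dirsum B1 B2" and ?Q = "\<lambda>x. dirsum (Q1 x) (Q2 x)" and ?L = "\<lambda>x. dirsum (L1' x) (L2' x)"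
    and ?R = "\<lambda>x. dirsum (R1 x) (R2 x)" and ?T = "\<lambda>x. dirsum (T1 x) (T2 x)"
  have c: "cmpo_data l (D1 + D2) ?B ?Q ?L ?R ?T"
    using c1 c2 unfolding cmpo_data_def
    by (intro conjI dirsum_carrier mat_fun_dirsum L1_0 L2_0 Linf_const L1_cong L2_cong Linf_cong) auto
  have B: "B1 \<in> carrier_mat D1 D1" "B2 \<in> carrier_mat D2 D2"
    and Q: "\<And>z. z \<in> seg l \<Longrightarrow> Q1 z \<in> carrier_mat D1 D1" "\<And>z. z \<in> seg l \<Longrightarrow> Q2 z \<in> carrier_mat D2 D2"
    using c1 c2 by (auto simp: cmpo_data_def mat_fun_def)
  have add: "cmpo_integrand l (D1 + D2) ?B ?Q ?L ?R ?T \<Phi> \<Psi> \<alpha> x =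
      cmpo_integrand l D1 B1 Q1 L1' R1 T1 \<Phi> \<Psi> \<alpha> x + cmpo_integrand l D2 B2 Q2 L2' R2 T2 \<Phi> \<Psi> \<alpha> x"
    if x: "x \<in> space (seg_pow l (length \<alpha>))" for \<Phi> \<Psi> \<alpha> x
  proof -
    define zs where "zs = map (\<lambda>i. (x i, \<alpha> ! i)) [0..<length \<alpha>]"
    have zs: "y \<in> seg l" if "(y, g) \<in> set zs" for y g
      using that seg_pow_space_seg[OF x] by (auto simp: zs_def)
    define K1 where "K1 y g = leg_mat (L1' y) (R1 y) (T1 y) g" for y g
    define K2 where "K2 y g = leg_mat (L2' y) (R2 y) (T2 y) g" for y g
    have K: "K1 y g \<in> carrier_mat D1 D1" "K2 y g \<in> carrier_mat D2 D2" if "y \<in> seg l" for y g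
      unfolding K1_def K2_def using leg_mat_carrier[OF c1 that] leg_mat_carrier[OF c2 that] by auto
    have "leg_mat (?L y) (?R y) (?T y) g = dirsum (K1 y g) (K2 y g)" for y g
      by (cases g) (auto simp: K1_def K2_def)
    then have S: "mat_string (D1 + D2) ?Q (- l / 2) (l / 2) (map (\<lambda>(y, g). (y, leg_mat (?L y) (?R y) (?T y) g)) zs) =
        dirsum (mat_string D1 Q1 (- l / 2) (l / 2) (map (\<lambda>(y, g). (y, K1 y g)) zs))
          (mat_string D2 Q2 (- l / 2) (l / 2) (map (\<lambda>(y, g). (y, K2 y g)) zs))"
      using seg_endpoints[OF l] Q zs K by (simp add: mat_string_dirsum)
    have C: "mat_string D1 Q1 (- l / 2) (l / 2) (map (\<lambda>(y, g). (y, K1 y g)) zs) \<in> carrier_mat D1 D1"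
      "mat_string D2 Q2 (- l / 2) (l / 2) (map (\<lambda>(y, g). (y, K2 y g)) zs) \<in> carrier_mat D2 D2"
      using zs K by (intro mat_string_carrier; auto)+
    show ?thesis
      unfolding cmpo_integrand_def zs_def[symmetric] S K1_def[symmetric] K2_def[symmetric]
      using dirsum_mult[OF B(1) C(1) B(2) C(2)]
        mat_trace_dirsum[OF mult_carrier_mat[OF B(1) C(1)] mult_carrier_mat[OF B(2) C(2)]]
      by (simp add: distrib_right)
  qed
  have "(\<forall>\<alpha>. set_integrable (seg_pow l (length \<alpha>)) (ordered_points (length \<alpha>))
           (cmpo_integrand l (D1 + D2) ?B ?Q ?L ?R ?T (sector M \<Phi>) (sector N \<Psi>) \<alpha>)) \<and>
        cmpo_elem l (D1 + D2) ?B ?Q ?L ?R ?T (sector M \<Phi>) (sector N \<Psi>) =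
        E1 (sector M \<Phi>) (sector N \<Psi>) + E2 (sector M \<Phi>) (sector N \<Psi>)"
    if F: "\<Phi> \<in> fock_space l" "\<Psi> \<in> fock_space l" for \<Phi> \<Psi> M N
  proof -
    let ?i = "\<lambda>\<alpha> x. cmpo_integrand l (D1 + D2) ?B ?Q ?L ?R ?T (sector M \<Phi>) (sector N \<Psi>) \<alpha> x"
    let ?i1 = "\<lambda>\<alpha> x. cmpo_integrand l D1 B1 Q1 L1' R1 T1 (sector M \<Phi>) (sector N \<Psi>) \<alpha> x"
    let ?i2 = "\<lambda>\<alpha> x. cmpo_integrand l D2 B2 Q2 L2' R2 T2 (sector M \<Phi>) (sector N \<Psi>) \<alpha> x"
    have i: "set_integrable (seg_pow l (length \<alpha>)) (ordered_points (length \<alpha>)) (?i1 \<alpha>)"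
      "set_integrable (seg_pow l (length \<alpha>)) (ordered_points (length \<alpha>)) (?i2 \<alpha>)" for \<alpha>
      using r1[OF F] r2[OF F] by auto
    note A = set_integral_add[OF i]
    have I: "set_integrable (seg_pow l (length \<alpha>)) (ordered_points (length \<alpha>)) (?i \<alpha>)" for \<alpha>
      using A(1) by (rule set_integral_cong_space(2)[THEN iffD1, rotated]) (simp add: add)
    have int: "(LINT x:ordered_points (length \<alpha>)|seg_pow l (length \<alpha>). ?i \<alpha> x) =
        (LINT x:ordered_points (length \<alpha>)|seg_pow l (length \<alpha>). ?i1 \<alpha> x) +
        (LINT x:ordered_points (length \<alpha>)|seg_pow l (length \<alpha>). ?i2 \<alpha> x)" for \<alpha>
      unfolding A(2)[symmetric] by (rule set_integral_cong_space(1)) (simp add: add)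
    have "(\<Sum>\<alpha> | length \<alpha> = n. LINT x:ordered_points n|seg_pow l n. ?i \<alpha> x) =
        (\<Sum>\<alpha> | length \<alpha> = n. LINT x:ordered_points n|seg_pow l n. ?i1 \<alpha> x) +
        (\<Sum>\<alpha> | length \<alpha> = n. LINT x:ordered_points n|seg_pow l n. ?i2 \<alpha> x)" for n
      unfolding sum.distrib[symmetric] by (intro sum.cong refl) (use int in auto)
    then have "cmpo_elem l (D1 + D2) ?B ?Q ?L ?R ?T (sector M \<Phi>) (sector N \<Psi>) =
        cmpo_elem l D1 B1 Q1 L1' R1 T1 (sector M \<Phi>) (sector N \<Psi>) +
        cmpo_elem l D2 B2 Q2 L2' R2 T2 (sector M \<Phi>) (sector N \<Psi>)"
      using sums_unique2[OF cmpo_elem_sector_sums[of l "D1 + D2" ?B ?Q ?L ?R ?T M \<Phi> N \<Psi>]]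
        sums_add[OF cmpo_elem_sector_sums[of l D1 B1 Q1 L1' R1 T1 M \<Phi> N \<Psi>]
          cmpo_elem_sector_sums[of l D2 B2 Q2 L2' R2 T2 M \<Phi> N \<Psi>]]
      by simp
    then show ?thesis using I r1[OF F] r2[OF F] by simp
  qed
  with c show ?thesis unfolding cmpo_represents_def by blast
qed

lemma path_exp_zero: "path_exp D (\<lambda>x. 0\<^sub>m D D) x y = 1\<^sub>m D"
proof -
  have t: "path_exp_term D (\<lambda>x. 0\<^sub>m D D) (Suc n) x y = 0\<^sub>m D D" for n
    by (rule eq_matI) (auto simp: path_exp_term.simps(2) right_mult_zero_mat[OF path_exp_term_carrier] set_lebesgue_integral_def)
  show ?thesis
  proof (rule eq_matI)
    fix i j assume "i < dim_row (1\<^sub>m D :: complex mat)" "j < dim_col (1\<^sub>m D :: complex mat)"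
    then have ij: "i < D" "j < D" by auto
    have "path_exp_term D (\<lambda>x. 0\<^sub>m D D) n x y $$ (i, j) = (if n = 0 then 1\<^sub>m D $$ (i, j) else 0)" for n
      using ij t by (cases n) auto
    then show "path_exp D (\<lambda>x. 0\<^sub>m D D) x y $$ (i, j) = 1\<^sub>m D $$ (i, j)"
      using ij suminf_finite[of "{0}" "\<lambda>n. path_exp_term D (\<lambda>x. 0\<^sub>m D D) n x y $$ (i, j)"]
      by (simp add: path_exp_index)
  qed auto
qed

lemma set_integral_indicator_zero [simp]: "(LINT x:A|M. 0) = 0"
  by (simp add: set_lebesgue_integral_def)

lemma vac_amp_extensional:
  assumes "x \<in> extensional {..<n}"
  shows "vac_amp \<Phi> (map x [0..<n]) = complex_of_real (sqrt (fact n)) * \<Phi> n x"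
proof -
  have "(\<lambda>i\<in>{..<n}. map x [0..<n] ! i) = x"
    using assms by (auto simp: fun_eq_iff extensional_def)
  then show ?thesis by (simp add: vac_amp_def)
qed

lemma sqrt_fact_self: "complex_of_real (sqrt (fact n)) * complex_of_real (sqrt (fact n)) = fact n"
  unfolding of_real_mult[symmetric] by simp

lemma sqrt_fact_self_left: "complex_of_real (sqrt (fact n)) * (complex_of_real (sqrt (fact n)) * z) = fact n * z"
  by (simp add: sqrt_fact_self flip: mult.assoc)

text \<open>The factor \<open>fact n\<close>, which arises from two square roots in the amplitudes,
  exactly compensates for restricting a symmetric integrand to one of \<open>fact n\<close>
  chambers.\<close>

lemma fock_product_integral_ordered:
  assumes "\<Phi> \<in> fock_space l" "\<Psi> \<in> fock_space l"
  shows "(LINT x:ordered_points n|seg_pow l n. fact n * (cnj (\<Phi> n x) * \<Psi> n x)) =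
    (LINT x|seg_pow l n. cnj (\<Phi> n x) * \<Psi> n x)"
proof -
  have "AE x in seg_pow l n. cnj (\<Phi> n (x \<circ> p)) * \<Psi> n (x \<circ> p) = cnj (\<Phi> n x) * \<Psi> n x"
    if "p permutes {..<n}" for p
    using fock_space_symmetric[OF assms(1) that] fock_space_symmetric[OF assms(2) that]
    by eventually_elim simp
  from integral_ordered_points_symmetric[OF fock_product_integrable[OF assms] this]
  show ?thesis by simp
qed

subsection \<open>The identity operator\<close>

text \<open>All propagators are trivial and a left or right leg inserts zero, so a single word of
  each length survives.\<close>

lemma mat_string_identity:
  "mat_string 1 (\<lambda>x. 0\<^sub>m 1 1) a b (map (\<lambda>(y, g). (y, leg_mat (0\<^sub>m 1 1) (0\<^sub>m 1 1) (1\<^sub>m 1) g)) zs) =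
    (if \<forall>z\<in>set zs. snd z = Ad_leg then 1\<^sub>m 1 else 0\<^sub>m 1 1)"
proof (induction zs arbitrary: a)
  case (Cons z zs)
  obtain y g where z: "z = (y, g)" by (cases z)
  show ?case
    using Cons.IH[of y] z by (cases g) (auto simp: path_exp_zero)
qed (simp add: path_exp_zero)

text \<open>In the surviving word of \<open>Ad_leg\<close> letters the ket and bra points coincide.
  The Dyson term of order \<open>n\<close> is therefore the \<open>n\<close>-particle part of the
  inner product.\<close>

lemma cmpo_represents_identity: "cmpo_represents l 1 (fock_inner l)"
proof -
  let ?Z = "\<lambda>x :: real. 0\<^sub>m 1 1 :: complex mat" and ?T = "\<lambda>x :: real. 1\<^sub>m 1 :: complex mat"
  have "cmpo_data l 1 (1\<^sub>m 1) ?Z ?Z ?Z ?T"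
    by (auto simp: cmpo_data_def mat_fun_def L1_0 L2_0 Linf_const)
  moreover have "(\<forall>\<alpha>. set_integrable (seg_pow l (length \<alpha>)) (ordered_points (length \<alpha>))
        (cmpo_integrand l 1 (1\<^sub>m 1) ?Z ?Z ?Z ?T (sector M \<Phi>) (sector N \<Psi>) \<alpha>)) \<and>
      cmpo_elem l 1 (1\<^sub>m 1) ?Z ?Z ?Z ?T (sector M \<Phi>) (sector N \<Psi>) = fock_inner l (sector M \<Phi>) (sector N \<Psi>)"
    if "\<Phi> \<in> fock_space l" "\<Psi> \<in> fock_space l" for \<Phi> \<Psi> M N
  proof -
    define \<Phi>' where "\<Phi>' = sector M \<Phi>"
    define \<Psi>' where "\<Psi>' = sector N \<Psi>"
    have F: "\<Phi>' \<in> fock_space l" "\<Psi>' \<in> fock_space l"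
      unfolding \<Phi>'_def \<Psi>'_def using that by (auto intro: sector_fock_space)
    let ?i = "cmpo_integrand l 1 (1\<^sub>m 1) ?Z ?Z ?Z ?T \<Phi>' \<Psi>'"
    let ?g = "\<lambda>n x. fact n * (cnj (\<Phi>' n x) * \<Psi>' n x)"
    let ?A = "\<lambda>n. replicate n Ad_leg"
    have eq: "?i \<alpha> x = (if \<alpha> = ?A (length \<alpha>) then ?g (length \<alpha>) x else 0)"
      if x: "x \<in> space (seg_pow l (length \<alpha>))" for \<alpha> x
    proof (cases "\<alpha> = ?A (length \<alpha>)")
      case True
      then obtain n where \<alpha>: "\<alpha> = ?A n" by blast
      have ext: "x \<in> extensional {..<n}" using x \<alpha> by (auto simp: space_seg_pow PiE_def)
      have "ket_points \<alpha> x = map x [0..<n]" "bra_points \<alpha> x = map x [0..<n]"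
        unfolding \<alpha> ket_points_def bra_points_def by (auto intro!: arg_cong[where f="map x"] filter_True)
      then have "?i \<alpha> x = ?g n x"
        using ext unfolding cmpo_integrand_def mat_string_identity
        by (simp add: \<alpha> vac_amp_extensional mat_trace_def mult_ac sqrt_fact_self)
      then show ?thesis by (simp add: \<alpha>)
    next
      case False
      then obtain i where "i < length \<alpha>" "\<alpha> ! i \<noteq> Ad_leg"
        by (metis length_replicate nth_equalityI nth_replicate)
      then have "\<not> (\<forall>z\<in>set (map (\<lambda>i. (x i, \<alpha> ! i)) [0..<length \<alpha>]). snd z = Ad_leg)" by auto
      then show ?thesis
        unfolding cmpo_integrand_def mat_string_identity using False by (auto simp: mat_trace_def)
    qed
    have gi: "set_integrable (seg_pow l n) (ordered_points n) (?g n)" for n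
      by (intro set_integrable_mult_right set_integrable_ordered_points fock_product_integrable[OF F])
    have zi: "set_integrable M' A (\<lambda>x. 0 :: complex)" for M' :: "(nat \<Rightarrow> real) measure" and A
      by (simp add: set_integrable_def)
    have "set_integrable (seg_pow l (length \<alpha>)) (ordered_points (length \<alpha>)) (?i \<alpha>)" for \<alpha>
    proof -
      have "set_integrable (seg_pow l (length \<alpha>)) (ordered_points (length \<alpha>))
          (\<lambda>x. if b then ?g (length \<alpha>) x else 0)" for b
        using gi zi by (cases b) (simp_all only: if_True if_False)
      then show ?thesis by (rule set_integral_cong_space(2)[THEN iffD1, rotated]) (simp only: eq)
    qed
    moreover have "(\<Sum>\<alpha> | length \<alpha> = n. LINT x:ordered_points n|seg_pow l n. ?i \<alpha> x) =
        (LINT x|seg_pow l n. cnj (\<Phi>' n x) * \<Psi>' n x)" for n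
    proof -
      have "(LINT x:ordered_points n|seg_pow l n. ?i \<alpha> x) =
          (if \<alpha> = ?A n then LINT x|seg_pow l n. cnj (\<Phi>' n x) * \<Psi>' n x else 0)" if "length \<alpha> = n" for \<alpha>
      proof -
        have "(LINT x:ordered_points n|seg_pow l n. ?i \<alpha> x) =
            (LINT x:ordered_points n|seg_pow l n. if \<alpha> = ?A n then ?g n x else 0)"
          by (rule set_integral_cong_space(1)) (use eq that in auto)
        then show ?thesis
          using fock_product_integral_ordered[OF F, of n] by (cases "\<alpha> = ?A n") simp_all
      qed
      then have "(\<Sum>\<alpha> | length \<alpha> = n. LINT x:ordered_points n|seg_pow l n. ?i \<alpha> x) =
          (\<Sum>\<alpha> | length \<alpha> = n. if \<alpha> = ?A n then LINT x|seg_pow l n. cnj (\<Phi>' n x) * \<Psi>' n x else 0)"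
        by (intro sum.cong refl) simp
      then show ?thesis by (simp add: finite_legs)
    qed
    ultimately show ?thesis
      unfolding \<Phi>'_def[symmetric] \<Psi>'_def[symmetric] cmpo_elem_integrand fock_inner_def by simp
  qed
  ultimately show ?thesis unfolding cmpo_represents_def by blast
qed

subsection \<open>Rank-one operators between matrix product states\<close>

lemma mat_fun_kron_one_right:
  assumes "mat_fun l n (L2 l) F"
  shows "mat_fun l (n * m) (L2 l) (\<lambda>x. kron (F x) (1\<^sub>m m))"
  unfolding mat_fun_def
proof (intro conjI ballI allI impI)
  fix i j assume ij: "i < n * m" "j < n * m"
  note b = div_mod_less_mult[OF ij(1)] div_mod_less_mult[OF ij(2)]
  have "L2 l (\<lambda>x. 1\<^sub>m m $$ (i mod m, j mod m) * F x $$ (i div m, j div m))"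
    using assms b by (intro L2_mult) (simp add: mat_fun_def)
  also have "L2 l (\<lambda>x. 1\<^sub>m m $$ (i mod m, j mod m) * F x $$ (i div m, j div m)) =
      L2 l (\<lambda>x. kron (F x) (1\<^sub>m m) $$ (i, j))"
    by (rule L2_cong) (simp add: kron_index[OF mat_fun_carrier[OF assms] one_carrier_mat ij])
  finally show "L2 l (\<lambda>x. kron (F x) (1\<^sub>m m) $$ (i, j))" .
qed (use mat_fun_carrier[OF assms] in \<open>auto intro: kron_carrier\<close>)

lemma mat_fun_kron_one_left:
  assumes "mat_fun l m (L2 l) F"
  shows "mat_fun l (n * m) (L2 l) (\<lambda>x. kron (1\<^sub>m n) (F x))"
  unfolding mat_fun_def
proof (intro conjI ballI allI impI)
  fix i j assume ij: "i < n * m" "j < n * m"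
  note b = div_mod_less_mult[OF ij(1)] div_mod_less_mult[OF ij(2)]
  have "L2 l (\<lambda>x. 1\<^sub>m n $$ (i div m, j div m) * F x $$ (i mod m, j mod m))"
    using assms b by (intro L2_mult) (simp add: mat_fun_def)
  also have "L2 l (\<lambda>x. 1\<^sub>m n $$ (i div m, j div m) * F x $$ (i mod m, j mod m)) =
      L2 l (\<lambda>x. kron (1\<^sub>m n) (F x) $$ (i, j))"
    by (rule L2_cong) (simp add: kron_index[OF one_carrier_mat mat_fun_carrier[OF assms] ij])
  finally show "L2 l (\<lambda>x. kron (1\<^sub>m n) (F x) $$ (i, j))" .
qed (use mat_fun_carrier[OF assms] in \<open>auto intro: kron_carrier\<close>)

lemma mat_fun_L2_cnj:
  assumes "mat_fun l n (L2 l) F"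
  shows "mat_fun l n (L2 l) (\<lambda>x. map_mat cnj (F x))"
  unfolding mat_fun_def
proof (intro conjI ballI allI impI)
  fix i j assume ij: "i < n" "j < n"
  have "L2 l (\<lambda>x. cnj (F x $$ (i, j)))" using assms ij by (intro L2_cnj) (simp add: mat_fun_def)
  also have "L2 l (\<lambda>x. cnj (F x $$ (i, j))) = L2 l (\<lambda>x. map_mat cnj (F x) $$ (i, j))"
    using mat_fun_carrier[OF assms] ij by (intro L2_cong) (metis carrier_matD index_map_mat(1))
  finally show "L2 l (\<lambda>x. map_mat cnj (F x) $$ (i, j))" .
qed (use mat_fun_carrier[OF assms] in auto)

text \<open>The wave function sorts its arguments before forming the string; on a list that is
  already sorted this has no effect, and only the normalisation remains.\<close>

lemma cmps_sorted:
  assumes "sorted ys" "length ys = n"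
  shows "mat_trace (B * mat_string D Q (- l / 2) (l / 2) (map (\<lambda>y. (y, L y)) ys)) =
    complex_of_real (sqrt (fact n)) * cmps l D B Q L n (\<lambda>i\<in>{..<n}. ys ! i)"
proof -
  have "map (\<lambda>i\<in>{..<n}. ys ! i) [0..<n] = ys"
    using assms(2) by (intro nth_equalityI) auto
  then show ?thesis
    using sorted_sort_id[OF assms(1)] by (simp add: cmps_def)
qed

lemma shuffle_legs_iff:
  assumes "Ad_leg \<notin> set \<alpha>"
  shows "\<alpha> \<in> shuffle_legs m n \<longleftrightarrow> length (ket_positions \<alpha>) = m \<and> length (bra_positions \<alpha>) = n"
proof
  assume "\<alpha> \<in> shuffle_legs m n"
  then show "length (ket_positions \<alpha>) = m \<and> length (bra_positions \<alpha>) = n"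
    using shuffle_legs_positions by blast
next
  assume mn: "length (ket_positions \<alpha>) = m \<and> length (bra_positions \<alpha>) = n"
  have "length (ket_positions \<alpha>) \<le> length \<alpha>"
    unfolding ket_positions_def using length_filter_le[of _ "[0..<length \<alpha>]"] by simp
  \<comment> \<open>There are at most \<open>length \<alpha>\<close> creators, so the truncated
    subtraction is exact.\<close>
  then have "\<alpha> \<in> shuffle_legs m (length \<alpha> - m)"
    using assms mn by (simp add: shuffle_legs_def)
  moreover from this have "length \<alpha> - m = n" using shuffle_legs_positions(4) mn by metis
  ultimately show "\<alpha> \<in> shuffle_legs m n" by simp
qed

lemma sorted_points:
  assumes "x \<in> ordered_points (length \<alpha>)"
  shows "sorted (ket_points \<alpha> x)" "sorted (bra_points \<alpha> x)"
proof -
  have "sorted (map x is)" if "sorted_wrt (<) is" "set is \<subseteq> {..<length \<alpha>}" for "is"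
    unfolding sorted_map
    by (rule sorted_wrt_mono_rel[OF _ that(1)])
       (use that(2) assms in \<open>auto simp: ordered_points_def intro!: less_imp_le\<close>)
  note * = this
  show "sorted (ket_points \<alpha> x)"
    unfolding ket_points_positions by (rule *[OF sorted_ket_positions]) (auto simp: ket_positions_def)
  show "sorted (bra_points \<alpha> x)"
    unfolding bra_points_positions by (rule *[OF sorted_bra_positions]) (auto simp: bra_positions_def)
qed

lemma mat_trace_smult: "A \<in> carrier_mat n n \<Longrightarrow> mat_trace (c \<cdot>\<^sub>m A) = c * mat_trace A"
  by (auto simp: mat_trace_def sum_distrib_left)

lemma cmpo_represents_ket_bra:
  assumes l: "l > 0" and d1: "cmps_data l D1 B1 Q1 K1" and d2: "cmps_data l D2 B2 Q2 K2"
    and \<psi>1: "cmps l D1 B1 Q1 K1 \<in> fock_space l" and \<psi>2: "cmps l D2 B2 Q2 K2 \<in> fock_space l"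
  shows "cmpo_represents l (D1 * D2)
    (\<lambda>\<Phi> \<Psi>. c * (fock_inner l \<Phi> (cmps l D1 B1 Q1 K1) * fock_inner l (cmps l D2 B2 Q2 K2) \<Psi>))"
proof -
  let ?p1 = "cmps l D1 B1 Q1 K1" and ?p2 = "cmps l D2 B2 Q2 K2"
  have B: "B1 \<in> carrier_mat D1 D1" "B2 \<in> carrier_mat D2 D2"
    and Q: "mat_fun l D1 (L1 l) Q1" "mat_fun l D2 (L1 l) Q2"
    and K: "mat_fun l D1 (L2 l) K1" "mat_fun l D2 (L2 l) K2"
    using d1 d2 by (auto simp: cmps_data_def)
  note Kc = mat_fun_carrier[OF K(1)] mat_fun_carrier[OF K(2)]
  interpret g1: L1_generator l D1 Q1 by (rule mat_fun_L1_generator[OF Q(1)])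
  interpret g2: L1_generator l D2 Q2 by (rule mat_fun_L1_generator[OF Q(2)])
  interpret g2': L1_generator l D2 "\<lambda>x. map_mat cnj (Q2 x)" by (rule g2.cnj_generator)
  interpret L1_generator_pair l D1 D2 Q1 "\<lambda>x. map_mat cnj (Q2 x)" ..
  let ?B = "kron (c \<cdot>\<^sub>m B1) (map_mat cnj B2)" and ?Q = "\<lambda>x. kron_sum D1 D2 (Q1 x) (map_mat cnj (Q2 x))"
    and ?L = "\<lambda>x. kron (K1 x) (1\<^sub>m D2)" and ?R = "\<lambda>x. kron (1\<^sub>m D1) (map_mat cnj (K2 x))"
    and ?T = "\<lambda>x :: real. 0\<^sub>m (D1 * D2) (D1 * D2) :: complex mat"
  have data: "cmpo_data l (D1 * D2) ?B ?Q ?L ?R ?T"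
    unfolding cmpo_data_def
    using B kron.L1 mat_fun_kron_one_right[OF K(1)] mat_fun_kron_one_left[OF mat_fun_L2_cnj[OF K(2)]]
    by (auto intro!: kron_carrier simp: mat_fun_def Linf_const)
  moreover have "(\<forall>\<alpha>. set_integrable (seg_pow l (length \<alpha>)) (ordered_points (length \<alpha>))
        (cmpo_integrand l (D1 * D2) ?B ?Q ?L ?R ?T (sector M \<Phi>) (sector N \<Psi>) \<alpha>)) \<and>
      cmpo_elem l (D1 * D2) ?B ?Q ?L ?R ?T (sector M \<Phi>) (sector N \<Psi>) =
      c * (fock_inner l (sector M \<Phi>) ?p1 * fock_inner l ?p2 (sector N \<Psi>))"
    if F: "\<Phi> \<in> fock_space l" "\<Psi> \<in> fock_space l" for \<Phi> \<Psi> M N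
  proof -
    let ?i = "cmpo_integrand l (D1 * D2) ?B ?Q ?L ?R ?T (sector M \<Phi>) (sector N \<Psi>)"
    \<comment> \<open>Each factorial combines a square root from the normalisation of
      \<open>cmps\<close> with one from \<open>vac_amp\<close>. The scalar \<open>c\<close> is
      carried by \<open>?f\<close> so that it occurs exactly once.\<close>
    let ?f = "\<lambda>y. c * (fact M * (cnj (\<Phi> M y) * ?p1 M y))" and ?g = "\<lambda>z. fact N * (cnj (?p2 N z) * \<Psi> N z)"
    let ?h = "\<lambda>\<alpha> x. ?f (\<lambda>i\<in>{..<M}. ket_points \<alpha> x ! i) * ?g (\<lambda>i\<in>{..<N}. bra_points \<alpha> x ! i)"
    have eq: "?i \<alpha> x = (if \<alpha> \<in> shuffle_legs M N then ?h \<alpha> x else 0)"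
      if x: "x \<in> space (seg_pow l (length \<alpha>))" "x \<in> ordered_points (length \<alpha>)" for \<alpha> x
    proof -
      define zs where "zs = map (\<lambda>i. (x i, \<alpha> ! i)) [0..<length \<alpha>]"
      have zs: "y \<in> seg l" if "(y, g) \<in> set zs" for y g
        using that seg_pow_space_seg[OF x(1)] by (auto simp: zs_def)
      have C: "leg_mat (?L y) (?R y) (?T y) g \<in> carrier_mat (D1 * D2) (D1 * D2)" if "y \<in> seg l" for y g
        using leg_mat_carrier[OF data that] .
      \<comment> \<open>An \<open>Ad_leg\<close> is killed by \<open>T = 0\<close>, wrong particle
        numbers are killed by the sectors, and the shuffles are the remaining words.\<close>
      consider "Ad_leg \<in> set \<alpha>" | "Ad_leg \<notin> set \<alpha>" "\<alpha> \<notin> shuffle_legs M N" | "\<alpha> \<in> shuffle_legs M N"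
        by blast
      then show ?thesis
      proof cases
        case 1
        then obtain i where i: "i < length \<alpha>" "\<alpha> ! i = Ad_leg" by (metis in_set_conv_nth)
        then have "(x i, Ad_leg) \<in> set zs" by (force simp: zs_def)
        then have "(x i, 0\<^sub>m (D1 * D2) (D1 * D2)) \<in> set (map (\<lambda>(y, g). (y, leg_mat (?L y) (?R y) (?T y) g)) zs)"
          by force
        then have "mat_string (D1 * D2) ?Q (- l / 2) (l / 2) (map (\<lambda>(y, g). (y, leg_mat (?L y) (?R y) (?T y) g)) zs) =
            0\<^sub>m (D1 * D2) (D1 * D2)"
          using zs C by (intro mat_string_zero) auto
        moreover have "?B * 0\<^sub>m (D1 * D2) (D1 * D2) = 0\<^sub>m (D1 * D2) (D1 * D2)"
          using B by (intro right_mult_zero_mat kron_carrier) auto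
        ultimately have "?i \<alpha> x = 0"
          unfolding cmpo_integrand_def zs_def[symmetric] by (simp add: mat_trace_def)
        moreover have "\<alpha> \<notin> shuffle_legs M N" using 1 by (simp add: shuffle_legs_def)
        ultimately show ?thesis by simp
      next
        case 2
        then have "length (ket_positions \<alpha>) \<noteq> M \<or> length (bra_positions \<alpha>) \<noteq> N"
          using shuffle_legs_iff by blast
        from cmpo_integrand_sector_zero[OF this] 2(2) show ?thesis by (simp only: if_False)
      next
        case 3
        have Ad: "Ad_leg \<notin> set \<alpha>" using 3 by (simp add: shuffle_legs_def)
        have len: "length (ket_points \<alpha> x) = M" "length (bra_points \<alpha> x) = N"
          using shuffle_legs_positions(3,4)[OF 3] by (simp_all add: ket_points_positions bra_points_positions)
        have pts: "y \<in> seg l" if "y \<in> set (ket_points \<alpha> x) \<union> set (bra_points \<alpha> x)" for y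
          using that seg_pow_space_seg[OF x(1)] by (auto simp: ket_points_def bra_points_def)
        let ?S1 = "mat_string D1 Q1 (- l / 2) (l / 2) (map (\<lambda>y. (y, K1 y)) (ket_points \<alpha> x))"
        let ?S2 = "mat_string D2 Q2 (- l / 2) (l / 2) (map (\<lambda>y. (y, K2 y)) (bra_points \<alpha> x))"
        have S: "?S1 \<in> carrier_mat D1 D1" "?S2 \<in> carrier_mat D2 D2"
          using pts Kc by (intro mat_string_carrier; auto)+
        have kets: "map (\<lambda>z. (fst z, K1 (fst z))) (filter (\<lambda>z. snd z \<noteq> Right_leg) zs) = map (\<lambda>y. (y, K1 y)) (ket_points \<alpha> x)"
          by (simp add: zs_def ket_points_def filter_map comp_def)
        have bras: "map (\<lambda>z. (fst z, map_mat cnj (K2 (fst z)))) (filter (\<lambda>z. snd z \<noteq> Left_leg) zs) =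
            map (\<lambda>(y, K). (y, map_mat cnj K)) (map (\<lambda>y. (y, K2 y)) (bra_points \<alpha> x))"
          by (simp add: zs_def bra_points_def filter_map comp_def)
        have "mat_string (D1 * D2) ?Q (- l / 2) (l / 2) (map (\<lambda>(y, g). (y, leg_mat (?L y) (?R y) (?T y) g)) zs) =
            kron ?S1 (mat_string D2 (\<lambda>x. map_mat cnj (Q2 x)) (- l / 2) (l / 2)
              (map (\<lambda>(y, K). (y, map_mat cnj K)) (map (\<lambda>y. (y, K2 y)) (bra_points \<alpha> x))))"
          unfolding kets[symmetric] bras[symmetric]
        proof (rule mat_string_kron)
          show "sorted (map fst zs)"
            using x(2) by (simp add: zs_def comp_def ordered_points_iff_sorted strict_sorted_iff)
          show "y \<in> seg l \<and> - l / 2 \<le> y \<and> y \<le> l / 2 \<and> g \<noteq> Ad_leg" if "(y, g) \<in> set zs" for y g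
          proof -
            obtain i where "i < length \<alpha>" "g = \<alpha> ! i" using \<open>(y, g) \<in> set zs\<close> by (auto simp: zs_def)
            then have "g \<noteq> Ad_leg" using Ad nth_mem by metis
            then show ?thesis using zs[OF that] by (auto simp: seg_def)
          qed
        qed (use l seg_endpoints Kc in auto)
        also have "mat_string D2 (\<lambda>x. map_mat cnj (Q2 x)) (- l / 2) (l / 2)
              (map (\<lambda>(y, K). (y, map_mat cnj K)) (map (\<lambda>y. (y, K2 y)) (bra_points \<alpha> x))) = map_mat cnj ?S2"
        proof (rule g2.mat_string_cnj)
          show "y \<in> seg l \<and> - l / 2 \<le> y \<and> y \<le> l / 2 \<and> K \<in> carrier_mat D2 D2"
            if "(y, K) \<in> set (map (\<lambda>y. (y, K2 y)) (bra_points \<alpha> x))" for y K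
            using that pts[of y] Kc by (auto simp: seg_def)
          show "sorted (map fst (map (\<lambda>y. (y, K2 y)) (bra_points \<alpha> x)))"
            using sorted_points(2)[OF x(2)] by (simp add: comp_def)
        qed (use l seg_endpoints in auto)
        finally have str: "mat_string (D1 * D2) ?Q (- l / 2) (l / 2)
            (map (\<lambda>(y, g). (y, leg_mat (?L y) (?R y) (?T y) g)) zs) = kron ?S1 (map_mat cnj ?S2)" .
        have "?B * kron ?S1 (map_mat cnj ?S2) = kron (c \<cdot>\<^sub>m (B1 * ?S1)) (map_mat cnj (B2 * ?S2))"
          unfolding map_mat_mult_cnj[OF B(2) S(2)] mult_smult_assoc_mat[OF B(1) S(1), symmetric]
          using B S by (intro kron_mult[where n = D1 and m = D2]) auto
        then have "mat_trace (?B * kron ?S1 (map_mat cnj ?S2)) = c * mat_trace (B1 * ?S1) * cnj (mat_trace (B2 * ?S2))"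
          using mult_carrier_mat[OF B(1) S(1)] mult_carrier_mat[OF B(2) S(2)]
          by (simp add: mat_trace_kron[where n = D1 and m = D2] mat_trace_smult[where n = D1] mat_trace_map_cnj[where n = D2])
        also have "mat_trace (B1 * ?S1) = complex_of_real (sqrt (fact M)) * ?p1 M (\<lambda>i\<in>{..<M}. ket_points \<alpha> x ! i)"
          by (rule cmps_sorted[OF sorted_points(1)[OF x(2)] len(1)])
        also have "mat_trace (B2 * ?S2) = complex_of_real (sqrt (fact N)) * ?p2 N (\<lambda>i\<in>{..<N}. bra_points \<alpha> x ! i)"
          by (rule cmps_sorted[OF sorted_points(2)[OF x(2)] len(2)])
        finally have tr: "mat_trace (?B * kron ?S1 (map_mat cnj ?S2)) =
            c * (complex_of_real (sqrt (fact M)) * ?p1 M (\<lambda>i\<in>{..<M}. ket_points \<alpha> x ! i)) *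
            cnj (complex_of_real (sqrt (fact N)) * ?p2 N (\<lambda>i\<in>{..<N}. bra_points \<alpha> x ! i))" .
        have "?i \<alpha> x = ?h \<alpha> x"
          unfolding cmpo_integrand_def zs_def[symmetric] str tr vac_amp_def len sector_def
          by (simp only: refl if_True complex_cnj_mult complex_cnj_complex_of_real mult_ac
              sqrt_fact_self sqrt_fact_self_left)
        with 3 show ?thesis by (simp only: if_True)
      qed
    qed
    have fi: "integrable (seg_pow l M) ?f" "integrable (seg_pow l N) ?g"
      by (intro integrable_mult_right fock_product_integrable F \<psi>1 \<psi>2)+
    have ints: "set_integrable (seg_pow l (length \<alpha>)) (ordered_points (length \<alpha>)) (?i \<alpha>)" for \<alpha>
    proof -
      have "set_integrable (seg_pow l (length \<alpha>)) (ordered_points (length \<alpha>))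
          (\<lambda>x. if \<alpha> \<in> shuffle_legs M N then ?h \<alpha> x else 0)"
      proof (cases "\<alpha> \<in> shuffle_legs M N")
        case True
        then have "length \<alpha> = M + N" by (simp add: shuffle_legs_def)
        with True show ?thesis using integrable_shuffle[OF fi True] by (simp only: if_True)
      qed (simp add: set_integrable_def)
      then show ?thesis by (rule set_integral_cong_space(2)[THEN iffD1, rotated]) (simp only: eq)
    qed
    have int: "(LINT x:ordered_points n|seg_pow l n. ?i \<alpha> x) =
        (if \<alpha> \<in> shuffle_legs M N then LINT x:ordered_points n|seg_pow l n. ?h \<alpha> x else 0)"
      if "length \<alpha> = n" for \<alpha> n
    proof -
      have "(LINT x:ordered_points n|seg_pow l n. ?i \<alpha> x) =
          (LINT x:ordered_points n|seg_pow l n. if \<alpha> \<in> shuffle_legs M N then ?h \<alpha> x else 0)"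
        unfolding that[symmetric] by (rule set_integral_cong_space(1)) (simp only: eq)
      then show ?thesis
        by (cases "\<alpha> \<in> shuffle_legs M N") (simp_all only: if_True if_False set_integral_indicator_zero)
    qed
    \<comment> \<open>The letters of a shuffle are \<open>M\<close> creators and \<open>N\<close>
      annihilators, all at distinct positions, so only the order \<open>M + N\<close>
      contributes.\<close>
    have "(\<Sum>\<alpha> | length \<alpha> = n. LINT x:ordered_points n|seg_pow l n. ?i \<alpha> x) =
        (if n = M + N then \<Sum>\<alpha>\<in>shuffle_legs M N. LINT x:ordered_points (M + N)|seg_pow l (M + N). ?h \<alpha> x else 0)" for n
    proof (cases "n = M + N")
      case True
      have "(\<Sum>\<alpha> | length \<alpha> = n. LINT x:ordered_points n|seg_pow l n. ?i \<alpha> x) =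
          (\<Sum>\<alpha>\<in>shuffle_legs M N. LINT x:ordered_points n|seg_pow l n. ?h \<alpha> x)"
      proof (rule sum.mono_neutral_cong_right)
        show "shuffle_legs M N \<subseteq> {\<alpha>. length \<alpha> = n}" using True by (auto simp: shuffle_legs_def)
        then show "(LINT x:ordered_points n|seg_pow l n. ?i \<alpha> x) = (LINT x:ordered_points n|seg_pow l n. ?h \<alpha> x)"
          if "\<alpha> \<in> shuffle_legs M N" for \<alpha> using that by (subst int) (auto simp only: if_True)
        show "\<forall>\<alpha>\<in>{\<alpha>. length \<alpha> = n} - shuffle_legs M N. (LINT x:ordered_points n|seg_pow l n. ?i \<alpha> x) = 0"
        proof
          fix \<alpha> assume "\<alpha> \<in> {\<alpha>. length \<alpha> = n} - shuffle_legs M N"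
          then have "length \<alpha> = n" "\<alpha> \<notin> shuffle_legs M N" by auto
          then show "(LINT x:ordered_points n|seg_pow l n. ?i \<alpha> x) = 0" by (simp only: int if_False)
        qed
      qed (rule finite_legs)
      then show ?thesis by (simp only: True refl if_True)
    next
      case False
      have "(LINT x:ordered_points n|seg_pow l n. ?i \<alpha> x) = 0" if "length \<alpha> = n" for \<alpha>
      proof -
        have "\<alpha> \<notin> shuffle_legs M N" using that False by (auto simp: shuffle_legs_def)
        then show ?thesis by (simp only: int[OF that] if_False)
      qed
      with False show ?thesis by (simp only: if_False) (rule sum.neutral, simp)
    qed
    then have "cmpo_elem l (D1 * D2) ?B ?Q ?L ?R ?T (sector M \<Phi>) (sector N \<Psi>) =
        (\<Sum>n. if n = M + N then \<Sum>\<alpha>\<in>shuffle_legs M N. LINT x:ordered_points (M + N)|seg_pow l (M + N). ?h \<alpha> x else 0)"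
      unfolding cmpo_elem_integrand by (intro suminf_cong)
    also have "\<dots> = (\<Sum>\<alpha>\<in>shuffle_legs M N. LINT x:ordered_points (M + N)|seg_pow l (M + N). ?h \<alpha> x)"
      by (subst suminf_finite[of "{M + N}"]) auto
    also have "\<dots> = (LINT y:ordered_points M|seg_pow l M. ?f y) * (LINT z:ordered_points N|seg_pow l N. ?g z)"
      by (rule integral_shuffle[OF fi])
    also have "\<dots> = c * (fock_inner l (sector M \<Phi>) ?p1 * fock_inner l ?p2 (sector N \<Psi>))"
      unfolding fock_inner_sector_left fock_inner_sector_right
      using fock_product_integral_ordered[OF F(1) \<psi>1, of M] fock_product_integral_ordered[OF \<psi>2 F(2), of N]
      by (simp only: set_integral_mult_right mult.assoc)
    finally show ?thesis using ints by blast
  qed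
  ultimately show ?thesis unfolding cmpo_represents_def by blast
qed

theorem mainTheorem5:
  fixes l :: real
    and d :: "nat \<Rightarrow> nat"
    and B :: "nat \<Rightarrow> complex mat"
    and Q L :: "nat \<Rightarrow> real \<Rightarrow> complex mat"
    and \<psi> :: "nat \<Rightarrow> fock"
    and V :: "complex mat"
    and U :: "fock \<Rightarrow> fock"
  assumes "l > 0"
    and "\<And>i. i < 2 \<Longrightarrow> cmps_data l (d i) (B i) (Q i) (L i)"
    and "\<And>i. i < 2 \<Longrightarrow> \<psi> i = cmps l (d i) (B i) (Q i) (L i)"
    and "\<And>i. i < 2 \<Longrightarrow> \<psi> i \<in> fock_space l"
    and "\<And>i j. i < 2 \<Longrightarrow> j < 2 \<Longrightarrow> fock_inner l (\<psi> i) (\<psi> j) = of_bool (i = j)"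
    and "V \<in> carrier_mat 2 2"
    and "mat_adjoint V * V = 1\<^sub>m 2"
    and "V * mat_adjoint V = 1\<^sub>m 2"
    and "U = (\<lambda>\<Psi> n x. \<Psi> n x +
           (\<Sum>i<2. \<Sum>j<2. (V $$ (i, j) - of_bool (i = j)) * ket_bra l (\<psi> i) (\<psi> j) \<Psi> n x))"
  shows "is_cmpu l (1 + (\<Sum>i<2. \<Sum>j<2. d i * d j)) U"
proof -
  define \<phi> \<eta> where \<phi>_def: "\<phi> = \<psi> 0" and \<eta>_def: "\<eta> = \<psi> 1"
  define A where "A i j = V $$ (i, j) - of_bool (i = j)" for i j :: nat
  have F: "\<phi> \<in> fock_space l" "\<eta> \<in> fock_space l" using assms(4) by (auto simp: \<phi>_def \<eta>_def)
  have unitary: "fock_unitary l U"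
    using assms(4-9) by (rule fock_unitary_two_dim)
  have r: "cmpo_represents l (d i * d j) (\<lambda>\<Phi> \<Psi>. A i j * (fock_inner l \<Phi> (\<psi> i) * fock_inner l (\<psi> j) \<Psi>))"
    if "i < 2" "j < 2" for i j
    using cmpo_represents_ket_bra[OF assms(1) assms(2)[OF that(1)] assms(2)[OF that(2)]] assms(3,4) that by simp
  \<comment> \<open>The identity contributes the summand \<open>1\<close>, and each of the four
    pairs keeps its own block of size \<open>d i * d j\<close> whatever the value of its
    coefficient.\<close>
  have "cmpo_represents l (1 + ((d 0 * d 0 + d 0 * d 1) + (d 1 * d 0 + d 1 * d 1)))
      (\<lambda>\<Phi> \<Psi>. fock_inner l \<Phi> \<Psi> +
        ((A 0 0 * (fock_inner l \<Phi> \<phi> * fock_inner l \<phi> \<Psi>) + A 0 1 * (fock_inner l \<Phi> \<phi> * fock_inner l \<eta> \<Psi>)) +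
         (A 1 0 * (fock_inner l \<Phi> \<eta> * fock_inner l \<phi> \<Psi>) + A 1 1 * (fock_inner l \<Phi> \<eta> * fock_inner l \<eta> \<Psi>))))"
    unfolding \<phi>_def \<eta>_def
    by (intro cmpo_represents_add[OF assms(1)] r cmpo_represents_identity) simp_all
  moreover have "fock_inner l \<Phi> (U \<Psi>) = fock_inner l \<Phi> \<Psi> +
        ((A 0 0 * (fock_inner l \<Phi> \<phi> * fock_inner l \<phi> \<Psi>) + A 0 1 * (fock_inner l \<Phi> \<phi> * fock_inner l \<eta> \<Psi>)) +
         (A 1 0 * (fock_inner l \<Phi> \<eta> * fock_inner l \<phi> \<Psi>) + A 1 1 * (fock_inner l \<Phi> \<eta> * fock_inner l \<eta> \<Psi>)))"
    if "\<Phi> \<in> fock_space l" "\<Psi> \<in> fock_space l" for \<Phi> \<Psi>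
  proof -
    \<comment> \<open>Collecting the four rank-one terms by their ket vector writes the image as a
      combination of three vectors, to which linearity of the inner product applies.\<close>
    define p where "p = A 0 0 * fock_inner l \<phi> \<Psi> + A 0 1 * fock_inner l \<eta> \<Psi>"
    define q where "q = A 1 0 * fock_inner l \<phi> \<Psi> + A 1 1 * fock_inner l \<eta> \<Psi>"
    have "U \<Psi> = (\<lambda>n x. p * \<phi> n x + (q * \<eta> n x + \<Psi> n x))"
      unfolding assms(9) A_def[symmetric] ket_bra_def p_def q_def \<phi>_def \<eta>_def
      by (simp add: numeral_2_eq_2 algebra_simps)
    then have "fock_inner l \<Phi> (U \<Psi>) = p * fock_inner l \<Phi> \<phi> + (q * fock_inner l \<Phi> \<eta> + fock_inner l \<Phi> \<Psi>)"
      using that F by (simp add: fock_inner_lin_right fock_space_lin)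
    then show ?thesis by (simp add: p_def q_def algebra_simps)
  qed
  \<comment> \<open>The representation is tested on vectors of the form
    \<open>sector N \<Psi>\<close>; these lie in \<open>fock_space\<close>, so the formula for the
    inner product with \<open>U\<close> applies to them.\<close>
  ultimately have "is_cmpo l (1 + ((d 0 * d 0 + d 0 * d 1) + (d 1 * d 0 + d 1 * d 1))) U"
    unfolding cmpo_represents_def is_cmpo_def by (metis sector_fock_space)
  moreover have "1 + ((d 0 * d 0 + d 0 * d 1) + (d 1 * d 0 + d 1 * d 1)) = 1 + (\<Sum>i<2. \<Sum>j<2. d i * d j)"
    by (simp add: numeral_2_eq_2)
  ultimately show ?thesis
    using unitary unfolding is_cmpu_def by (simp only:)
qed

end
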